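(* Let $f=(f_0,\dots,f_{K-1}):X=(\mathbf{C}^{N+K},0)\to(\mathbf{C}^K,0)$ be a quasihomogeneous polynomial mapping defining an isolated complete intersection singularity $X_0$ of dimension $N$ with Milnor number $\mu(X_0)$. Let $\tilde\omega_1,\dots,\tilde\omega_{\mu(X_0)}$ be quasihomogeneous $(N+1)$-forms whose classes form a basis of $F$, and let $\phi_1(u)du,\dots,\phi_{\mu(X_0)}(u)du$ be quasihomogeneous $(N+K)$-forms whose classes form a basis of $\Phi$ ($F$, $\Phi$ as in the context). Then for all $1\le i\le\mu(X_0)$ and $0\le\ell\le K-1$ there is a decomposition $$\tilde\omega_i\wedge\bigwedge_{k\neq\ell}df_k=\sum_{j=1}^{\mu(X_0)}P^{(\ell)}_{ij}\,\phi_j(u)\,du\ \bmod\ \big(df_0\wedge\cdots\wedge df_{K-1}\wedge d\Omega_X^{N-1}\big)$$ with $P^{(\ell)}_{ij}\in\mathbf{C}[f_0,\dots,f_{K-1}]$, where $\bigwedge_{k\ne\ell}df_k=df_0\wedge\cdots\wedge df_{\ell-1}\wedge df_{\ell+1}\wedge\cdots\wedge df_{K-1}$.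
   Context: $X=(\mathbf{C}^{N+K},0)$ has coordinates $u=(u_1,\dots,u_{N+K})$, and $X_y=\{u\in X:f_0(u)=y_0,\dots,f_{K-1}(u)=y_{K-1}\}$. That $f$ defines an isolated quasihomogeneous complete intersection singularity means: $\dim X_y=N\ge0$; the critical set of $f$ on $X_0$ is isolated in $X_0$; and the $f_\ell$ are polynomials for which there are positive integers $v_1,\dots,v_{N+K}$ with greatest common divisor $1$ and integers $p_0,\dots,p_{K-1}$ such that $Ef_\ell=p_\ell f_\ell$, where $E=\sum_iv_iu_i\frac{\partial}{\partial u_i}$ is the Euler vector field. $\Omega_X^p$ denotes holomorphic $p$-forms on $X$, $i_E$ inner contraction with $E$. Define $$F=\frac{\Omega_X^{N+1}}{\sum_i df_i\wedge\Omega^N_X+i_E(\Omega_X^{N+2})},\qquad \Phi=\frac{\Omega_X^{N+K}}{df_0\wedge\cdots\wedge df_{K-1}\wedge\Omega_X^N+\sum_i f_i\Omega_X^{N+K}};$$ both have dimension $\mu(X_0)$ over $\mathbf{C}$.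
   Formalization: For N=0 and K≥2, where dΩ^{-1} is undefined and the claim fails if it is read as 0 (e.g. f=(x²,y²), ω̃=(x+y)dx), the modulus is taken to be df_0∧…∧df_{K-1}·C[f_0,…,f_{K-1}]; for N≥1, and for N=0, K=1 with Ω^{-1}=0, the statement is literal. *)

theory Defs
  imports
    "HOL-Analysis.Analysis"
    "HOL-Homology.Homology"
    "HOL-Library.Function_Algebras"
begin

section \<open>Holomorphic functions of several variables near a point\<close>

text \<open>Coordinates are indexed by a finite linearly ordered type \<open>'n\<close>; the order only fixes
  signs of forms.  Germs are handled through representatives: all conditions below only concern
  the behaviour near the point, and equalities of germs are equalities on a neighbourhood.\<close>

definition holo_near :: "complex ^ 'n::finite \<Rightarrow> (complex ^ 'n \<Rightarrow> complex) \<Rightarrow> bool" where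
  "holo_near a g \<longleftrightarrow>
     (\<forall>\<^sub>F u in nhds a. \<exists>D::complex ^ 'n. (g has_derivative (\<lambda>h. \<Sum>i\<in>UNIV. D $ i * h $ i)) (at u))"

definition partial :: "'n::finite \<Rightarrow> (complex ^ 'n \<Rightarrow> complex) \<Rightarrow> complex ^ 'n \<Rightarrow> complex" where
  "partial i g u = deriv (\<lambda>z. g (u + axis i z)) 0"

text \<open>The algebra \<open>\<complex>[g\<^sub>i : i \<in> V]\<close> generated by functions \<open>g\<^sub>i\<close>; a multi-index
  is a function \<open>m\<close>.\<close>

definition poly_algebra :: "'i set \<Rightarrow> ('i \<Rightarrow> 'a \<Rightarrow> complex) \<Rightarrow> ('a \<Rightarrow> complex) set" where
  "poly_algebra V g =
     {h. \<exists>S (c :: ('i \<Rightarrow> nat) \<Rightarrow> complex). finite S \<and>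
           h = (\<lambda>u. \<Sum>m\<in>S. c m * (\<Prod>i\<in>V. g i u ^ m i))}"

definition euler :: "('n::finite \<Rightarrow> nat) \<Rightarrow> (complex ^ 'n \<Rightarrow> complex) \<Rightarrow> complex ^ 'n \<Rightarrow> complex" where
  "euler v g u = (\<Sum>i\<in>UNIV. of_nat (v i) * u $ i * partial i g u)"

text \<open>Dimension of an analytic set at one of its points: the least number of holomorphic
  functions vanishing at the point that cut it out as an isolated point of the set.\<close>

definition local_dim :: "(complex ^ 'n::finite) set \<Rightarrow> complex ^ 'n \<Rightarrow> nat" where
  "local_dim S a =
     (LEAST d. \<exists>g. (\<forall>i<d. holo_near a (g i) \<and> g i a = 0) \<and>
                   (\<forall>\<^sub>F u in at a. u \<in> S \<longrightarrow> (\<exists>i<d. g i u \<noteq> 0)))"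


section \<open>Differential forms\<close>

text \<open>\<open>\<omega> I\<close> is the coefficient of \<open>du\<^bsub>i\<^sub>1\<^esub> \<and> \<dots> \<and> du\<^bsub>i\<^sub>p\<^esub>\<close>, where
  \<open>I = {i\<^sub>1 < \<dots> < i\<^sub>p}\<close>.\<close>

type_synonym 'n scalar_fn = "complex ^ 'n \<Rightarrow> complex"
type_synonym 'n form = "'n set \<Rightarrow> complex ^ 'n \<Rightarrow> complex"

definition Omega :: "nat \<Rightarrow> ('n::{finite,linorder}) form set" where
  "Omega p = {\<omega>. (\<forall>I. holo_near 0 (\<omega> I)) \<and> (\<forall>I. card I \<noteq> p \<longrightarrow> \<omega> I = 0)}"

definition germ_eq :: "('n::{finite,linorder}) form \<Rightarrow> 'n form \<Rightarrow> bool" (infix \<open>=\<^sub>0\<close> 50) where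
  "\<omega> =\<^sub>0 \<eta> \<longleftrightarrow> (\<forall>I. \<forall>\<^sub>F u in nhds 0. \<omega> I u = \<eta> I u)"

definition smult_form ::
    "'n scalar_fn \<Rightarrow> ('n::{finite,linorder}) form \<Rightarrow> 'n form" (infixr \<open>*\<^sub>\<Omega>\<close> 75) where
  "g *\<^sub>\<Omega> \<omega> = (\<lambda>I u. g u * \<omega> I u)"

definition fun_form :: "'n scalar_fn \<Rightarrow> ('n::{finite,linorder}) form" where
  "fun_form g = (\<lambda>I. if I = {} then g else 0)"

definition top_form :: "'n scalar_fn \<Rightarrow> ('n::{finite,linorder}) form" where
  "top_form g = (\<lambda>I. if I = UNIV then g else 0)"

definition shuffle_sign :: "'n::{finite,linorder} set \<Rightarrow> 'n set \<Rightarrow> complex" where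
  "shuffle_sign J L = (-1) ^ card {(j, l). j \<in> J \<and> l \<in> L \<and> l < j}"

definition wedge ::
    "('n::{finite,linorder}) form \<Rightarrow> 'n form \<Rightarrow> 'n form" (infixr \<open>\<and>\<^sub>\<Omega>\<close> 70) where
  "\<alpha> \<and>\<^sub>\<Omega> \<beta> = (\<lambda>I u. \<Sum>J\<in>Pow I. shuffle_sign J (I - J) * \<alpha> J u * \<beta> (I - J) u)"

definition ext_d :: "('n::{finite,linorder}) form \<Rightarrow> 'n form" where
  "ext_d \<omega> = (\<lambda>I u. \<Sum>i\<in>I. shuffle_sign {i} (I - {i}) * partial i (\<omega> (I - {i})) u)"

definition contract_euler :: "('n::{finite,linorder} \<Rightarrow> nat) \<Rightarrow> 'n form \<Rightarrow> 'n form" where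
  "contract_euler v \<omega> =
     (\<lambda>I u. \<Sum>i\<in>- I. shuffle_sign {i} I * of_nat (v i) * u $ i * \<omega> (insert i I) u)"

definition big_wedge :: "('n::{finite,linorder}) form list \<Rightarrow> 'n form" where
  "big_wedge \<omega>s = foldr (\<and>\<^sub>\<Omega>) \<omega>s (fun_form 1)"

abbreviation d_comp ::
    "(nat \<Rightarrow> 'n scalar_fn) \<Rightarrow> nat \<Rightarrow> ('n::{finite,linorder}) form" where
  "d_comp f k \<equiv> ext_d (fun_form (f k))"

definition df_all ::
    "nat \<Rightarrow> (nat \<Rightarrow> 'n scalar_fn) \<Rightarrow> ('n::{finite,linorder}) form" where
  "df_all K f = big_wedge (map (d_comp f) [0..<K])"

definition df_omit ::
    "nat \<Rightarrow> (nat \<Rightarrow> 'n scalar_fn) \<Rightarrow> nat \<Rightarrow> ('n::{finite,linorder}) form" where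
  "df_omit K f l = big_wedge (map (d_comp f) (filter (\<lambda>k. k \<noteq> l) [0..<K]))"

text \<open>Both \<open>u\<^sub>i\<close> and \<open>du\<^sub>i\<close> have weight \<open>v\<^sub>i\<close>, so that
  \<open>L\<^sub>E (g du\<^sub>I) = (E g + (\<Sum>i\<in>I. v\<^sub>i) g) du\<^sub>I\<close>; the condition is \<open>L\<^sub>E \<omega> = w \<omega>\<close>.\<close>

definition quasihomogeneous_form :: "('n::{finite,linorder} \<Rightarrow> nat) \<Rightarrow> 'n form \<Rightarrow> bool" where
  "quasihomogeneous_form v \<omega> \<longleftrightarrow>
     (\<exists>w::int. (\<lambda>I u. euler v (\<omega> I) u + of_nat (\<Sum>i\<in>I. v i) * \<omega> I u) =\<^sub>0 (\<lambda>I u. of_int w * \<omega> I u))"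


section \<open>Quasihomogeneous isolated complete intersection singularities\<close>

definition fibre ::
    "nat \<Rightarrow> (nat \<Rightarrow> 'n scalar_fn) \<Rightarrow> (nat \<Rightarrow> complex) \<Rightarrow> (complex ^ 'n::{finite,linorder}) set" where
  "fibre K f y = {u. \<forall>l<K. f l u = y l}"

definition critical_set ::
    "nat \<Rightarrow> (nat \<Rightarrow> 'n scalar_fn) \<Rightarrow> (complex ^ 'n::{finite,linorder}) set" where
  "critical_set K f = {u. \<forall>I. df_all K f I u = 0}"

text \<open>\<open>dim X\<^sub>y = N\<close> is required of every fibre \<open>X\<^sub>y\<close> at each of its points near the origin.\<close>

definition quasihomogeneous_icis ::
    "nat \<Rightarrow> nat \<Rightarrow> ('n::{finite,linorder} \<Rightarrow> nat) \<Rightarrow> (nat \<Rightarrow> int)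
      \<Rightarrow> (nat \<Rightarrow> 'n scalar_fn) \<Rightarrow> bool" where
  "quasihomogeneous_icis N K v p f \<longleftrightarrow>
     CARD('n) = N + K \<and>
     (\<forall>l<K. f l \<in> poly_algebra UNIV (\<lambda>i u. u $ i) \<and> f l 0 = 0) \<and>
     (\<forall>i. v i > 0) \<and> Gcd (range v) = 1 \<and>
     (\<forall>l<K. \<forall>u. euler v (f l) u = of_int (p l) * f l u) \<and>
     (\<forall>\<^sub>F u in nhds 0. local_dim (fibre K f (\<lambda>l. f l u)) u = N) \<and>
     (\<forall>\<^sub>F u in at 0. u \<in> fibre K f (\<lambda>_. 0) \<longrightarrow> u \<notin> critical_set K f)"

text \<open>The Milnor number is the rank of the \<open>N\<close>-th homology of the Milnor fibre.  Reduced homology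
  only matters for \<open>N = 0\<close>, where the Milnor fibre consists of \<open>\<mu> + 1\<close> points.\<close>

definition milnor_number ::
    "nat \<Rightarrow> nat \<Rightarrow> (nat \<Rightarrow> 'n::{finite,linorder} scalar_fn) \<Rightarrow> nat" where
  "milnor_number N K f = (THE m.
     \<exists>e0>0. \<forall>e. 0 < e \<and> e < e0 \<longrightarrow> (\<exists>\<delta>>0. \<forall>y.
       (\<forall>l<K. norm (y l) < \<delta>) \<and> ball 0 e \<inter> fibre K f y \<inter> critical_set K f = {} \<longrightarrow>
       reduced_homology_group (int N) (top_of_set (ball 0 e \<inter> fibre K f y))
         \<cong> free_Abelian_group {..<m}))"


section \<open>The quotient spaces and the modulus of the decomposition\<close>

text \<open>\<open>F = \<Omega>\<^bsup>N+1\<^esup> / F_relations\<close> and \<open>\<Phi> = \<Omega>\<^bsup>N+K\<^esup> / Phi_relations\<close>.\<close>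

definition F_relations ::
    "nat \<Rightarrow> nat \<Rightarrow> ('n::{finite,linorder} \<Rightarrow> nat) \<Rightarrow> (nat \<Rightarrow> 'n scalar_fn) \<Rightarrow> 'n form set" where
  "F_relations N K v f =
     {\<omega> \<in> Omega (N + 1). \<exists>\<alpha> \<beta>. (\<forall>k<K. \<alpha> k \<in> Omega N) \<and> \<beta> \<in> Omega (N + 2) \<and>
        \<omega> =\<^sub>0 (\<Sum>k<K. d_comp f k \<and>\<^sub>\<Omega> \<alpha> k) + contract_euler v \<beta>}"

definition Phi_relations ::
    "nat \<Rightarrow> nat \<Rightarrow> (nat \<Rightarrow> 'n scalar_fn) \<Rightarrow> ('n::{finite,linorder}) form set" where
  "Phi_relations N K f =
     {\<omega> \<in> Omega (N + K). \<exists>\<alpha> \<beta>. \<alpha> \<in> Omega N \<and> (\<forall>k<K. \<beta> k \<in> Omega (N + K)) \<and>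
        \<omega> =\<^sub>0 df_all K f \<and>\<^sub>\<Omega> \<alpha> + (\<Sum>k<K. f k *\<^sub>\<Omega> \<beta> k)}"

text \<open>The classes of \<open>b 1, \<dots>, b m\<close> form a basis of the complex vector space \<open>A / B\<close>.\<close>

definition basis_mod ::
    "('n::{finite,linorder}) form set \<Rightarrow> 'n form set \<Rightarrow> nat \<Rightarrow> (nat \<Rightarrow> 'n form) \<Rightarrow> bool" where
  "basis_mod A B m b \<longleftrightarrow>
     (\<forall>i\<in>{1..m}. b i \<in> A) \<and>
     (\<forall>c. (\<Sum>i=1..m. (\<lambda>_. c i) *\<^sub>\<Omega> b i) \<in> B \<longrightarrow> (\<forall>i\<in>{1..m}. c i = 0)) \<and>
     (\<forall>\<omega>\<in>A. \<exists>c. \<omega> - (\<Sum>i=1..m. (\<lambda>_. c i) *\<^sub>\<Omega> b i) \<in> B)"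

text \<open>The forms \<open>d\<eta>\<close>, \<open>\<eta> \<in> \<Omega>\<^bsup>N-1\<^esup>\<close>.  For \<open>N = 0\<close> a convention is needed.  Reading
  \<open>\<Omega>\<^bsup>-1\<^esup>\<close> as zero is correct when \<open>K = 1\<close>.  When \<open>K \<ge> 2\<close> the decomposition fails for
  that reading: take \<open>f = (x\<^sup>2, y\<^sup>2)\<close>, the basis \<open>dx, dy, (x + y) dx\<close> of \<open>F\<close> and
  the basis \<open>1, x, y\<close> of \<open>\<Phi>\<close>; then \<open>(x + y) dx \<and> d(y\<^sup>2)\<close> contains the term
  \<open>2xy dx \<and> dy\<close>, which is not in the span of \<open>1, x, y\<close> over \<open>\<complex>[x\<^sup>2, y\<^sup>2]\<close>.
  There the augmented relative de Rham complex is used (the one matching reduced homology): the term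
  preceding \<open>\<Omega>\<^sup>0\<close> is \<open>\<complex>[f\<^sub>0, \<dots>, f\<^bsub>K-1\<^esub>]\<close>, mapped by inclusion.\<close>

definition exact_forms ::
    "nat \<Rightarrow> nat \<Rightarrow> (nat \<Rightarrow> 'n scalar_fn) \<Rightarrow> ('n::{finite,linorder}) form set" where
  "exact_forms N K f =
     (if N \<ge> 1 then ext_d ` Omega (N - 1)
      else if K \<le> 1 then {0}
      else fun_form ` poly_algebra {..<K} f)"

end

theory Submission
  imports Defs "HOL-Complex_Analysis.Cauchy_Integral_Formula"
begin

text \<open>A germ with \<open>E g = w g\<close> is a weighted homogeneous polynomial, so all forms that occur are
  polynomial.  Let \<open>\<alpha>\<close> be a top form of weight \<open>w\<close>.  The part of weight \<open>w\<close> of the relation that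
  expresses \<open>\<alpha>\<close> through the basis of \<open>\<Phi>\<close> reads
  \<open>\<alpha> = (\<Sum>j. c\<^sub>j \<phi>\<^sub>j du) + df\<^sub>0 \<and> \<dots> \<and> df\<^bsub>K-1\<^esub> \<and> \<omega> + (\<Sum>k. f\<^sub>k \<beta>\<^sub>k)\<close> with \<open>\<omega>\<close> and
  \<open>\<beta>\<^sub>k\<close> homogeneous.  If the weight \<open>w'\<close> of \<open>\<omega>\<close> is not zero, Cartan's formula
  \<open>w' \<omega> = d (i\<^sub>E \<omega>) + i\<^sub>E (d\<omega>)\<close> splits the middle term: the first part lies in the modulus, and
  \<open>df\<^sub>0 \<and> \<dots> \<and> df\<^bsub>K-1\<^esub> \<and> i\<^sub>E (d\<omega>)\<close> lies in \<open>\<Sum>k. f\<^sub>k \<Omega>\<^bsup>N+K\<^esup>\<close>, as one sees by contracting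
  \<open>df\<^sub>0 \<and> \<dots> \<and> df\<^bsub>K-1\<^esub> \<and> d\<omega> = 0\<close> with \<open>E\<close>.  Since \<open>p\<^sub>k > 0\<close>, the coefficients of the
  \<open>f\<^sub>k\<close> have smaller weight and induction on the weight applies.

  A form \<open>\<omega> \<noteq> 0\<close> of weight zero exists only for \<open>N = 0\<close> and is constant; for \<open>K \<ge> 2\<close> it lies in the
  modulus.  For \<open>N = 0\<close> and \<open>K = 1\<close> a basis element of \<open>F\<close> has weight less than \<open>p\<^sub>0\<close>, since it
  would be a multiple of \<open>df\<^sub>0\<close> otherwise, and by weight only the first sum occurs.\<close>

section \<open>Holomorphic functions of several variables\<close>

text \<open>Holomorphy here is bare complex differentiability, and forms are functions compared by
  \<open>=\<^sub>0\<close>. This creates two obstacles. Weight parts have to be extracted without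
  power series in several variables: they are defined by recursion through Euler's formula, which
  requires partial derivatives to be holomorphic again; Cauchy estimates on coordinate lines supply
  this. Moreover, equality of germs is awkward under \<open>ext_d\<close>, which also sees a
  representative far from the origin. The part of a fixed weight cures this: it depends on the germ
  alone and is a polynomial, so a relation between germs becomes an equality of functions on the
  whole space. Solutions of \<open>E g = w g\<close> are polynomials because they are homogeneous
  under \<open>u_i -> z^(v i) u_i\<close>: letting \<open>z -> 0\<close> forces zero for
  \<open>w < 0\<close> and a constant for \<open>w = 0\<close>, while for \<open>w > 0\<close> the
  partial derivatives have smaller weight and determine \<open>g\<close> by Euler's formula.\<close>

definition holo_on :: "(complex ^ 'n::finite) set \<Rightarrow> (complex ^ 'n \<Rightarrow> complex) \<Rightarrow> bool" where
  "holo_on S g \<longleftrightarrow>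
     (\<forall>u\<in>S. \<exists>D::complex ^ 'n. (g has_derivative (\<lambda>h. \<Sum>i\<in>UNIV. D $ i * h $ i)) (at u))"

lemma holo_near_iff_holo_on: "holo_near a g \<longleftrightarrow> (\<exists>S. open S \<and> a \<in> S \<and> holo_on S g)"
  unfolding holo_near_def holo_on_def eventually_nhds by blast

lemma holo_on_subset: "holo_on S g \<Longrightarrow> T \<subseteq> S \<Longrightarrow> holo_on T g"
  unfolding holo_on_def by blast

lemma bounded_linear_axis: "bounded_linear (\<lambda>h::complex. axis i h)"
  by (rule linear_conv_bounded_linear[THEN iffD1])
    (auto intro!: linearI simp: axis_def vec_eq_iff)

lemma axis_line_has_derivative:
  "((\<lambda>z::complex. u + axis i z) has_derivative (\<lambda>h. axis i h)) (at z)"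
  using bounded_linear_imp_has_derivative[OF bounded_linear_axis]
  by (auto intro!: derivative_eq_intros)

lemma sum_mult_axis: "(\<Sum>j\<in>UNIV. D $ j * axis i h $ j) = D $ i * (h::complex)"
  by (simp add: axis_def if_distrib cong: if_cong)

lemma has_derivative_axis_line:
  fixes g :: "complex ^ 'n::finite \<Rightarrow> complex"
  assumes "(g has_derivative (\<lambda>h. \<Sum>i\<in>UNIV. D $ i * h $ i)) (at (u + axis i z))"
  shows "((\<lambda>z. g (u + axis i z)) has_field_derivative D $ i) (at z)"
proof -
  have "((\<lambda>z. g (u + axis i z)) has_derivative (\<lambda>h. \<Sum>j\<in>UNIV. D $ j * axis i h $ j)) (at z)"
    using has_derivative_compose[OF axis_line_has_derivative assms] .
  then show ?thesis by (simp add: sum_mult_axis has_field_derivative_def)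
qed

lemma partial_eq_derivative:
  assumes "(g has_derivative (\<lambda>h. \<Sum>i\<in>UNIV. D $ i * h $ i)) (at u)"
  shows "partial i g u = D $ i"
  unfolding partial_def using assms by (intro DERIV_imp_deriv has_derivative_axis_line) (simp add: axis_def zero_vec_def[symmetric])

lemma holo_on_has_derivative:
  assumes "holo_on S g" "u \<in> S"
  shows "(g has_derivative (\<lambda>h. \<Sum>i\<in>UNIV. partial i g u * h $ i)) (at u)"
proof -
  obtain D where D: "(g has_derivative (\<lambda>h. \<Sum>i\<in>UNIV. D $ i * h $ i)) (at u)"
    using assms unfolding holo_on_def by blast
  then show ?thesis by (simp add: partial_eq_derivative[OF D])
qed

lemma holo_on_continuous_on: "holo_on S g \<Longrightarrow> continuous_on S g"
  by (meson continuous_at_imp_continuous_on has_derivative_continuous holo_on_has_derivative)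

lemma holo_onI:
  assumes "\<And>u. u \<in> S \<Longrightarrow> (g has_derivative (\<lambda>h. \<Sum>i\<in>UNIV. D i u * h $ i)) (at u)"
  shows "holo_on S g"
  unfolding holo_on_def
proof
  fix u assume "u \<in> S"
  then show "\<exists>Da. (g has_derivative (\<lambda>h. \<Sum>i\<in>UNIV. Da $ i * h $ i)) (at u)"
    using assms by (intro exI[of _ "\<chi> i. D i u"]) simp
qed

lemma partial_eqI:
  assumes "(g has_derivative (\<lambda>h. \<Sum>i\<in>UNIV. D i * h $ i)) (at u)"
  shows "partial i g u = D i"
  using partial_eq_derivative[of g "\<chi> i. D i" u i] assms by simp

lemma axis_zero: "axis i 0 = 0"
  by (simp add: axis_def zero_vec_def[symmetric])

lemma holo_on_axis_line:
  assumes "holo_on S g" "u + axis i z \<in> S"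
  shows "((\<lambda>z. g (u + axis i z)) has_field_derivative partial i g (u + axis i z)) (at z)"
proof -
  have "(g has_derivative (\<lambda>h. \<Sum>j\<in>UNIV. (\<chi> j. partial j g (u + axis i z)) $ j * h $ j)) (at (u + axis i z))"
    using holo_on_has_derivative[OF assms] by simp
  from has_derivative_axis_line[OF this] show ?thesis by simp
qed

section \<open>Cauchy estimates on coordinate lines and holomorphy of partial derivatives\<close>

lemma norm_axis_complex: "norm (axis i z) = norm (z::complex)"
proof -
  have "(norm (axis i z $ j))\<^sup>2 = (if j = i then (norm z)\<^sup>2 else 0)" for j
    by (auto simp: axis_def)
  then show ?thesis by (simp add: norm_vec_def L2_set_def)
qed

lemma axis_line_holomorphic:
  assumes "holo_on (ball u R) g"
  shows "(\<lambda>z. g (u + axis i z)) holomorphic_on ball 0 R"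
proof -
  have "\<And>z. z \<in> ball 0 R \<Longrightarrow> u + axis i z \<in> ball u R"
    by (simp add: dist_norm norm_axis_complex)
  then show ?thesis
    using holo_on_axis_line[OF assms] field_differentiable_at_within field_differentiable_def
    unfolding holomorphic_on_def by blast
qed

text \<open>Cauchy's inequality for the restriction to a coordinate line; \<open>r < R\<close> is
  strict so that the closed disc lies in the domain.\<close>

lemma partial_bound:
  assumes "holo_on (ball u R) g" "0 < r" "r < R" "\<And>x. x \<in> ball u R \<Longrightarrow> norm (g x) \<le> M"
  shows "norm (partial i g u) \<le> M / r"
proof -
  let ?h = "\<lambda>z. g (u + axis i z)"
  have hol: "?h holomorphic_on ball 0 R" by (rule axis_line_holomorphic[OF assms(1)])
  have "norm ((deriv ^^ 1) ?h 0) \<le> fact 1 * M / r ^ 1"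
  proof (rule Cauchy_inequality)
    show "?h holomorphic_on ball 0 r" using hol assms(3) by (auto elim!: holomorphic_on_subset)
    show "continuous_on (cball 0 r) ?h"
      using holomorphic_on_imp_continuous_on[OF hol] by (rule continuous_on_subset) (use assms(3) in auto)
    show "norm (?h x) \<le> M" if "norm (0 - x) = r" for x
      using that assms(3) by (intro assms(4)) (simp add: dist_norm norm_axis_complex)
  qed (use assms in auto)
  then show ?thesis by (simp add: partial_def)
qed

text \<open>First-order Taylor remainder on a coordinate line. At each point of
  \<open>cball 0 r\<close> the second derivative is bounded by Cauchy's inequality on a disc of
  radius \<open>r\<close>, and \<open>2 * r < R\<close> keeps these discs in the domain. The
  constant depends on \<open>M\<close> and \<open>r\<close> only, which makes difference quotients
  converge uniformly in \<open>u\<close>.\<close>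

lemma partial_quotient_bound:
  assumes g: "holo_on (ball u R) g" and r: "0 < r" "2 * r < R"
    and M: "\<And>x. x \<in> ball u R \<Longrightarrow> norm (g x) \<le> M" and t: "norm t \<le> r"
  shows "norm (g (u + axis i t) - g u - partial i g u * t) \<le> 2 * M / r ^ 2 * norm t ^ 2"
proof -
  let ?h = "\<lambda>z. g (u + axis i z)"
  have hol: "?h holomorphic_on ball 0 R" by (rule axis_line_holomorphic[OF g])
  have sub: "cball x r \<subseteq> ball 0 R" if "x \<in> cball 0 r" for x
  proof
    fix y assume "y \<in> cball x r"
    then show "y \<in> ball 0 R" using that r dist_triangle[of 0 y x] by (simp add: dist_commute)
  qed
  have sub0: "cball (0::complex) r \<subseteq> ball 0 R" using r by auto
  have "norm (?h t - (\<Sum>j\<le>1. (deriv ^^ j) ?h 0 * (t - 0) ^ j / fact j))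
      \<le> (2 * M / r ^ 2) * norm (t - 0) ^ Suc 1 / fact 1"
  proof (rule complex_Taylor[where S = "cball 0 r" and f = "\<lambda>j. (deriv ^^ j) ?h" and n = 1, simplified funpow_0])
    fix j :: nat and x assume x: "x \<in> cball (0::complex) r"
    have "(deriv ^^ j) ?h holomorphic_on ball 0 R"
      using hol by (rule holomorphic_higher_deriv) simp
    then have "((deriv ^^ j) ?h has_field_derivative deriv ((deriv ^^ j) ?h) x) (at x)"
      by (rule holomorphic_derivI) (use x sub0 in auto)
    then show "((deriv ^^ j) ?h has_field_derivative (deriv ^^ (Suc j)) ?h x) (at x within cball 0 r)"
      by (simp add: has_field_derivative_at_within)
  next
    fix x assume x: "x \<in> cball (0::complex) r"
    have "norm ((deriv ^^ 2) ?h x) \<le> fact 2 * M / r ^ 2"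
    proof (rule Cauchy_inequality)
      show "?h holomorphic_on ball x r"
        using hol sub[OF x] ball_subset_cball by (blast intro: holomorphic_on_subset)
      show "continuous_on (cball x r) ?h"
        using holomorphic_on_imp_continuous_on[OF hol] sub[OF x] by (blast intro: continuous_on_subset)
      show "norm (?h y) \<le> M" if "norm (x - y) = r" for y
      proof (rule M)
        have "y \<in> cball x r" using that by (simp add: dist_norm)
        then have "y \<in> ball 0 R" using sub[OF x] by blast
        then show "u + axis i y \<in> ball u R" by (simp add: dist_norm norm_axis_complex)
      qed
    qed (use r in auto)
    then show "norm ((deriv ^^ Suc 1) ?h x) \<le> 2 * M / r ^ 2" by (simp add: numeral_2_eq_2)
  qed (use r t in auto)
  then show ?thesis by (simp add: partial_def axis_zero power2_eq_square algebra_simps)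
qed

lemma partial_diff_at:
  assumes "holo_on S g" "holo_on S h" "u \<in> S"
  shows "partial i (\<lambda>x. g x - h x) u = partial i g u - partial i h u"
proof (rule partial_eqI)
  show "((\<lambda>x. g x - h x) has_derivative (\<lambda>v. \<Sum>i\<in>UNIV. (partial i g u - partial i h u) * v $ i)) (at u)"
    using has_derivative_diff[OF holo_on_has_derivative[OF assms(1,3)] holo_on_has_derivative[OF assms(2,3)]]
    by (simp add: left_diff_distrib sum_subtractf)
qed

lemma holo_on_diff: "holo_on S g \<Longrightarrow> holo_on S h \<Longrightarrow> holo_on S (\<lambda>x. g x - h x)"
proof (rule holo_onI)
  fix u assume "holo_on S g" "holo_on S h" "u \<in> S"
  then show "((\<lambda>x. g x - h x) has_derivative (\<lambda>v. \<Sum>i\<in>UNIV. (partial i g u - partial i h u) * v $ i)) (at u)"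
    using has_derivative_diff[OF holo_on_has_derivative holo_on_has_derivative]
    by (simp add: left_diff_distrib sum_subtractf)
qed

lemma norm_sum_mult_le:
  fixes h :: "complex ^ 'n::finite"
  assumes "\<And>i. norm (c i) \<le> e"
  shows "norm (\<Sum>i\<in>UNIV. c i * h $ i) \<le> real CARD('n) * e * norm h"
proof -
  have "norm (\<Sum>i\<in>UNIV. c i * h $ i) \<le> (\<Sum>i\<in>(UNIV::'n set). e * norm h)"
  proof (rule sum_norm_le)
    fix i
    have "norm (c i) * norm (h $ i) \<le> e * norm h"
      by (rule mult_mono[OF assms Finite_Cartesian_Product.norm_nth_le])
        (use assms[of i] norm_ge_zero[of "c i"] in linarith, simp)
    then show "norm (c i * h $ i) \<le> e * norm h" by (simp add: norm_mult)
  qed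
  then show ?thesis by simp
qed

text \<open>Weierstrass's convergence theorem. Cauchy estimates for \<open>h m - h n\<close> make
  the partial derivatives converge uniformly on the smaller ball, so the limit can be differentiated
  term by term.\<close>

lemma holo_on_uniform_limit:
  fixes h :: "nat \<Rightarrow> complex ^ 'n::finite \<Rightarrow> complex"
  assumes h: "\<And>k. holo_on (ball a R) (h k)" and R: "0 < R"
    and lim: "\<And>e. e > 0 \<Longrightarrow> \<forall>\<^sub>F k in sequentially. \<forall>u\<in>ball a R. norm (h k u - g u) \<le> e"
  shows "holo_on (ball a (R/2)) g"
proof -
  let ?B = "ball a (R/2)"
  have sub: "ball u (R/2) \<subseteq> ball a R" if "u \<in> ?B" for u
  proof
    fix x assume "x \<in> ball u (R/2)"
    then show "x \<in> ball a R" using that dist_triangle[of a x u] by simp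
  qed
  have cau: "\<exists>N. \<forall>m\<ge>N. \<forall>n\<ge>N. \<forall>u\<in>?B. norm (partial i (h m) u - partial i (h n) u) \<le> e"
    if e: "e > 0" for e i
  proof -
    \<comment> \<open>Then \<open>h m - h n\<close> is at most \<open>e * R / 4\<close>, and the
      Cauchy estimate with radius \<open>R / 4\<close> turns this into \<open>e\<close>.\<close>
    have "e * R / 8 > 0" using e R by simp
    from lim[OF this] obtain N where N: "\<And>k u. k \<ge> N \<Longrightarrow> u \<in> ball a R \<Longrightarrow> norm (h k u - g u) \<le> e * R / 8"
      unfolding eventually_sequentially by blast
    show ?thesis
    proof (intro exI[of _ N] allI impI ballI)
      fix m n u assume mn: "m \<ge> N" "n \<ge> N" and u: "u \<in> ?B"
      have ua: "u \<in> ball a R" by (rule subsetD[OF sub[OF u]]) (use R in simp)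
      have "norm (partial i (\<lambda>x. h m x - h n x) u) \<le> (e * R / 4) / (R / 4)"
      proof (rule partial_bound[where R = "R/2"])
        show "holo_on (ball u (R/2)) (\<lambda>x. h m x - h n x)"
          using holo_on_diff[OF h h] sub[OF u] by (rule holo_on_subset)
        show "norm (h m x - h n x) \<le> e * R / 4" if "x \<in> ball u (R/2)" for x
        proof -
          have x: "x \<in> ball a R" using that sub[OF u] by blast
          have "norm (h m x - h n x) \<le> norm (h m x - g x) + norm (h n x - g x)"
            by (metis norm_triangle_sub norm_minus_commute add.commute diff_diff_eq2 diff_add_cancel norm_triangle_ineq4 diff_diff_eq)
          then show ?thesis using N[OF mn(1) x] N[OF mn(2) x] by simp
        qed
      qed (use R in auto)
      then show "norm (partial i (h m) u - partial i (h n) u) \<le> e"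
        using R by (simp add: partial_diff_at[OF h h ua])
    qed
  qed
  have "\<exists>L. uniform_limit ?B (\<lambda>k. partial i (h k)) L sequentially" for i
  proof -
    have "uniformly_Cauchy_on ?B (\<lambda>k. partial i (h k))"
    proof (rule uniformly_Cauchy_onI)
      fix e::real assume "e > 0"
      then obtain N where N: "\<forall>m\<ge>N. \<forall>n\<ge>N. \<forall>u\<in>?B. norm (partial i (h m) u - partial i (h n) u) \<le> e/2"
        using cau[of "e/2" i] half_gt_zero by blast
      have "dist (partial i (h m) x) (partial i (h n) x) < e" if "x \<in> ?B" "m \<ge> N" "n \<ge> N" for x m n
      proof -
        have "norm (partial i (h m) x - partial i (h n) x) \<le> e / 2" using N that by blast
        then show ?thesis using \<open>e > 0\<close> by (simp add: dist_norm)
      qed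
      then show "\<exists>M. \<forall>x\<in>?B. \<forall>m\<ge>M. \<forall>n\<ge>M. dist (partial i (h m) x) (partial i (h n) x) < e"
        by blast
    qed
    then show ?thesis
      using Cauchy_uniformly_convergent uniformly_convergent_on_def by blast
  qed
  then obtain L where L: "\<And>i. uniform_limit ?B (\<lambda>k. partial i (h k)) (L i) sequentially" by metis
  have ptw: "(\<lambda>k. h k u) \<longlonglongrightarrow> g u" if "u \<in> ball a R" for u
  proof (rule LIMSEQ_I)
    fix e::real assume "e > 0"
    then obtain N where N: "\<And>k u. k \<ge> N \<Longrightarrow> u \<in> ball a R \<Longrightarrow> norm (h k u - g u) \<le> e/2"
      using lim[of "e/2"] half_gt_zero[of e] unfolding eventually_sequentially by blast
    have "norm (h k u - g u) < e" if "k \<ge> N" for k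
      using N[OF that \<open>u \<in> ball a R\<close>] \<open>e > 0\<close> by linarith
    then show "\<exists>N. \<forall>k\<ge>N. norm (h k u - g u) < e" by blast
  qed
  have "\<exists>G. \<forall>x\<in>?B. (\<lambda>k. h k x) \<longlonglongrightarrow> G x \<and> (G has_derivative (\<lambda>v. \<Sum>i\<in>UNIV. L i x * v $ i)) (at x within ?B)"
  proof (rule has_derivative_sequence[where f = h and f' = "\<lambda>k x v. \<Sum>i\<in>UNIV. partial i (h k) x * v $ i"
        and g' = "\<lambda>x v. \<Sum>i\<in>UNIV. L i x * v $ i" and ?x0.0 = a and l = "g a" and S = ?B])
    show "(h k has_derivative (\<lambda>v. \<Sum>i\<in>UNIV. partial i (h k) x * v $ i)) (at x within ?B)" if "x \<in> ?B" for k x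
      by (rule has_derivative_at_withinI[OF holo_on_has_derivative[OF h subsetD[OF sub[OF that]]]]) (use R in simp)
    show "\<forall>\<^sub>F k in sequentially. \<forall>x\<in>?B. \<forall>v. norm ((\<Sum>i\<in>UNIV. partial i (h k) x * v $ i) - (\<Sum>i\<in>UNIV. L i x * v $ i)) \<le> e * norm v"
      if "e > 0" for e
    proof -
      \<comment> \<open>The derivative is a sum of \<open>CARD('n)\<close> coordinate terms, each of
        which is allowed the error \<open>?c\<close>.\<close>
      let ?c = "e / real CARD('n)"
      have "?c > 0" using that by simp
      then have "\<forall>\<^sub>F k in sequentially. \<forall>x\<in>?B. dist (partial i (h k) x) (L i x) < ?c" for i
        using L[of i] unfolding uniform_limit_iff by blast
      then have "\<forall>\<^sub>F k in sequentially. \<forall>i\<in>UNIV. \<forall>x\<in>?B. dist (partial i (h k) x) (L i x) < ?c"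
        by (intro eventually_ball_finite) auto
      then show ?thesis
      proof (eventually_elim, intro ballI allI)
        fix k x and v :: "complex ^ 'n"
        assume "\<forall>i\<in>UNIV. \<forall>x\<in>?B. dist (partial i (h k) x) (L i x) < ?c" and "x \<in> ?B"
        then have "\<And>i. norm (partial i (h k) x - L i x) \<le> ?c" by (simp add: dist_norm less_imp_le)
        from norm_sum_mult_le[OF this, where h = v] show "norm ((\<Sum>i\<in>UNIV. partial i (h k) x * v $ i) - (\<Sum>i\<in>UNIV. L i x * v $ i)) \<le> e * norm v"
          by (simp add: sum_subtractf[symmetric] left_diff_distrib)
      qed
    qed
    show "a \<in> ?B" using R by simp
    show "(\<lambda>k. h k a) \<longlonglongrightarrow> g a" using ptw R by simp
  qed simp
  then obtain G where G: "\<And>x. x \<in> ?B \<Longrightarrow> (\<lambda>k. h k x) \<longlonglongrightarrow> G x"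
    "\<And>x. x \<in> ?B \<Longrightarrow> (G has_derivative (\<lambda>v. \<Sum>i\<in>UNIV. L i x * v $ i)) (at x within ?B)" by blast
  have eq: "G x = g x" if "x \<in> ?B" for x
    by (rule LIMSEQ_unique[OF G(1)[OF that] ptw[OF subsetD[OF sub[OF that]]]]) (use R in simp)
  show ?thesis
  proof (rule holo_onI)
    fix x assume x: "x \<in> ?B"
    have "(G has_derivative (\<lambda>v. \<Sum>i\<in>UNIV. L i x * v $ i)) (at x)"
      using G(2)[OF x] at_within_open[OF x open_ball] by metis
    then show "(g has_derivative (\<lambda>v. \<Sum>i\<in>UNIV. L i x * v $ i)) (at x)"
      by (rule has_derivative_transform_within_open[OF _ open_ball x eq])
  qed
qed

lemma has_derivative_shift:
  assumes "(g has_derivative g') (at (u + c))"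
  shows "((\<lambda>x. g (x + c)) has_derivative g') (at u)"
proof -
  have "((\<lambda>x. x + c) has_derivative (\<lambda>h. h)) (at u)" by (auto intro!: derivative_eq_intros)
  from has_derivative_compose[OF this assms] show ?thesis .
qed

text \<open>For a fixed increment the difference quotient along \<open>axis i\<close> is holomorphic
  in the base point. As the increment tends to zero these quotients converge uniformly near every
  point, so the partial derivative is a uniform limit of holomorphic functions.\<close>

lemma holo_on_partial:
  assumes "open S" "holo_on S g"
  shows "holo_on S (partial i g)"
proof -
  have "\<exists>r>0. holo_on (ball a r) (partial i g)" if a: "a \<in> S" for a
  proof -
    obtain e where e: "e > 0" "cball a e \<subseteq> S" using assms(1) a open_contains_cball by blast
    \<comment> \<open>One \<open>R\<close> covers the distance of \<open>u\<close> from
      \<open>a\<close>, the other four the ball about \<open>u\<close> to which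
      \<open>partial_quotient_bound\<close> is applied.\<close>
    define R where "R = e / 5"
    have R: "R > 0" "cball a (5 * R) \<subseteq> S" using e by (auto simp: R_def)
    have "compact (g ` cball a (5 * R))"
      using R by (intro compact_continuous_image continuous_on_subset[OF holo_on_continuous_on[OF assms(2)]]) auto
    then obtain M where M: "\<And>x. x \<in> cball a (5 * R) \<Longrightarrow> norm (g x) \<le> M"
      using compact_imp_bounded bounded_iff by (metis imageI)
    define t where "t k = complex_of_real (R / real (Suc k))" for k
    have t: "norm (t k) = R / real (Suc k)" "norm (t k) \<le> R" "t k \<noteq> 0" for k
      using R unfolding t_def norm_of_real by (auto simp: field_simps simp del: of_nat_Suc)
    have sub: "ball u (4 * R) \<subseteq> cball a (5 * R)" if "u \<in> ball a R" for u
    proof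
      fix x assume "x \<in> ball u (4 * R)"
      then show "x \<in> cball a (5 * R)" using that dist_triangle[of a x u] by simp
    qed
    have "holo_on (ball a (R/2)) (partial i g)"
    proof (rule holo_on_uniform_limit[where h = "\<lambda>k u. (g (u + axis i (t k)) - g u) / t k"])
      show "holo_on (ball a R) (\<lambda>u. (g (u + axis i (t k)) - g u) / t k)" for k
      proof (rule holo_onI)
        fix u assume u: "u \<in> ball a R"
        have uS: "u \<in> S" using subsetD[OF sub[OF u], of u] R by auto
        have "u + axis i (t k) \<in> ball u (4 * R)" using t(2)[of k] R(1) by (simp add: dist_norm norm_axis_complex)
        then have vS: "u + axis i (t k) \<in> S" using sub[OF u] R by auto
        have "((\<lambda>x. (g (x + axis i (t k)) - g x) * inverse (t k)) has_derivative
           (\<lambda>h. ((\<Sum>j\<in>UNIV. partial j g (u + axis i (t k)) * h $ j) - (\<Sum>j\<in>UNIV. partial j g u * h $ j)) * inverse (t k))) (at u)"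
          by (intro has_derivative_mult_left has_derivative_diff
             has_derivative_shift[OF holo_on_has_derivative[OF assms(2) vS]]
             holo_on_has_derivative[OF assms(2) uS])
        then show "((\<lambda>x. (g (x + axis i (t k)) - g x) / t k) has_derivative
           (\<lambda>h. \<Sum>j\<in>UNIV. ((partial j g (u + axis i (t k)) - partial j g u) / t k) * h $ j)) (at u)"
          by (simp add: divide_inverse sum_subtractf[symmetric] sum_distrib_right sum_distrib_left left_diff_distrib algebra_simps)
      qed
      show "\<forall>\<^sub>F k in sequentially. \<forall>u\<in>ball a R. norm ((g (u + axis i (t k)) - g u) / t k - partial i g u) \<le> e"
        if "e > 0" for e
      proof -
        have bd: "norm ((g (u + axis i (t k)) - g u) / t k - partial i g u) \<le> 2 * M / R ^ 2 * (R / real (Suc k))"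
          if u: "u \<in> ball a R" for u k
        proof -
          have "norm (g (u + axis i (t k)) - g u - partial i g u * t k) \<le> 2 * M / R ^ 2 * norm (t k) ^ 2"
          proof (rule partial_quotient_bound[where R = "4 * R"])
            show "holo_on (ball u (4 * R)) g" using sub[OF u] R by (blast intro: holo_on_subset[OF assms(2)])
            show "norm (g x) \<le> M" if "x \<in> ball u (4 * R)" for x
              using that sub[OF u] M by blast
          qed (use R t in auto)
          then have "norm (g (u + axis i (t k)) - g u - partial i g u * t k) / norm (t k) \<le> 2 * M / R ^ 2 * norm (t k)"
            using t(3)[of k] by (simp add: divide_le_eq power2_eq_square mult.assoc)
          moreover have "(g (u + axis i (t k)) - g u) / t k - partial i g u = (g (u + axis i (t k)) - g u - partial i g u * t k) / t k"
            using t(3)[of k] by (simp add: field_simps)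
          ultimately show ?thesis by (simp add: norm_divide t(1))
        qed
        have "(\<lambda>k. 2 * M / R ^ 2 * (R * inverse (real (Suc k)))) \<longlonglongrightarrow> 2 * M / R ^ 2 * (R * 0)"
          by (intro tendsto_intros LIMSEQ_inverse_real_of_nat)
        then have "\<forall>\<^sub>F k in sequentially. 2 * M / R ^ 2 * (R / real (Suc k)) < e"
          using that by (auto simp: order_tendsto_iff divide_inverse)
        then show ?thesis
        proof eventually_elim
          case (elim k)
          show ?case
          proof
            fix u assume "u \<in> ball a R"
            from bd[OF this, of k] elim
            show "norm ((g (u + axis i (t k)) - g u) / t k - partial i g u) \<le> e" by linarith
          qed
        qed
      qed
    qed (use R in auto)
    then show ?thesis using R by (intro exI[of _ "R/2"]) auto
  qed
  then show ?thesis unfolding holo_on_def using centre_in_ball by blast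
qed

section \<open>Sums and products of holomorphic functions and their partial derivatives\<close>

lemma holo_on_const: "holo_on S (\<lambda>_. c)"
  by (rule holo_onI[where D = "\<lambda>_ _. 0"]) simp

lemma has_derivative_coord:
  "((\<lambda>u. u $ j) has_derivative (\<lambda>h::complex^'n::finite. \<Sum>i\<in>UNIV. (if i = j then 1 else 0) * h $ i)) (at u)"
proof -
  have "(\<Sum>i\<in>UNIV. (if i = j then 1 else 0) * h $ i) = h $ j" for h :: "complex ^ 'n"
    by (simp add: of_bool_def[symmetric])
  then show ?thesis
    using bounded_linear_imp_has_derivative[OF bounded_linear_vec_nth, of j] by simp
qed

lemma holo_on_coord: "holo_on S (\<lambda>u. u $ j)"
  by (rule holo_onI[OF has_derivative_coord])

lemma has_derivative_add_coeffs:
  assumes "(g has_derivative (\<lambda>h::complex^'n::finite. \<Sum>i\<in>UNIV. a i * h $ i)) (at u)"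
    and "(k has_derivative (\<lambda>h. \<Sum>i\<in>UNIV. b i * h $ i)) (at u)"
  shows "((\<lambda>x. g x + k x) has_derivative (\<lambda>h. \<Sum>i\<in>UNIV. (a i + b i) * h $ i)) (at u)"
  using has_derivative_add[OF assms] by (simp add: distrib_right sum.distrib)

lemma has_derivative_mult_coeffs:
  fixes g k :: "complex^'n::finite \<Rightarrow> complex"
  assumes "(g has_derivative (\<lambda>h. \<Sum>i\<in>UNIV. a i * h $ i)) (at u)"
    and "(k has_derivative (\<lambda>h. \<Sum>i\<in>UNIV. b i * h $ i)) (at u)"
  shows "((\<lambda>x. g x * k x) has_derivative (\<lambda>h. \<Sum>i\<in>UNIV. (g u * b i + a i * k u) * h $ i)) (at u)"
  using has_derivative_mult[OF assms]
  by (simp add: distrib_left sum.distrib sum_distrib_left sum_distrib_right mult.assoc mult.left_commute mult.commute)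

lemma holo_on_add: "holo_on S g \<Longrightarrow> holo_on S h \<Longrightarrow> holo_on S (\<lambda>x. g x + h x)"
  by (rule holo_onI[OF has_derivative_add_coeffs[OF holo_on_has_derivative holo_on_has_derivative]])

lemma holo_on_mult: "holo_on S g \<Longrightarrow> holo_on S h \<Longrightarrow> holo_on S (\<lambda>x. g x * h x)"
  by (rule holo_onI[OF has_derivative_mult_coeffs[OF holo_on_has_derivative holo_on_has_derivative]])

lemma partial_add:
  "holo_on S g \<Longrightarrow> holo_on S h \<Longrightarrow> u \<in> S \<Longrightarrow> partial i (\<lambda>x. g x + h x) u = partial i g u + partial i h u"
  by (rule partial_eqI[OF has_derivative_add_coeffs[OF holo_on_has_derivative holo_on_has_derivative]])

lemma partial_mult:
  "holo_on S g \<Longrightarrow> holo_on S h \<Longrightarrow> u \<in> S \<Longrightarrow>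
    partial i (\<lambda>x. g x * h x) u = g u * partial i h u + partial i g u * h u"
  by (rule partial_eqI[OF has_derivative_mult_coeffs[OF holo_on_has_derivative holo_on_has_derivative]])

lemma partial_const: "partial i (\<lambda>_. c) u = 0"
  by (simp add: partial_def)

lemma partial_coord: "partial i (\<lambda>u. u $ j) u = (if i = j then 1 else 0)"
  by (rule partial_eqI[OF has_derivative_coord])

lemma partial_cmult:
  "holo_on S g \<Longrightarrow> u \<in> S \<Longrightarrow> partial i (\<lambda>x. c * g x) u = c * partial i g u"
  using partial_mult[OF holo_on_const, of S g u i c] by (simp add: partial_const)

lemma holo_on_sum: "(\<And>j. j \<in> A \<Longrightarrow> holo_on S (g j)) \<Longrightarrow> holo_on S (\<lambda>x. \<Sum>j\<in>A. g j x)"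
  by (induction A rule: infinite_finite_induct) (auto intro: holo_on_const holo_on_add)

lemma partial_sum:
  "(\<And>j. j \<in> A \<Longrightarrow> holo_on S (g j)) \<Longrightarrow> u \<in> S \<Longrightarrow>
    partial i (\<lambda>x. \<Sum>j\<in>A. g j x) u = (\<Sum>j\<in>A. partial i (g j) u)"
proof (induction A rule: infinite_finite_induct)
  case (insert a A)
  then show ?case
    using partial_add[of S "g a" "\<lambda>x. \<Sum>j\<in>A. g j x" u i] holo_on_sum[of A S g] by simp
qed (auto simp: partial_const)

lemma partial_cong:
  assumes "\<forall>\<^sub>F x in nhds u. g x = h x"
  shows "partial i g u = partial i h u"
  unfolding partial_def
proof (rule deriv_cong_ev)
  have "((\<lambda>z. u + axis i z) \<longlongrightarrow> u) (nhds 0)"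
    using has_derivative_continuous[OF axis_line_has_derivative[of u i 0]]
    by (simp add: isCont_def tendsto_nhds_iff axis_zero)
  then show "\<forall>\<^sub>F z in nhds 0. g (u + axis i z) = h (u + axis i z)"
    using assms by (rule eventually_compose_filterlim[rotated])
qed simp

section \<open>Germs of holomorphic functions\<close>

lemma holo_nearI: "open S \<Longrightarrow> a \<in> S \<Longrightarrow> holo_on S g \<Longrightarrow> holo_near a g"
  using holo_near_iff_holo_on by blast

lemma holo_on_UNIV_near: "holo_on UNIV g \<Longrightarrow> holo_near a g"
  by (rule holo_nearI[of UNIV]) auto

lemma holo_near2E:
  assumes "holo_near a g" and "holo_near a h"
  obtains S where "open S" "a \<in> S" "holo_on S g" "holo_on S h"
proof -
  obtain S T where "open S" "a \<in> S" "holo_on S g" "open T" "a \<in> T" "holo_on T h"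
    using assms holo_near_iff_holo_on by metis
  then show ?thesis using that[of "S \<inter> T"] by (auto intro: holo_on_subset)
qed

lemma holo_near_add: "holo_near a g \<Longrightarrow> holo_near a h \<Longrightarrow> holo_near a (\<lambda>x. g x + h x)"
  by (rule holo_near2E[of a g h]) (auto intro: holo_nearI holo_on_add)

lemma holo_near_mult: "holo_near a g \<Longrightarrow> holo_near a h \<Longrightarrow> holo_near a (\<lambda>x. g x * h x)"
  by (rule holo_near2E[of a g h]) (auto intro: holo_nearI holo_on_mult)

lemma holo_near_const: "holo_near a (\<lambda>_. c)"
  by (rule holo_on_UNIV_near[OF holo_on_const])

lemma holo_near_sum: "(\<And>j. j \<in> A \<Longrightarrow> holo_near a (g j)) \<Longrightarrow> holo_near a (\<lambda>x. \<Sum>j\<in>A. g j x)"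
  by (induction A rule: infinite_finite_induct) (auto intro: holo_near_const holo_near_add)

lemma holo_near_partial: "holo_near a g \<Longrightarrow> holo_near a (partial i g)"
  unfolding holo_near_iff_holo_on using holo_on_partial by blast

lemma partial_germ_cong:
  assumes "\<forall>\<^sub>F u in nhds a. g u = h u"
  shows "\<forall>\<^sub>F u in nhds a. partial i g u = partial i h u"
  using eventually_eventually[THEN iffD2, OF assms] by eventually_elim (rule partial_cong)

lemma partial_add_germ:
  assumes "holo_near a g" "holo_near a h"
  shows "\<forall>\<^sub>F u in nhds a. partial i (\<lambda>x. g x + h x) u = partial i g u + partial i h u"
  by (rule holo_near2E[OF assms]) (unfold eventually_nhds, blast intro: partial_add)

lemma partial_mult_germ:
  assumes "holo_near a g" "holo_near a h"
  shows "\<forall>\<^sub>F u in nhds a. partial i (\<lambda>x. g x * h x) u = g u * partial i h u + partial i g u * h u"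
  by (rule holo_near2E[OF assms]) (unfold eventually_nhds, blast intro: partial_mult)

section \<open>Weighted homogeneous polynomials\<close>

locale weights =
  fixes v :: "'n::finite \<Rightarrow> nat"
  assumes weight_pos: "v i > 0"
begin

text \<open>Monomials are built one coordinate at a time, so properties follow by rule induction
  without multi-indices. Weights are integers, so that \<open>w - int (v i)\<close> needs no side
  condition, and the zero function has every weight.\<close>

inductive wpoly :: "int \<Rightarrow> (complex ^ 'n \<Rightarrow> complex) \<Rightarrow> bool" where
  const: "wpoly 0 (\<lambda>_. c)"
| zero: "wpoly w (\<lambda>_. 0)"
| add: "wpoly w g \<Longrightarrow> wpoly w h \<Longrightarrow> wpoly w (\<lambda>u. g u + h u)"
| coord: "wpoly w g \<Longrightarrow> wpoly (w + int (v i)) (\<lambda>u. u $ i * g u)"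

lemma wpoly_holo_on: "wpoly w g \<Longrightarrow> holo_on S g"
  by (induction rule: wpoly.induct) (auto intro: holo_on_const holo_on_add holo_on_mult holo_on_coord)

lemma wpoly_holo_near: "wpoly w g \<Longrightarrow> holo_near a g"
  by (rule holo_on_UNIV_near[OF wpoly_holo_on])

lemma wpoly_neg: "wpoly w g \<Longrightarrow> w < 0 \<Longrightarrow> g u = 0"
  by (induction rule: wpoly.induct) auto

lemma wpoly_0: "wpoly w g \<Longrightarrow> w = 0 \<Longrightarrow> g u = g 0"
proof (induction rule: wpoly.induct)
  case (coord w g i)
  then have "w < 0" using weight_pos[of i] by linarith
  then show ?case using wpoly_neg[OF coord.hyps] by simp
qed auto

lemma wpoly_coord': "wpoly (w - int (v i)) g \<Longrightarrow> wpoly w (\<lambda>u. u $ i * g u)"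
  using wpoly.coord[of "w - int (v i)" g i] by simp

lemma wpoly_cmult: "wpoly w g \<Longrightarrow> wpoly w (\<lambda>u. c * g u)"
proof (induction rule: wpoly.induct)
  case (add w g h)
  then show ?case using wpoly.add by (simp add: distrib_left)
next
  case (coord w g i)
  then show ?case using wpoly.coord[of w "\<lambda>u. c * g u" i] by (simp add: mult.left_commute)
qed (auto intro: wpoly.intros)

lemma wpoly_mult: "wpoly a g \<Longrightarrow> wpoly b h \<Longrightarrow> wpoly (a + b) (\<lambda>u. g u * h u)"
proof (induction rule: wpoly.induct)
  case (const c)
  then show ?case using wpoly_cmult by simp
next
  case (add w g k)
  then show ?case using wpoly.add by (simp add: distrib_right)
next
  case (coord w g i)
  then show ?case using wpoly.coord[of "w + b" "\<lambda>u. g u * h u" i] by (simp add: mult.assoc algebra_simps)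
qed (auto intro: wpoly.intros)

lemma wpoly_sum: "(\<And>j. j \<in> A \<Longrightarrow> wpoly w (g j)) \<Longrightarrow> wpoly w (\<lambda>u. \<Sum>j\<in>A. g j u)"
  by (induction A rule: infinite_finite_induct) (auto intro: wpoly.intros)

lemma wpoly_partial: "wpoly w g \<Longrightarrow> wpoly (w - int (v i)) (partial i g)"
proof (induction rule: wpoly.induct)
  case (const c)
  have "partial i (\<lambda>_. c) = (\<lambda>_. 0)" by (rule ext) (simp add: partial_const)
  then show ?case by (simp add: wpoly.zero)
next
  case (zero w)
  have "partial i (\<lambda>_. 0) = (\<lambda>_. 0)" by (rule ext) (simp add: partial_const)
  then show ?case by (simp add: wpoly.zero)
next
  case (add w g h)
  have "partial i (\<lambda>u. g u + h u) = (\<lambda>u. partial i g u + partial i h u)"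
    using add.hyps by (intro ext partial_add[of UNIV]) (auto intro: wpoly_holo_on)
  then show ?case using add.IH by (simp add: wpoly.add)
next
  case (coord w g j)
  have *: "partial i (\<lambda>u. u $ j * g u) = (\<lambda>u. u $ j * partial i g u + (if i = j then 1 else 0) * g u)"
  proof
    fix u show "partial i (\<lambda>u. u $ j * g u) u = u $ j * partial i g u + (if i = j then 1 else 0) * g u"
      using partial_mult[OF holo_on_coord wpoly_holo_on[OF coord.hyps], where u = u and S = UNIV and i = i]
      by (simp add: partial_coord)
  qed
  have "wpoly (w + int (v j) - int (v i)) (\<lambda>u. u $ j * partial i g u)"
    using wpoly.coord[OF coord.IH, of j] by (simp add: algebra_simps)
  moreover have "wpoly (w + int (v j) - int (v i)) (\<lambda>u. (if i = j then 1 else 0) * g u)"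
    using coord.hyps by (cases "i = j") (auto intro: wpoly.zero)
  ultimately show ?case unfolding * by (rule wpoly.add)
qed

lemma wpoly_euler: "wpoly w g \<Longrightarrow> euler v g u = of_int w * g u"
proof (induction rule: wpoly.induct)
  case (add w g h)
  have "partial i (\<lambda>u. g u + h u) u = partial i g u + partial i h u" for i
    using add.hyps by (intro partial_add[of UNIV]) (auto intro: wpoly_holo_on)
  then show ?case using add.IH by (simp add: euler_def distrib_left sum.distrib)
next
  case (coord w g j)
  have "partial i (\<lambda>u. u $ j * g u) u = u $ j * partial i g u + (if i = j then 1 else 0) * g u" for i
    using partial_mult[OF holo_on_coord wpoly_holo_on[OF coord.hyps], where u = u and S = UNIV and i = i]
    by (simp add: partial_coord)
  then have "of_nat (v i) * u $ i * partial i (\<lambda>u. u $ j * g u) u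
    = u $ j * (of_nat (v i) * u $ i * partial i g u) + (if i = j then of_nat (v i) * u $ i * g u else 0)" for i
    by (simp add: algebra_simps)
  then have "euler v (\<lambda>u. u $ j * g u) u = u $ j * euler v g u + of_nat (v j) * u $ j * g u"
    by (simp add: euler_def sum.distrib sum_distrib_left)
  then show ?case using coord.IH by (simp add: algebra_simps)
qed (auto simp: euler_def partial_const)

text \<open>Euler's formula \<open>w g\<^sub>w = (\<Sum>i. v\<^sub>i u\<^sub>i \<partial>\<^sub>i g\<^sub>w)\<close> for the part \<open>g\<^sub>w\<close> of weight \<open>w\<close> of the
  Taylor expansion of \<open>g\<close> at the origin, turned into a recursion: \<open>\<partial>\<^sub>i g\<^sub>w\<close> is the part of
  weight \<open>w - v\<^sub>i\<close> of \<open>\<partial>\<^sub>i g\<close>.\<close>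

function taylor :: "nat \<Rightarrow> (complex ^ 'n \<Rightarrow> complex) \<Rightarrow> complex ^ 'n \<Rightarrow> complex" where
  "taylor w g u = (if w = 0 then g 0 else
     (\<Sum>i\<in>UNIV. if v i \<le> w then of_nat (v i) * u $ i * taylor (w - v i) (partial i g) u else 0) / of_nat w)"
  by auto
termination
  by (relation "Wellfounded.measure (\<lambda>(w, g, u). w)") (use weight_pos in \<open>auto simp: neq0_conv\<close>)

declare taylor.simps [simp del]

text \<open>The value zero at negative weights absorbs the test \<open>v i \<le> w\<close> in the
  recursion for \<open>taylor\<close>.\<close>

definition wpart :: "int \<Rightarrow> (complex ^ 'n \<Rightarrow> complex) \<Rightarrow> complex ^ 'n \<Rightarrow> complex" where
  "wpart w g u = (if w < 0 then 0 else taylor (nat w) g u)"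

lemma wpart_neg: "w < 0 \<Longrightarrow> wpart w g u = 0"
  by (simp add: wpart_def)

lemma wpart_0: "wpart 0 g u = g 0"
  by (simp add: wpart_def taylor.simps)

lemma wpart_rec:
  assumes "w > 0"
  shows "wpart w g u = (\<Sum>i\<in>UNIV. of_nat (v i) * u $ i * wpart (w - int (v i)) (partial i g) u) / of_int w"
proof -
  have "(if v i \<le> nat w then of_nat (v i) * u $ i * taylor (nat w - v i) (partial i g) u else 0)
     = of_nat (v i) * u $ i * wpart (w - int (v i)) (partial i g) u" for i
    using assms by (auto simp: wpart_def nat_diff_distrib)
  then show ?thesis using assms by (simp add: wpart_def taylor.simps[of "nat w"])
qed

text \<open>Recursions on weights subtract some \<open>v i > 0\<close>, so they end at zero or among
  the negative weights, where only the zero function occurs.\<close>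

lemma weight_induct [case_names neg zero pos]:
  fixes w :: int
  assumes "\<And>w. w < 0 \<Longrightarrow> P w" "P 0" "\<And>w. w > 0 \<Longrightarrow> (\<And>i. P (w - int (v i))) \<Longrightarrow> P w"
  shows "P w"
proof (induction "nat w" arbitrary: w rule: less_induct)
  case less
  show ?case
  proof (cases "w > 0")
    case True
    have "P (w - int (v i))" for i using less[of "w - int (v i)"] True weight_pos[of i] by simp
    then show ?thesis using assms(3) True by blast
  qed (use assms in \<open>cases "w = 0"; simp\<close>)
qed

lemma wpart_cong: "\<forall>\<^sub>F u in nhds 0. g u = h u \<Longrightarrow> wpart w g u = wpart w h u"
proof (induction w arbitrary: g h rule: weight_induct)
  case (pos w)
  show ?case using pos.IH[OF partial_germ_cong[OF pos.prems]] pos.hyps by (simp add: wpart_rec)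
qed (auto simp: wpart_neg wpart_0 dest: eventually_nhds_x_imp_x)

lemma wpart_add:
  "holo_near 0 g \<Longrightarrow> holo_near 0 h \<Longrightarrow> wpart w (\<lambda>x. g x + h x) u = wpart w g u + wpart w h u"
proof (induction w arbitrary: g h rule: weight_induct)
  case (pos w)
  have "wpart (w - int (v i)) (partial i (\<lambda>x. g x + h x)) u
      = wpart (w - int (v i)) (partial i g) u + wpart (w - int (v i)) (partial i h) u" for i
    using wpart_cong[OF partial_add_germ[OF pos.prems]] pos.IH[OF holo_near_partial holo_near_partial] pos.prems
    by simp
  then show ?case using pos.hyps by (simp add: wpart_rec distrib_left sum.distrib add_divide_distrib)
qed (auto simp: wpart_neg wpart_0)

lemma wpart_const: "wpart w (\<lambda>_. c) u = (if w = 0 then c else 0)"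
proof (induction w arbitrary: c rule: weight_induct)
  case (pos w)
  have "wpart (w - int (v i)) (partial i (\<lambda>_. c)) u = 0" for i
    using pos.IH[of i 0] wpart_cong[of "partial i (\<lambda>_. c)" "\<lambda>_. 0" "w - int (v i)" u] by (simp add: partial_const)
  then show ?case using pos.hyps by (simp add: wpart_rec)
qed (auto simp: wpart_neg wpart_0)

text \<open>The recursion with the division cleared, which makes it valid for every integer
  \<open>w\<close>: both sides vanish for \<open>w \<le> 0\<close>.\<close>

lemma wpart_euler:
  "(\<Sum>i\<in>UNIV. of_nat (v i) * u $ i * wpart (w - int (v i)) (partial i g) u) = of_int w * wpart w g u"
proof (cases "w > 0")
  case False
  then have "wpart (w - int (v i)) (partial i g) u = 0" for i
    using weight_pos[of i] by (intro wpart_neg) linarith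
  then show ?thesis using False by (cases "w = 0") (auto simp: wpart_neg)
qed (simp add: wpart_rec)

text \<open>Leibniz's rule inserted into Euler's formula. By induction the derivatives of
  \<open>g\<close> contribute the factor \<open>w - v j\<close>, and the derivative of the
  coordinate itself contributes the missing \<open>v j\<close>.\<close>

lemma wpart_mult_coord:
  "holo_near 0 g \<Longrightarrow> wpart w (\<lambda>x. x $ j * g x) u = u $ j * wpart (w - int (v j)) g u"
proof (induction w arbitrary: g rule: weight_induct)
  case zero
  then show ?case using weight_pos[of j] by (simp add: wpart_0 wpart_neg)
next
  case (pos w)
  have "wpart (w - int (v i)) (partial i (\<lambda>x. x $ j * g x)) u
      = u $ j * wpart (w - int (v j) - int (v i)) (partial i g) u
        + (if i = j then wpart (w - int (v j)) g u else 0)" for i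
  proof -
    have g': "holo_near 0 (partial i g)" using pos.prems by (rule holo_near_partial)
    have c: "holo_near 0 (\<lambda>x. x $ j)" by (rule holo_on_UNIV_near[OF holo_on_coord])
    have d: "holo_near 0 (\<lambda>x. (if i = j then 1 else 0) * g x)"
      by (rule holo_near_mult[OF holo_near_const pos.prems])
    have "\<forall>\<^sub>F x in nhds 0. partial i (\<lambda>x. x $ j * g x) x = x $ j * partial i g x + (if i = j then 1 else 0) * g x"
      using partial_mult_germ[OF c pos.prems] by (simp add: partial_coord)
    then have "wpart (w - int (v i)) (partial i (\<lambda>x. x $ j * g x)) u
       = wpart (w - int (v i)) (\<lambda>x. x $ j * partial i g x) u + wpart (w - int (v i)) (\<lambda>x. (if i = j then 1 else 0) * g x) u"
      using wpart_add[OF holo_near_mult[OF c g'] d] by (simp add: wpart_cong)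
    then show ?thesis using pos.IH[OF g', of i]
      by (auto simp: wpart_const algebra_simps)
  qed
  then have *: "of_nat (v i) * u $ i * wpart (w - int (v i)) (partial i (\<lambda>x. x $ j * g x)) u
      = u $ j * (of_nat (v i) * u $ i * wpart (w - int (v j) - int (v i)) (partial i g) u)
        + (if i = j then of_nat (v i) * u $ i * wpart (w - int (v j)) g u else 0)" for i
    by (simp add: algebra_simps)
  have "of_int w * wpart w (\<lambda>x. x $ j * g x) u
     = u $ j * (\<Sum>i\<in>UNIV. of_nat (v i) * u $ i * wpart (w - int (v j) - int (v i)) (partial i g) u)
       + of_nat (v j) * u $ j * wpart (w - int (v j)) g u"
    unfolding wpart_euler[symmetric, of w] * by (simp add: sum.distrib sum_distrib_left)
  also have "\<dots> = of_int w * (u $ j * wpart (w - int (v j)) g u)"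
    unfolding wpart_euler by (simp add: algebra_simps)
  finally show ?case using pos.hyps by simp
qed (auto simp: wpart_neg)

lemma wpart_cmult: "holo_near 0 g \<Longrightarrow> wpart w (\<lambda>x. c * g x) u = c * wpart w g u"
proof (induction w arbitrary: g rule: weight_induct)
  case (pos w)
  have "wpart (w - int (v i)) (partial i (\<lambda>x. c * g x)) u = c * wpart (w - int (v i)) (partial i g) u" for i
  proof -
    have "\<forall>\<^sub>F x in nhds 0. partial i (\<lambda>x. c * g x) x = c * partial i g x"
      using partial_mult_germ[OF holo_near_const pos.prems, of i c] by (simp add: partial_const)
    then show ?thesis using pos.IH[OF holo_near_partial[OF pos.prems]] by (simp add: wpart_cong)
  qed
  then show ?case using pos.hyps by (simp add: wpart_rec mult.left_commute sum_distrib_left[symmetric])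
qed (auto simp: wpart_neg wpart_0)

lemma wpart_sum:
  "(\<And>j. j \<in> A \<Longrightarrow> holo_near 0 (g j)) \<Longrightarrow> wpart w (\<lambda>x. \<Sum>j\<in>A. g j x) u = (\<Sum>j\<in>A. wpart w (g j) u)"
proof (induction A rule: infinite_finite_induct)
  case (insert a A)
  then show ?case using wpart_add[of "g a" "\<lambda>x. \<Sum>j\<in>A. g j x" w u] holo_near_sum[of A 0 g] by simp
qed (auto simp: wpart_const)

lemma wpoly_wpart: "wpoly w (wpart w g)"
proof (induction w arbitrary: g rule: weight_induct)
  case (neg w)
  then have "wpart w g = (\<lambda>_. 0)" by (auto simp: wpart_neg)
  then show ?case by (simp add: wpoly.zero)
next
  case zero
  have "wpart 0 g = (\<lambda>_. g 0)" by (auto simp: wpart_0)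
  then show ?case by (simp add: wpoly.const)
next
  case (pos w)
  have "wpart w g = (\<lambda>u. \<Sum>i\<in>UNIV. (of_nat (v i) / of_int w) * (u $ i * wpart (w - int (v i)) (partial i g) u))"
    using pos.hyps by (auto simp: wpart_rec sum_divide_distrib mult.assoc)
  then show ?case
    by (simp only:) (intro wpoly_sum wpoly_cmult wpoly_coord' pos.IH)
qed

text \<open>Rule induction on the polynomial factor reduces this to multiplication by a single
  coordinate, so no product of two expansions has to be sorted by weight.\<close>

lemma wpart_mult:
  "wpoly a p \<Longrightarrow> holo_near 0 g \<Longrightarrow> wpart w (\<lambda>x. p x * g x) u = p u * wpart (w - a) g u"
proof (induction arbitrary: w rule: wpoly.induct)
  case (const c)
  then show ?case by (simp add: wpart_cmult)
next
  case (zero a)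
  then show ?case by (simp add: wpart_const)
next
  case (add a p q)
  have "wpart w (\<lambda>x. p x * g x + q x * g x) u = wpart w (\<lambda>x. p x * g x) u + wpart w (\<lambda>x. q x * g x) u"
    by (intro wpart_add holo_near_mult wpoly_holo_near[OF add.hyps(1)] wpoly_holo_near[OF add.hyps(2)] add.prems)
  then show ?case using add by (simp add: distrib_right)
next
  case (coord a p i)
  have "wpart w (\<lambda>x. x $ i * (p x * g x)) u = u $ i * wpart (w - int (v i)) (\<lambda>x. p x * g x) u"
    by (intro wpart_mult_coord holo_near_mult wpoly_holo_near[OF coord.hyps] coord.prems)
  then show ?case using coord by (simp add: mult.assoc algebra_simps)
qed

text \<open>The case of \<open>wpart_mult\<close> with second factor 1, whose only nonzero part has
  weight zero.\<close>

lemma wpart_wpoly: "wpoly a p \<Longrightarrow> wpart w p u = (if w = a then p u else 0)"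
  using wpart_mult[OF _ holo_near_const, of a p w 1 u] by (auto simp: wpart_const)

section \<open>Weighted scaling, the action generated by the Euler field\<close>

definition scale :: "complex \<Rightarrow> complex ^ 'n \<Rightarrow> complex ^ 'n" where
  "scale z u = (\<chi> i. z ^ v i * u $ i)"

text \<open>Every exponent \<open>v i\<close> is at least one, so for \<open>norm z \<le> 1\<close>
  each coordinate shrinks at least by the factor \<open>norm z\<close>.\<close>

lemma norm_scale_le: "norm z \<le> 1 \<Longrightarrow> norm (scale z u) \<le> norm z * norm u"
proof -
  assume z: "norm z \<le> 1"
  have "norm (scale z u) \<le> norm (norm z *\<^sub>R u)"
  proof (rule norm_le_componentwise_cart)
    fix i
    obtain k where "v i = Suc k" using weight_pos[of i] by (cases "v i") auto
    then have "norm (z ^ v i) \<le> norm z"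
      using z by (simp add: norm_mult norm_power mult_right_le_one_le power_le_one)
    then show "norm (scale z u $ i) \<le> norm ((norm z *\<^sub>R u) $ i)"
      by (simp add: scale_def norm_mult mult_right_mono)
  qed
  then show ?thesis by simp
qed

lemma scale_mem_ball: "norm z \<le> 1 \<Longrightarrow> u \<in> ball 0 R \<Longrightarrow> scale z u \<in> ball 0 R"
  using norm_scale_le[of z u] mult_left_le_one_le[of "norm u" "norm z"] by simp

lemma wpoly_scale: "wpoly w g \<Longrightarrow> z \<noteq> 0 \<Longrightarrow> g (scale z u) = z powi w * g u"
proof (induction rule: wpoly.induct)
  case (coord w g i)
  then show ?case by (simp add: scale_def power_int_add mult_ac)
qed (auto simp: distrib_left)

lemma scale_has_derivative:
  "((\<lambda>z. scale z u) has_derivative (\<lambda>h. \<chi> i. of_nat (v i) * z ^ (v i - 1) * u $ i * h)) (at z)"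
proof -
  have sum_axis: "(\<Sum>i\<in>UNIV. axis i (c i)) = (\<chi> i. c i)" for c :: "'n \<Rightarrow> complex"
    by (simp add: vec_eq_iff axis_def)
  have "((\<lambda>z. \<Sum>i\<in>UNIV. axis i (z ^ v i * u $ i)) has_derivative
      (\<lambda>h. \<Sum>i\<in>UNIV. axis i (of_nat (v i) * z ^ (v i - 1) * u $ i * h))) (at z)"
  proof (intro has_derivative_sum bounded_linear.has_derivative[OF bounded_linear_axis])
    fix i
    have "((\<lambda>z. z ^ v i * u $ i) has_field_derivative of_nat (v i) * z ^ (v i - 1) * u $ i) (at z)"
      by (auto intro!: derivative_eq_intros)
    then show "((\<lambda>z. z ^ v i * u $ i) has_derivative (\<lambda>h. of_nat (v i) * z ^ (v i - 1) * u $ i * h)) (at z)"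
      by (simp add: has_field_derivative_def)
  qed
  then show ?thesis by (simp add: sum_axis scale_def)
qed

lemma scale_line_has_field_derivative:
  assumes g: "holo_on S g" "scale z u \<in> S" and z: "z \<noteq> 0"
  shows "((\<lambda>z. g (scale z u)) has_field_derivative euler v g (scale z u) / z) (at z)"
proof -
  have "of_nat (v i) * z ^ (v i - 1) * u $ i = of_nat (v i) * scale z u $ i / z" for i
    using z weight_pos[of i] by (cases "v i") (auto simp: scale_def)
  then have "(\<lambda>h. \<Sum>i\<in>UNIV. partial i g (scale z u) * (\<chi> i. of_nat (v i) * z ^ (v i - 1) * u $ i * h) $ i)
      = (*) (euler v g (scale z u) / z)"
    by (intro ext) (simp add: euler_def sum_divide_distrib sum_distrib_left mult_ac)
  then show ?thesis
    using has_derivative_compose[OF scale_has_derivative holo_on_has_derivative[OF g]]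
    by (simp add: has_field_derivative_def)
qed

text \<open>The function \<open>z powi (- w) * g (scale z u)\<close> has derivative zero by the
  Euler equation, so it keeps its value at \<open>z = 1\<close>. The half disc
  \<open>Re z > 0\<close> is convex and avoids the origin, where negative powers fail.\<close>

lemma euler_imp_scaling:
  assumes g: "holo_on (ball 0 R) g" and u: "u \<in> ball 0 R"
    and eul: "\<And>x. x \<in> ball 0 R \<Longrightarrow> euler v g x = of_int w * g x"
    and z: "norm z \<le> 1" "Re z > 0"
  shows "g (scale z u) = z powi w * g u"
proof -
  define S where "S = cball 0 1 \<inter> {z. Re z > 0}"
  have "convex S" unfolding S_def by (intro convex_Int convex_cball convex_halfspace_Re_gt)
  moreover have "((\<lambda>z. z powi (- w) * g (scale z u)) has_field_derivative 0) (at z within S)" if "z \<in> S" for z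
  proof -
    have z: "norm z \<le> 1" "z \<noteq> 0" using that by (auto simp: S_def)
    have m: "scale z u \<in> ball 0 R" using scale_mem_ball z(1) u by blast
    have "((\<lambda>z. z powi (- w) * g (scale z u)) has_field_derivative
       (of_int (- w) * z powi (- w - 1) * 1) * g (scale z u) + (euler v g (scale z u) / z) * z powi (- w)) (at z)"
      by (intro DERIV_mult DERIV_power_int DERIV_ident scale_line_has_field_derivative[OF g m z(2)] disjI2 z(2))
    moreover have "(of_int (- w) * z powi (- w - 1) * 1) * g (scale z u) + (euler v g (scale z u) / z) * z powi (- w) = 0"
      using z(2) by (simp add: eul[OF m] power_int_diff)
    ultimately show ?thesis by (simp add: has_field_derivative_at_within)
  qed
  ultimately obtain c where c: "\<And>z. z \<in> S \<Longrightarrow> z powi (- w) * g (scale z u) = c"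
    using has_field_derivative_zero_constant[of S "\<lambda>z. z powi (- w) * g (scale z u)"] by blast
  have "scale 1 u = u" by (simp add: scale_def vec_eq_iff)
  then have "z powi (- w) * g (scale z u) = g u"
    using c[of z] c[of 1] z by (simp add: S_def)
  moreover have "z \<noteq> 0" using z by auto
  ultimately show ?thesis by (simp add: power_int_minus field_simps)
qed

text \<open>Let \<open>z\<close> tend to zero in \<open>z ^ nat (- w) * g (scale z u) = g u\<close>.
  The power of zero treats both cases at once: it is 1 for \<open>w = 0\<close> and 0 for
  \<open>w < 0\<close>.\<close>

lemma scaling_limit:
  assumes "R > 0" and g: "holo_on (ball 0 R) g" and u: "u \<in> ball 0 R" and w: "w \<le> 0"
    and sc: "\<And>z. norm z \<le> 1 \<Longrightarrow> Re z > 0 \<Longrightarrow> g (scale z u) = z powi w * g u"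
  shows "g u = 0 ^ nat (- w) * g 0"
proof -
  define z where "z k = complex_of_real (inverse (real (Suc k)))" for k
  have z1: "norm (z k) \<le> 1" "Re (z k) > 0" for k
    unfolding z_def norm_of_real by (auto simp: field_simps)
  have z0: "z \<longlonglongrightarrow> 0"
    unfolding z_def by (metis LIMSEQ_inverse_real_of_nat of_real_0 tendsto_of_real)
  have "(\<lambda>k. norm (z k) * norm u) \<longlonglongrightarrow> 0"
    using z0 tendsto_mult_left_zero tendsto_norm_zero by blast
  then have "(\<lambda>k. scale (z k) u) \<longlonglongrightarrow> 0"
    by (rule Lim_null_comparison[rotated]) (simp add: norm_scale_le[OF z1(1)])
  moreover have "isCont g 0"
    using holo_on_has_derivative[OF g, of 0] \<open>R > 0\<close> has_derivative_continuous by auto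
  ultimately have "(\<lambda>k. g (scale (z k) u)) \<longlonglongrightarrow> g 0" using isCont_tendsto_compose by blast
  then have "(\<lambda>k. z k ^ nat (- w) * g (scale (z k) u)) \<longlonglongrightarrow> 0 ^ nat (- w) * g 0"
    by (intro tendsto_intros z0)
  moreover have "z k ^ nat (- w) * g (scale (z k) u) = g u" for k
  proof -
    have "z k \<noteq> 0" using z1(2)[of k] by auto
    then have "z k ^ nat (- w) * z k powi w = 1"
      using w by (simp add: power_int_def power_mult_distrib[symmetric])
    then show ?thesis using sc[OF z1] by (simp flip: mult.assoc)
  qed
  ultimately show ?thesis using LIMSEQ_unique[OF tendsto_const] by simp
qed

lemma scale_add_axis: "scale z (u + axis i y) = scale z u + axis i (z ^ v i * y)"
  by (simp add: scale_def vec_eq_iff axis_def distrib_left)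

text \<open>Differentiate the scaling relation in the direction \<open>i\<close>: the chain rule
  gives a factor \<open>z ^ v i\<close> on one side, which lowers the weight by
  \<open>v i\<close>.\<close>

lemma partial_scaling:
  assumes g: "holo_on (ball 0 R) g"
    and sc: "\<And>u z. u \<in> ball 0 R \<Longrightarrow> norm z \<le> 1 \<Longrightarrow> Re z > 0 \<Longrightarrow> g (scale z u) = z powi w * g u"
    and u: "u \<in> ball 0 R" and z: "norm z \<le> 1" "Re z > 0"
  shows "partial i g (scale z u) = z powi (w - int (v i)) * partial i g u"
proof -
  have z0: "z \<noteq> 0" using z by auto
  have m: "scale z u \<in> ball 0 R" using scale_mem_ball z(1) u by blast
  have "((\<lambda>y. g (scale z u + axis i y)) has_field_derivative partial i g (scale z u)) (at (z ^ v i * 0))"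
    using holo_on_axis_line[OF g, of "scale z u" i 0] m by (simp add: axis_zero)
  moreover have "((\<lambda>y. z ^ v i * y) has_field_derivative z ^ v i) (at 0)"
    by (auto intro!: derivative_eq_intros)
  ultimately have "((\<lambda>y. g (scale z u + axis i (z ^ v i * y))) has_field_derivative partial i g (scale z u) * z ^ v i) (at 0)"
    by (rule DERIV_chain2)
  moreover have "((\<lambda>y. g (scale z u + axis i (z ^ v i * y))) has_field_derivative z powi w * partial i g u) (at 0)"
  proof (rule has_field_derivative_transform_within_open)
    show "((\<lambda>y. z powi w * g (u + axis i y)) has_field_derivative z powi w * partial i g u) (at 0)"
      using holo_on_axis_line[OF g, of u i 0] u by (intro DERIV_cmult) (simp add: axis_zero)
    show "open (ball (0::complex) (R - norm u))" by simp
    show "0 \<in> ball (0::complex) (R - norm u)" using u by simp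
    show "z powi w * g (u + axis i y) = g (scale z u + axis i (z ^ v i * y))" if "y \<in> ball 0 (R - norm u)" for y
    proof -
      have "norm (u + axis i y) < R"
        using that norm_triangle_ineq[of u "axis i y"] by (simp add: norm_axis_complex)
      then show ?thesis using sc[of "u + axis i y" z] z by (simp add: scale_add_axis)
    qed
  qed
  ultimately have "partial i g (scale z u) * z ^ v i = z powi w * partial i g u"
    by (rule DERIV_unique)
  then show ?thesis using z0 by (simp add: power_int_diff field_simps)
qed

text \<open>Induction on the weight over one fixed ball. The partial derivatives scale with smaller
  weight and hence agree with polynomials there; Euler's formula assembles \<open>g\<close> from
  them.\<close>

lemma scaling_imp_wpoly:
  assumes "R > 0" and "holo_on (ball 0 R) g"
    and "\<And>u z. u \<in> ball 0 R \<Longrightarrow> norm z \<le> 1 \<Longrightarrow> Re z > 0 \<Longrightarrow> g (scale z u) = z powi w * g u"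
  shows "\<exists>q. wpoly w q \<and> (\<forall>u\<in>ball 0 R. g u = q u)"
  using assms(2,3)
proof (induction w arbitrary: g rule: weight_induct)
  case (neg w)
  then have "g u = 0" if "u \<in> ball 0 R" for u
    using scaling_limit[OF assms(1) neg.prems(1) that, of w] neg.prems(2)[OF that] neg.hyps by simp
  then show ?case by (auto intro: wpoly.zero)
next
  case zero
  then have "g u = g 0" if "u \<in> ball 0 R" for u
    using scaling_limit[OF assms(1) zero.prems(1) that, of 0] zero.prems(2)[OF that] by simp
  then show ?case by (auto intro: wpoly.const)
next
  case (pos w)
  have "\<exists>q. wpoly (w - int (v i)) q \<and> (\<forall>u\<in>ball 0 R. partial i g u = q u)" for i
    by (rule pos.IH[OF holo_on_partial[OF open_ball pos.prems(1)] partial_scaling[OF pos.prems]])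
  then obtain q where q: "\<And>i. wpoly (w - int (v i)) (q i)" "\<And>i u. u \<in> ball 0 R \<Longrightarrow> partial i g u = q i u"
    by metis
  define Q where "Q = (\<lambda>u. \<Sum>i\<in>UNIV. (of_nat (v i) / of_int w) * (u $ i * q i u))"
  have Q: "wpoly w Q" unfolding Q_def by (intro wpoly_sum wpoly_cmult wpoly_coord' q(1))
  have "g u = Q u" if u: "u \<in> ball 0 R" for u
  proof -
    \<comment> \<open>Scaling is known for \<open>norm z \<le> 1\<close> only, so
      \<open>z = 1\<close> has no full neighbourhood in which to differentiate. Euler's formula is
      obtained at the interior point \<open>z = 1/2\<close> and carried from \<open>x\<close> back
      to \<open>u\<close> by homogeneity.\<close>
    have half: "norm (1/2 :: complex) \<le> 1" "Re (1/2) > 0" "(1/2 :: complex) \<noteq> 0" by auto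
    define x where "x = scale (1/2) u"
    have x: "x \<in> ball 0 R" unfolding x_def by (rule scale_mem_ball[OF half(1) u])
    have "((\<lambda>z. g (scale z u)) has_field_derivative euler v g x / (1/2)) (at (1/2))"
      unfolding x_def by (rule scale_line_has_field_derivative[OF pos.prems(1) x[unfolded x_def] half(3)])
    moreover have "((\<lambda>z. g (scale z u)) has_field_derivative of_int w * (1/2) powi (w - 1) * 1 * g u) (at (1/2))"
    proof (rule has_field_derivative_transform_within_open)
      show "((\<lambda>z. z powi w * g u) has_field_derivative of_int w * (1/2) powi (w - 1) * 1 * g u) (at (1/2 :: complex))"
        by (intro DERIV_cmult_right DERIV_power_int DERIV_ident) simp
      show "open (ball 0 1 \<inter> {z. Re z > 0})" by (intro open_Int open_ball open_halfspace_Re_gt)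
      show "z powi w * g u = g (scale z u)" if "z \<in> ball 0 1 \<inter> {z. Re z > 0}" for z
        using pos.prems(2)[OF u, of z] that by simp
    qed auto
    ultimately have "euler v g x / (1/2) = of_int w * (1/2) powi (w - 1) * 1 * g u"
      by (rule DERIV_unique)
    then have "euler v g x = of_int w * ((1/2) powi w * g u)"
      by (simp add: power_int_diff)
    also have "(1/2) powi w * g u = g x" unfolding x_def using pos.prems(2)[OF u half(1,2)] by simp
    finally have "g x = Q x"
      using pos.hyps by (simp add: euler_def Q_def q(2)[OF x] sum_divide_distrib[symmetric] mult.assoc field_simps)
    moreover have "g x = (1/2) powi w * g u" "Q x = (1/2) powi w * Q u"
      unfolding x_def using pos.prems(2)[OF u half(1,2)] wpoly_scale[OF Q half(3)] by auto
    ultimately show ?thesis by simp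
  qed
  then show ?case using Q by blast
qed

lemma euler_imp_wpoly:
  assumes "R > 0" "holo_on (ball 0 R) g" "\<And>x. x \<in> ball 0 R \<Longrightarrow> euler v g x = of_int w * g x"
  shows "\<exists>q. wpoly w q \<and> (\<forall>u\<in>ball 0 R. g u = q u)"
  using assms by (intro scaling_imp_wpoly euler_imp_scaling) auto

lemma eventually_nhds_ball: "R > 0 \<Longrightarrow> \<forall>u\<in>ball a R. P u \<Longrightarrow> \<forall>\<^sub>F u in nhds a. P u"
  unfolding eventually_nhds by (intro exI[of _ "ball a R"]) auto

lemma euler_germ_imp_wpoly:
  assumes "holo_near 0 g" "\<forall>\<^sub>F x in nhds 0. euler v g x = of_int w * g x"
  shows "\<exists>q. wpoly w q \<and> (\<forall>\<^sub>F u in nhds 0. g u = q u)"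
proof -
  obtain S T where "open S" "0 \<in> S" "holo_on S g" "open T" "0 \<in> T" "\<And>x. x \<in> T \<Longrightarrow> euler v g x = of_int w * g x"
    using assms unfolding holo_near_iff_holo_on eventually_nhds by metis
  moreover from this obtain R where "R > 0" "ball 0 R \<subseteq> S \<inter> T"
    by (meson IntI openE open_Int)
  ultimately obtain q where "wpoly w q" "\<forall>u\<in>ball 0 R. g u = q u"
    using euler_imp_wpoly[of R g w] holo_on_subset[of S g "ball 0 R"] by (metis le_inf_iff subsetD)
  then show ?thesis using eventually_nhds_ball[OF \<open>R > 0\<close>] by blast
qed

text \<open>On each ball \<open>g\<close> agrees with a polynomial that might depend on the radius.
  All of these equal \<open>wpart w g\<close>, which is determined by the germ at the origin, so one
  polynomial serves everywhere.\<close>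

lemma wpoly_of_euler_UNIV:
  assumes "holo_on UNIV g" "\<And>x. euler v g x = of_int w * g x"
  shows "wpoly w g"
proof -
  have "\<exists>q. wpoly w q \<and> (\<forall>u\<in>ball 0 R. g u = q u)" if "R > 0" for R
    using assms that by (intro euler_imp_wpoly) (auto intro: holo_on_subset)
  then have R: "g u = wpart w g u" if "R > 0" "u \<in> ball 0 R" for R u
  proof -
    obtain q where q: "wpoly w q" "\<forall>u\<in>ball 0 R. g u = q u"
      using \<open>\<And>R. R > 0 \<Longrightarrow> _\<close> \<open>R > 0\<close> by blast
    have "\<forall>\<^sub>F u in nhds 0. g u = q u"
      by (rule eventually_nhds_ball[OF \<open>R > 0\<close> q(2)])
    then show ?thesis using q \<open>u \<in> ball 0 R\<close> wpart_wpoly[OF q(1), of w u] wpart_cong[of g q w u] by simp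
  qed
  have "g = wpart w g"
  proof
    show "g u = wpart w g u" for u by (rule R[of "norm u + 1"]) (auto simp: add_nonneg_pos)
  qed
  then show ?thesis using wpoly_wpart by metis
qed

end

section \<open>Exterior algebra\<close>

text \<open>The sign that sorts \<open>du_i\<close> into its place among the factors of
  \<open>du_I\<close>; the index \<open>i\<close> itself is never counted.\<close>

definition ins_sign :: "'n::{finite,linorder} \<Rightarrow> 'n set \<Rightarrow> complex" where
  "ins_sign i I = (-1) ^ card {l \<in> I. l < i}"

text \<open>Left multiplication by \<open>du_i\<close>; \<open>int_mult i\<close> is contraction
  with the i-th coordinate field. Wedging with a one-form, \<open>ext_d\<close> and
  \<open>contract_euler\<close> are combinations of these operators, so their identities reduce to
  anticommutation relations.\<close>

definition ext_mult :: "'n::{finite,linorder} \<Rightarrow> 'n form \<Rightarrow> 'n form" where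
  "ext_mult i \<beta> = (\<lambda>I u. if i \<in> I then ins_sign i I * \<beta> (I - {i}) u else 0)"

definition int_mult :: "'n::{finite,linorder} \<Rightarrow> 'n form \<Rightarrow> 'n form" where
  "int_mult i \<beta> = (\<lambda>I u. if i \<in> I then 0 else ins_sign i I * \<beta> (insert i I) u)"

definition one_form :: "('n::{finite,linorder}) form \<Rightarrow> bool" where
  "one_form a \<longleftrightarrow> (\<forall>I. card I \<noteq> 1 \<longrightarrow> a I = 0)"

lemma ins_sign_square [simp]: "ins_sign i I * ins_sign i I = 1"
  by (simp add: ins_sign_def flip: power_mult_distrib)

lemma ins_sign_square' [simp]: "ins_sign i I * (ins_sign i I * x) = x"
  by (simp flip: mult.assoc)

lemma ins_sign_Diff_self [simp]: "ins_sign i (I - {i}) = ins_sign i I"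
  unfolding ins_sign_def by (rule arg_cong[where f = "\<lambda>A. (-1) ^ card A"]) auto

lemma ins_sign_insert_self [simp]: "ins_sign i (insert i I) = ins_sign i I"
  unfolding ins_sign_def by (rule arg_cong[where f = "\<lambda>A. (-1) ^ card A"]) auto

lemma ins_sign_insert:
  assumes "j \<notin> I"
  shows "ins_sign i (insert j I) = (if j < i then - ins_sign i I else ins_sign i I)"
proof (cases "j < i")
  case True
  then have "{l \<in> insert j I. l < i} = insert j {l \<in> I. l < i}" by auto
  then show ?thesis using assms True by (simp add: ins_sign_def)
next
  case False
  then have "{l \<in> insert j I. l < i} = {l \<in> I. l < i}" by auto
  then show ?thesis using False by (simp add: ins_sign_def)
qed

lemma ins_sign_Diff:
  assumes "j \<in> I"
  shows "ins_sign i (I - {j}) = (if j < i then - ins_sign i I else ins_sign i I)"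
  using ins_sign_insert[of j "I - {j}" i] assms by (auto simp: insert_absorb)

lemma ins_sign_Un:
  assumes "J \<inter> L = {}"
  shows "ins_sign i (J \<union> L) = ins_sign i J * ins_sign i L"
proof -
  have "{l \<in> J \<union> L. l < i} = {l \<in> J. l < i} \<union> {l \<in> L. l < i}" by auto
  then have "card {l \<in> J \<union> L. l < i} = card {l \<in> J. l < i} + card {l \<in> L. l < i}"
    using assms by (auto intro!: card_Un_disjoint)
  then show ?thesis by (simp add: ins_sign_def power_add)
qed

lemma shuffle_sign_singleton: "shuffle_sign {i} I = ins_sign i I"
proof -
  have "{(j, l). j \<in> {i} \<and> l \<in> I \<and> l < j} = Pair i ` {l \<in> I. l < i}" by auto
  then show ?thesis by (simp add: shuffle_sign_def ins_sign_def card_image inj_on_def)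
qed

lemma shuffle_sign_insert:
  assumes "i \<notin> J"
  shows "shuffle_sign (insert i J) L = ins_sign i L * shuffle_sign J L"
proof -
  let ?A = "Pair i ` {l \<in> L. l < i}" and ?B = "{(j, l). j \<in> J \<and> l \<in> L \<and> l < j}"
  have eq: "{(j, l). j \<in> insert i J \<and> l \<in> L \<and> l < j} = ?A \<union> ?B" by auto
  have "card (?A \<union> ?B) = card ?A + card ?B"
    using assms by (intro card_Un_disjoint) auto
  moreover have "card ?A = card {l \<in> L. l < i}" by (simp add: card_image inj_on_def)
  ultimately show ?thesis unfolding shuffle_sign_def ins_sign_def eq by (simp add: power_add)
qed

lemma shuffle_sign_empty [simp]: "shuffle_sign {} L = 1" "shuffle_sign J {} = 1"
  by (simp_all add: shuffle_sign_def)

section \<open>Anticommutation relations\<close>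

lemma ext_mult_self: "ext_mult i (ext_mult i \<beta>) I u = 0"
  by (simp add: ext_mult_def)

text \<open>Removing one index changes the sign of the other insertion exactly when the removed
  index is the smaller one, and this happens in one of the two orders only.\<close>

lemma ext_mult_commute:
  assumes "i \<noteq> j"
  shows "ext_mult i (ext_mult j \<beta>) I u = - ext_mult j (ext_mult i \<beta>) I u"
proof (cases "i \<in> I \<and> j \<in> I")
  case True
  then show ?thesis
    using assms by (auto simp: ext_mult_def ins_sign_Diff Diff_insert2[symmetric] insert_commute
      Diff_insert[symmetric] dest: less_asym)
qed (auto simp: ext_mult_def)

lemma int_ext_mult_self: "int_mult i (ext_mult i \<beta>) I u + ext_mult i (int_mult i \<beta>) I u = \<beta> I u"
  by (auto simp: ext_mult_def int_mult_def insert_absorb)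

lemma ext_int_mult_self: "ext_mult i (int_mult i \<beta>) I u = (if i \<in> I then \<beta> I u else 0)"
  by (auto simp: ext_mult_def int_mult_def insert_absorb)

lemma int_ext_mult:
  assumes "i \<noteq> j"
  shows "int_mult i (ext_mult j \<beta>) I u + ext_mult j (int_mult i \<beta>) I u = 0"
proof (cases "i \<notin> I \<and> j \<in> I")
  case True
  moreover have "insert i I - {j} = insert i (I - {j})" using assms by auto
  ultimately show ?thesis
    using assms by (auto simp: ext_mult_def int_mult_def ins_sign_Diff ins_sign_insert dest: less_asym)
qed (use assms in \<open>auto simp: ext_mult_def int_mult_def\<close>)

lemma ext_mult_sum:
  "ext_mult i (\<lambda>I u. \<Sum>j\<in>A. c j u * \<beta> j I u) I u = (\<Sum>j\<in>A. c j u * ext_mult i (\<beta> j) I u)"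
  by (auto simp: ext_mult_def sum_distrib_left mult_ac)

lemma int_mult_sum:
  "int_mult i (\<lambda>I u. \<Sum>j\<in>A. c j u * \<beta> j I u) I u = (\<Sum>j\<in>A. c j u * int_mult i (\<beta> j) I u)"
  by (auto simp: int_mult_def sum_distrib_left mult_ac)

lemma wedge_one_form:
  assumes "one_form a"
  shows "(a \<and>\<^sub>\<Omega> \<beta>) = (\<lambda>I u. \<Sum>i\<in>UNIV. a {i} u * ext_mult i \<beta> I u)"
proof (intro ext)
  fix I u
  have "(a \<and>\<^sub>\<Omega> \<beta>) I u = (\<Sum>J\<in>(\<lambda>i. {i}) ` I. shuffle_sign J (I - J) * a J u * \<beta> (I - J) u)"
    unfolding wedge_def
  proof (rule sum.mono_neutral_right)
    show "\<forall>J\<in>Pow I - (\<lambda>i. {i}) ` I. shuffle_sign J (I - J) * a J u * \<beta> (I - J) u = 0"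
    proof
      fix J assume J: "J \<in> Pow I - (\<lambda>i. {i}) ` I"
      have "card J \<noteq> 1"
      proof
        assume "card J = 1"
        then obtain i where "J = {i}" using card_1_singletonE by blast
        then show False using J by auto
      qed
      then show "shuffle_sign J (I - J) * a J u * \<beta> (I - J) u = 0"
        using assms by (simp add: one_form_def)
    qed
  qed auto
  also have "\<dots> = (\<Sum>i\<in>I. a {i} u * ext_mult i \<beta> I u)"
    by (subst sum.reindex) (auto simp: ext_mult_def shuffle_sign_singleton mult_ac intro!: sum.cong)
  also have "\<dots> = (\<Sum>i\<in>UNIV. a {i} u * ext_mult i \<beta> I u)"
    by (rule sum.mono_neutral_left) (auto simp: ext_mult_def)
  finally show "(a \<and>\<^sub>\<Omega> \<beta>) I u = (\<Sum>i\<in>UNIV. a {i} u * ext_mult i \<beta> I u)" .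
qed

lemma ext_d_eq: "ext_d \<omega> = (\<lambda>I u. \<Sum>i\<in>UNIV. ext_mult i (\<lambda>J. partial i (\<omega> J)) I u)"
proof (intro ext)
  fix I u
  have "ext_d \<omega> I u = (\<Sum>i\<in>I. ext_mult i (\<lambda>J. partial i (\<omega> J)) I u)"
    by (auto simp: ext_d_def ext_mult_def shuffle_sign_singleton intro!: sum.cong)
  also have "\<dots> = (\<Sum>i\<in>UNIV. ext_mult i (\<lambda>J. partial i (\<omega> J)) I u)"
    by (rule sum.mono_neutral_left) (auto simp: ext_mult_def)
  finally show "ext_d \<omega> I u = (\<Sum>i\<in>UNIV. ext_mult i (\<lambda>J. partial i (\<omega> J)) I u)" .
qed

lemma contract_euler_eq:
  "contract_euler v \<omega> = (\<lambda>I u. \<Sum>i\<in>UNIV. (of_nat (v i) * u $ i) * int_mult i \<omega> I u)"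
proof (intro ext)
  fix I u
  have "contract_euler v \<omega> I u = (\<Sum>i\<in>-I. (of_nat (v i) * u $ i) * int_mult i \<omega> I u)"
    by (auto simp: contract_euler_def int_mult_def shuffle_sign_singleton mult_ac intro!: sum.cong)
  also have "\<dots> = (\<Sum>i\<in>UNIV. (of_nat (v i) * u $ i) * int_mult i \<omega> I u)"
    by (rule sum.mono_neutral_left) (auto simp: int_mult_def)
  finally show "contract_euler v \<omega> I u = (\<Sum>i\<in>UNIV. (of_nat (v i) * u $ i) * int_mult i \<omega> I u)" .
qed

lemma wedge_one_forms_anticommute:
  assumes "one_form a" "one_form b"
  shows "(a \<and>\<^sub>\<Omega> b \<and>\<^sub>\<Omega> \<beta>) I u = - (b \<and>\<^sub>\<Omega> a \<and>\<^sub>\<Omega> \<beta>) I u"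
proof -
  have 1: "(a \<and>\<^sub>\<Omega> b \<and>\<^sub>\<Omega> \<beta>) I u = (\<Sum>i\<in>UNIV. \<Sum>j\<in>UNIV. a {i} u * (b {j} u * ext_mult i (ext_mult j \<beta>) I u))"
    if "one_form a" "one_form b" for a b
    by (simp add: wedge_one_form that ext_mult_sum sum_distrib_left)
  have "a {i} u * (b {j} u * ext_mult i (ext_mult j \<beta>) I u) = - (b {j} u * (a {i} u * ext_mult j (ext_mult i \<beta>) I u))" for i j
    using ext_mult_commute[of i j \<beta> I u] by (cases "i = j") (auto simp: ext_mult_self)
  then have "(a \<and>\<^sub>\<Omega> b \<and>\<^sub>\<Omega> \<beta>) I u = - (\<Sum>i\<in>UNIV. \<Sum>j\<in>UNIV. b {j} u * (a {i} u * ext_mult j (ext_mult i \<beta>) I u))"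
    by (simp add: 1 assms sum_negf)
  also have "\<dots> = - (b \<and>\<^sub>\<Omega> a \<and>\<^sub>\<Omega> \<beta>) I u"
    by (subst sum.swap) (simp add: 1 assms)
  finally show ?thesis .
qed

lemma wedge_one_form_self: "one_form a \<Longrightarrow> a \<and>\<^sub>\<Omega> a \<and>\<^sub>\<Omega> \<beta> = 0"
  using wedge_one_forms_anticommute[of a a \<beta>] by (intro ext) (simp add: eq_neg_iff_add_eq_0 flip: mult_2)

text \<open>The antiderivation rule. Off the diagonal \<open>int_mult i\<close> and
  \<open>ext_mult j\<close> anticommute; the diagonal terms sum to the pairing of \<open>a\<close>
  with the Euler field.\<close>

lemma contract_euler_wedge_one_form:
  assumes "one_form a"
  shows "contract_euler v (a \<and>\<^sub>\<Omega> \<beta>) I u =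
    (\<Sum>i\<in>UNIV. of_nat (v i) * u $ i * a {i} u) * \<beta> I u - (a \<and>\<^sub>\<Omega> contract_euler v \<beta>) I u"
proof -
  have *: "int_mult i (ext_mult j \<beta>) I u = (if i = j then \<beta> I u else 0) - ext_mult j (int_mult i \<beta>) I u" for i j
    using int_ext_mult[of i j \<beta> I u] int_ext_mult_self[of i \<beta> I u]
    by (auto simp: algebra_simps eq_neg_iff_add_eq_0)
  have "contract_euler v (a \<and>\<^sub>\<Omega> \<beta>) I u = (\<Sum>i\<in>UNIV. \<Sum>j\<in>UNIV.
     (if i = j then of_nat (v i) * u $ i * a {i} u * \<beta> I u else 0)
      - of_nat (v i) * u $ i * a {j} u * ext_mult j (int_mult i \<beta>) I u)"
    unfolding contract_euler_eq wedge_one_form[OF assms] int_mult_sum sum_distrib_left *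
    by (intro sum.cong refl) (simp add: right_diff_distrib)
  also have "\<dots> = (\<Sum>i\<in>UNIV. of_nat (v i) * u $ i * a {i} u * \<beta> I u)
     - (\<Sum>i\<in>UNIV. \<Sum>j\<in>UNIV. of_nat (v i) * u $ i * a {j} u * ext_mult j (int_mult i \<beta>) I u)"
    by (simp add: sum_subtractf)
  also have "(\<Sum>i\<in>UNIV. \<Sum>j\<in>UNIV. of_nat (v i) * u $ i * a {j} u * ext_mult j (int_mult i \<beta>) I u)
     = (a \<and>\<^sub>\<Omega> contract_euler v \<beta>) I u"
    unfolding contract_euler_eq wedge_one_form[OF assms] ext_mult_sum sum_distrib_left
    by (subst sum.swap) (simp add: mult_ac)
  finally show ?thesis by (simp add: sum_distrib_right)
qed

text \<open>Associativity with a single \<open>du_i\<close> on the left: the contributing subsets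
  contain \<open>i\<close>, removing it reindexes the sum, and the sign of inserting
  \<open>i\<close> into \<open>I\<close> splits over the two factors. By linearity this gives
  associativity for every one-form on the left.\<close>

lemma ext_mult_wedge: "ext_mult i \<gamma> \<and>\<^sub>\<Omega> \<beta> = ext_mult i (\<gamma> \<and>\<^sub>\<Omega> \<beta>)"
proof (intro ext)
  fix I u
  show "(ext_mult i \<gamma> \<and>\<^sub>\<Omega> \<beta>) I u = ext_mult i (\<gamma> \<and>\<^sub>\<Omega> \<beta>) I u"
  proof (cases "i \<in> I")
    case False
    then have "(ext_mult i \<gamma> \<and>\<^sub>\<Omega> \<beta>) I u = 0"
      unfolding wedge_def by (intro sum.neutral) (auto simp: ext_mult_def)
    then show ?thesis using False by (simp add: ext_mult_def)
  next
    case True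
    have "(ext_mult i \<gamma> \<and>\<^sub>\<Omega> \<beta>) I u
      = (\<Sum>J\<in>insert i ` Pow (I - {i}). shuffle_sign J (I - J) * ext_mult i \<gamma> J u * \<beta> (I - J) u)"
      unfolding wedge_def
    proof (rule sum.mono_neutral_right)
      show "insert i ` Pow (I - {i}) \<subseteq> Pow I" using True by auto
      show "\<forall>J\<in>Pow I - insert i ` Pow (I - {i}). shuffle_sign J (I - J) * ext_mult i \<gamma> J u * \<beta> (I - J) u = 0"
      proof
        fix J assume J: "J \<in> Pow I - insert i ` Pow (I - {i})"
        have "i \<notin> J"
        proof
          assume "i \<in> J"
          then have "J = insert i (J - {i})" "J - {i} \<in> Pow (I - {i})" using J by auto
          then show False using J by blast
        qed
        then show "shuffle_sign J (I - J) * ext_mult i \<gamma> J u * \<beta> (I - J) u = 0" by (simp add: ext_mult_def)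
      qed
    qed auto
    also have "\<dots> = (\<Sum>J\<in>Pow (I - {i}). shuffle_sign (insert i J) (I - insert i J) * ext_mult i \<gamma> (insert i J) u * \<beta> (I - insert i J) u)"
      by (subst sum.reindex) (auto simp: inj_on_def)
    also have "\<dots> = (\<Sum>J\<in>Pow (I - {i}). ins_sign i I * (shuffle_sign J (I - {i} - J) * \<gamma> J u * \<beta> (I - {i} - J) u))"
    proof (rule sum.cong[OF refl])
      fix J assume J: "J \<in> Pow (I - {i})"
      let ?L = "I - {i} - J"
      have L: "I - insert i J = ?L" by auto
      have "ins_sign i I = ins_sign i (I - {i})" by simp
      also have "I - {i} = J \<union> ?L" using J by auto
      also have "ins_sign i (J \<union> ?L) = ins_sign i J * ins_sign i ?L" by (rule ins_sign_Un) auto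
      finally have s: "ins_sign i I = ins_sign i J * ins_sign i ?L" .
      have "i \<notin> J" using J by auto
      then have "ext_mult i \<gamma> (insert i J) u = ins_sign i J * \<gamma> J u" by (simp add: ext_mult_def)
      then show "shuffle_sign (insert i J) (I - insert i J) * ext_mult i \<gamma> (insert i J) u * \<beta> (I - insert i J) u
        = ins_sign i I * (shuffle_sign J ?L * \<gamma> J u * \<beta> ?L u)"
        unfolding L s shuffle_sign_insert[OF \<open>i \<notin> J\<close>] by (simp add: mult_ac)
    qed
    also have "\<dots> = ext_mult i (\<gamma> \<and>\<^sub>\<Omega> \<beta>) I u"
      using True by (simp add: ext_mult_def wedge_def sum_distrib_left)
    finally show ?thesis .
  qed
qed

lemma wedge_sum_left:
  "((\<lambda>I u. \<Sum>j\<in>A. c j u * \<gamma> j I u) \<and>\<^sub>\<Omega> \<beta>) I u = (\<Sum>j\<in>A. c j u * (\<gamma> j \<and>\<^sub>\<Omega> \<beta>) I u)"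
  unfolding wedge_def sum_distrib_left sum_distrib_right
  by (subst sum.swap) (simp add: mult_ac)

lemma wedge_one_form_assoc:
  assumes "one_form a"
  shows "(a \<and>\<^sub>\<Omega> \<gamma>) \<and>\<^sub>\<Omega> \<beta> = a \<and>\<^sub>\<Omega> \<gamma> \<and>\<^sub>\<Omega> \<beta>"
  by (intro ext) (simp add: wedge_one_form[OF assms] wedge_sum_left ext_mult_wedge)

lemma fun_form_wedge: "fun_form g \<and>\<^sub>\<Omega> \<beta> = g *\<^sub>\<Omega> \<beta>"
proof (intro ext)
  fix I u
  have "(fun_form g \<and>\<^sub>\<Omega> \<beta>) I u = (\<Sum>J\<in>{{}}. shuffle_sign J (I - J) * fun_form g J u * \<beta> (I - J) u)"
    unfolding wedge_def by (rule sum.mono_neutral_right) (auto simp: fun_form_def)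
  then show "(fun_form g \<and>\<^sub>\<Omega> \<beta>) I u = (g *\<^sub>\<Omega> \<beta>) I u" by (simp add: fun_form_def smult_form_def)
qed

lemma wedge_fun_form: "\<beta> \<and>\<^sub>\<Omega> fun_form g = g *\<^sub>\<Omega> \<beta>"
proof (intro ext)
  fix I u
  have "(\<beta> \<and>\<^sub>\<Omega> fun_form g) I u = (\<Sum>J\<in>{I}. shuffle_sign J (I - J) * \<beta> J u * fun_form g (I - J) u)"
    unfolding wedge_def by (rule sum.mono_neutral_right) (auto simp: fun_form_def)
  then show "(\<beta> \<and>\<^sub>\<Omega> fun_form g) I u = (g *\<^sub>\<Omega> \<beta>) I u" by (simp add: fun_form_def smult_form_def)
qed

lemma wedge_add_right: "\<alpha> \<and>\<^sub>\<Omega> (\<beta> + \<gamma>) = \<alpha> \<and>\<^sub>\<Omega> \<beta> + \<alpha> \<and>\<^sub>\<Omega> \<gamma>"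
  by (intro ext) (simp add: wedge_def distrib_left sum.distrib)

lemma wedge_smult_right: "\<alpha> \<and>\<^sub>\<Omega> (g *\<^sub>\<Omega> \<beta>) = g *\<^sub>\<Omega> (\<alpha> \<and>\<^sub>\<Omega> \<beta>)"
  by (intro ext) (simp add: wedge_def smult_form_def sum_distrib_left mult_ac)

lemma sum_form_apply: "(\<Sum>k\<in>A. F k) I u = (\<Sum>k\<in>A. F k I u)"
  for F :: "'a \<Rightarrow> 'n::{finite,linorder} form"
  by (induction A rule: infinite_finite_induct) auto

lemma wedge_zero_right: "\<alpha> \<and>\<^sub>\<Omega> 0 = 0"
  by (intro ext) (simp add: wedge_def)

lemma smult_form_zero: "g *\<^sub>\<Omega> 0 = 0"
  by (intro ext) (simp add: smult_form_def)

lemma wedge_sum_right: "\<alpha> \<and>\<^sub>\<Omega> (\<Sum>k\<in>A. \<beta> k) = (\<Sum>k\<in>A. \<alpha> \<and>\<^sub>\<Omega> \<beta> k)"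
  by (induction A rule: infinite_finite_induct) (simp_all only: sum.infinite sum.empty sum.insert wedge_zero_right wedge_add_right not_False_eq_True)

lemma big_wedge_Cons_wedge:
  assumes "one_form a"
  shows "big_wedge (a # as) \<and>\<^sub>\<Omega> \<beta> = a \<and>\<^sub>\<Omega> big_wedge as \<and>\<^sub>\<Omega> \<beta>"
  by (simp add: big_wedge_def wedge_one_form_assoc[OF assms])

lemma big_wedge_Nil_wedge: "big_wedge [] \<and>\<^sub>\<Omega> \<beta> = \<beta>"
  by (intro ext) (simp add: big_wedge_def fun_form_wedge smult_form_def)

text \<open>Moving \<open>a\<close> to the left past one-forms changes only the sign, until it meets
  its own copy in the product.\<close>

lemma big_wedge_wedge_mem:
  assumes "\<And>b. b \<in> set as \<Longrightarrow> one_form b" "a \<in> set as"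
  shows "big_wedge as \<and>\<^sub>\<Omega> a \<and>\<^sub>\<Omega> \<beta> = 0"
proof -
  have commute: "big_wedge bs \<and>\<^sub>\<Omega> a \<and>\<^sub>\<Omega> \<beta> = (\<lambda>_. (-1) ^ length bs) *\<^sub>\<Omega> (a \<and>\<^sub>\<Omega> big_wedge bs \<and>\<^sub>\<Omega> \<beta>)"
    if "\<And>b. b \<in> set bs \<Longrightarrow> one_form b" for bs
    using that
  proof (induction bs)
    case Nil
    show ?case by (intro ext) (simp add: big_wedge_Nil_wedge smult_form_def)
  next
    case (Cons b bs)
    have a: "one_form a" using assms by blast
    have b: "one_form b" using Cons.prems by simp
    have "big_wedge (b # bs) \<and>\<^sub>\<Omega> a \<and>\<^sub>\<Omega> \<beta> = (\<lambda>_. (-1) ^ length bs) *\<^sub>\<Omega> (b \<and>\<^sub>\<Omega> a \<and>\<^sub>\<Omega> big_wedge bs \<and>\<^sub>\<Omega> \<beta>)"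
      using Cons by (simp add: big_wedge_Cons_wedge[OF b] wedge_smult_right)
    then show ?case
      unfolding big_wedge_Cons_wedge[OF b]
      by (intro ext) (simp add: smult_form_def wedge_one_forms_anticommute[OF b a])
  qed
  show ?thesis
    using assms
  proof (induction as)
    case (Cons b bs)
    have b: "one_form b" using Cons.prems by simp
    show ?case
    proof (cases "a = b")
      case True
      have "b \<and>\<^sub>\<Omega> big_wedge bs \<and>\<^sub>\<Omega> b \<and>\<^sub>\<Omega> \<beta>
          = (\<lambda>_. (-1) ^ length bs) *\<^sub>\<Omega> (b \<and>\<^sub>\<Omega> b \<and>\<^sub>\<Omega> big_wedge bs \<and>\<^sub>\<Omega> \<beta>)"
        using commute[of bs] Cons.prems True by (simp add: wedge_smult_right)
      then show ?thesis
        by (simp only: big_wedge_Cons_wedge[OF b] True wedge_one_form_self[OF b] smult_form_zero)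
    next
      case False
      then have "big_wedge bs \<and>\<^sub>\<Omega> a \<and>\<^sub>\<Omega> \<beta> = 0" using Cons.prems by (intro Cons.IH) auto
      then show ?thesis by (simp only: big_wedge_Cons_wedge[OF b] wedge_zero_right)
    qed
  qed simp
qed

lemma one_form_d_comp:
  fixes f :: "nat \<Rightarrow> 'n::{finite,linorder} scalar_fn"
  shows "one_form (d_comp f k)"
  unfolding one_form_def
proof (intro allI impI ext)
  fix I :: "'n set" and u assume I: "card I \<noteq> 1"
  have "I - {i} \<noteq> {}" if "i \<in> I" for i
  proof
    assume "I - {i} = {}"
    then have "I = {i}" using that by auto
    then show False using I by simp
  qed
  then show "d_comp f k I u = 0 u"
    by (auto simp: ext_d_def fun_form_def partial_def zero_fun_def intro!: sum.neutral)
qed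

lemma d_comp_singleton: "d_comp f k {i} = partial i (f k)"
  by (intro ext) (simp add: ext_d_def fun_form_def)

section \<open>Weighted homogeneous forms\<close>

locale form_weights = weights v for v :: "'n::{finite,linorder} \<Rightarrow> nat"
begin

definition wt :: "'n set \<Rightarrow> int" where
  "wt I = int (\<Sum>i\<in>I. v i)"

text \<open>Since \<open>du_I\<close> has weight \<open>wt I\<close>, the coefficient carries the
  rest. The conditions concern functions on the whole space and not germs.\<close>

definition hform :: "nat \<Rightarrow> int \<Rightarrow> 'n form \<Rightarrow> bool" where
  "hform q w \<omega> \<longleftrightarrow> (\<forall>I. wpoly (w - wt I) (\<omega> I)) \<and> (\<forall>I. card I \<noteq> q \<longrightarrow> \<omega> I = 0)"

definition form_part :: "int \<Rightarrow> 'n form \<Rightarrow> 'n form" where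
  "form_part w \<omega> = (\<lambda>I. wpart (w - wt I) (\<omega> I))"

lemma wt_nonneg: "wt I \<ge> 0"
  by (simp add: wt_def sum_nonneg)

lemma wt_pos: "I \<noteq> {} \<Longrightarrow> wt I > 0"
  using weight_pos sum_pos[of I v] by (simp add: wt_def del: of_nat_sum)

lemma wt_empty [simp]: "wt {} = 0"
  by (simp add: wt_def)

lemma wt_insert: "i \<notin> I \<Longrightarrow> wt (insert i I) = int (v i) + wt I"
  by (simp add: wt_def)

lemma wt_remove: "i \<in> I \<Longrightarrow> wt (I - {i}) = wt I - int (v i)"
  using wt_insert[of i "I - {i}"] by (simp add: insert_absorb)

lemma wt_Diff: "J \<subseteq> I \<Longrightarrow> wt (I - J) = wt I - wt J"
  by (simp add: wt_def sum_diff_nat of_nat_diff sum_mono2 del: of_nat_sum)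

lemma hform_wpoly: "hform q w \<omega> \<Longrightarrow> wpoly (w - wt I) (\<omega> I)"
  by (simp add: hform_def)

lemma hform_holo_on: "hform q w \<omega> \<Longrightarrow> holo_on S (\<omega> I)"
  using wpoly_holo_on hform_wpoly by blast

lemma hform_Omega: "hform q w \<omega> \<Longrightarrow> \<omega> \<in> Omega q"
  by (auto simp: hform_def Omega_def intro: wpoly_holo_near)

lemma hform_zero: "hform q w 0"
  using wpoly.zero by (auto simp: hform_def zero_fun_def)

lemma hform_add: "hform q w \<alpha> \<Longrightarrow> hform q w \<beta> \<Longrightarrow> hform q w (\<alpha> + \<beta>)"
  by (auto simp: hform_def plus_fun_def intro: wpoly.add)

lemma hform_smult: "wpoly a g \<Longrightarrow> hform q w \<alpha> \<Longrightarrow> hform q (a + w) (g *\<^sub>\<Omega> \<alpha>)"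
  unfolding hform_def smult_form_def
  using wpoly_mult[of a g] by (auto simp: add_diff_eq[symmetric] zero_fun_def)

lemma hform_cmult: "hform q w \<alpha> \<Longrightarrow> hform q w ((\<lambda>_. c) *\<^sub>\<Omega> \<alpha>)"
  using hform_smult[OF wpoly.const, of q w \<alpha> c] by simp

lemma hform_wedge:
  assumes "hform q a \<alpha>" "hform r b \<beta>"
  shows "hform (q + r) (a + b) (\<alpha> \<and>\<^sub>\<Omega> \<beta>)"
  unfolding hform_def
proof (intro conjI allI impI)
  fix I
  have "wpoly (a + b - wt I) (\<lambda>u. shuffle_sign J (I - J) * (\<alpha> J u * \<beta> (I - J) u))" if "J \<in> Pow I" for J
  proof -
    have eq: "a + b - wt I = a - wt J + (b - wt (I - J))" using that by (simp add: wt_Diff)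
    show ?thesis unfolding eq by (intro wpoly_cmult wpoly_mult hform_wpoly[OF assms(1)] hform_wpoly[OF assms(2)])
  qed
  then have "wpoly (a + b - wt I) (\<lambda>u. \<Sum>J\<in>Pow I. shuffle_sign J (I - J) * (\<alpha> J u * \<beta> (I - J) u))"
    by (rule wpoly_sum)
  then show "wpoly (a + b - wt I) ((\<alpha> \<and>\<^sub>\<Omega> \<beta>) I)" by (simp add: wedge_def mult.assoc)
next
  fix I :: "'n set" assume I: "card I \<noteq> q + r"
  have "\<alpha> J = 0 \<or> \<beta> (I - J) = 0" if "J \<subseteq> I" for J
  proof -
    have "card J + card (I - J) = card I" using that by (simp add: card_Diff_subset card_mono)
    then have "card J \<noteq> q \<or> card (I - J) \<noteq> r" using I by auto
    then show ?thesis using assms by (auto simp: hform_def)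
  qed
  then have "shuffle_sign J (I - J) * \<alpha> J u * \<beta> (I - J) u = 0" if "J \<in> Pow I" for J u
    using that by (metis PowD mult_zero_left mult_zero_right zero_fun_apply)
  then show "(\<alpha> \<and>\<^sub>\<Omega> \<beta>) I = 0"
    by (intro ext) (simp only: wedge_def sum.neutral_const zero_fun_apply cong: sum.cong)
qed

text \<open>The weight is preserved: differentiation loses \<open>v i\<close>, and the new factor
  \<open>du_i\<close> restores it.\<close>

lemma hform_ext_d:
  assumes "hform q w \<omega>"
  shows "hform (Suc q) w (ext_d \<omega>)"
  unfolding hform_def
proof (intro conjI allI impI)
  fix I
  have "wpoly (w - wt I) (\<lambda>u. shuffle_sign {i} (I - {i}) * partial i (\<omega> (I - {i})) u)" if "i \<in> I" for i
  proof -
    have eq: "w - wt I = w - wt (I - {i}) - int (v i)" using that by (simp add: wt_remove)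
    show ?thesis unfolding eq by (intro wpoly_cmult wpoly_partial hform_wpoly[OF assms])
  qed
  from wpoly_sum[OF this] show "wpoly (w - wt I) (ext_d \<omega> I)" by (simp add: ext_d_def)
next
  fix I :: "'n set" assume I: "card I \<noteq> Suc q"
  have "\<omega> (I - {i}) = (\<lambda>_. 0)" if "i \<in> I" for i
  proof -
    have "card (I - {i}) \<noteq> q" using I that card_Suc_Diff1[of I i] by auto
    then show ?thesis using assms by (simp add: hform_def zero_fun_def)
  qed
  then show "ext_d \<omega> I = 0"
    by (intro ext) (auto simp: ext_d_def partial_const zero_fun_def intro!: sum.neutral)
qed

lemma hform_contract_wpoly:
  assumes "hform q w \<omega>"
  shows "wpoly (w - wt I) (contract_euler v \<omega> I)"
proof -
  have "wpoly (w - wt I) (\<lambda>u. shuffle_sign {i} I * of_nat (v i) * (u $ i * \<omega> (insert i I) u))" if "i \<in> - I" for i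
  proof (intro wpoly_cmult wpoly_coord')
    show "wpoly (w - wt I - int (v i)) (\<omega> (insert i I))"
      using hform_wpoly[OF assms, of "insert i I"] that by (simp add: wt_insert algebra_simps)
  qed
  then have "wpoly (w - wt I) (\<lambda>u. \<Sum>i\<in>- I. shuffle_sign {i} I * of_nat (v i) * (u $ i * \<omega> (insert i I) u))"
    by (rule wpoly_sum)
  then show ?thesis by (simp add: contract_euler_def mult.assoc)
qed

lemma hform_contract:
  assumes "hform (Suc q) w \<omega>"
  shows "hform q w (contract_euler v \<omega>)"
  unfolding hform_def
proof (intro conjI allI impI)
  fix I :: "'n set" assume I: "card I \<noteq> q"
  have "\<omega> (insert i I) = 0" if "i \<in> - I" for i
    using assms that I by (simp add: hform_def)
  then show "contract_euler v \<omega> I = 0"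
    by (intro ext) (auto simp: contract_euler_def zero_fun_def intro!: sum.neutral)
qed (rule hform_contract_wpoly[OF assms])

lemma hform_0_contract:
  assumes "hform 0 w \<omega>"
  shows "contract_euler v \<omega> = 0"
proof (intro ext)
  fix I u
  have "\<omega> (insert i I) = 0" for i using assms by (simp add: hform_def card_gt_0_iff)
  then show "contract_euler v \<omega> I u = 0 I u" by (simp add: contract_euler_def)
qed

lemma hform_large_degree:
  assumes "hform q w \<omega>" "q > CARD('n)"
  shows "\<omega> = 0"
proof
  fix I :: "'n set"
  have "card I \<le> CARD('n)" by (rule card_mono) auto
  then show "\<omega> I = 0 I" using assms by (simp add: hform_def)
qed

text \<open>A nonzero coefficient at \<open>I\<close> forces \<open>wt I \<le> w\<close>, and
  \<open>wt I\<close> is positive unless \<open>I\<close> is empty. So a nonzero form of weight zero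
  has degree zero.\<close>

lemma hform_nonpos:
  assumes "hform q w \<omega>" "w \<le> 0" "q > 0 \<or> w < 0"
  shows "\<omega> = 0"
proof (intro ext)
  fix I u
  show "\<omega> I u = 0 I u"
  proof (cases "card I = q")
    case True
    then have "w - wt I < 0" using assms wt_pos[of I] wt_nonneg[of I] by (cases "I = {}") auto
    then show ?thesis using wpoly_neg[OF hform_wpoly[OF assms(1)]] by simp
  next
    case False
    then show ?thesis using assms(1) by (simp add: hform_def)
  qed
qed

lemma hform_0_0:
  assumes "hform 0 0 \<omega>"
  shows "\<omega> = fun_form (\<lambda>_. \<omega> {} 0)"
proof (intro ext)
  fix I u
  show "\<omega> I u = fun_form (\<lambda>_. \<omega> {} 0) I u"
    using assms wpoly_0[OF hform_wpoly[OF assms, of "{}"], of u] by (auto simp: hform_def fun_form_def)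
qed

lemma hform_fun_form: "wpoly w g \<Longrightarrow> hform 0 w (fun_form g)"
  using wpoly.zero by (auto simp: hform_def fun_form_def zero_fun_def)

lemma hform_form_part: "\<omega> \<in> Omega q \<Longrightarrow> hform q w (form_part w \<omega>)"
  using wpoly_wpart by (auto simp: hform_def form_part_def Omega_def zero_fun_def wpart_const)

section \<open>Cartan's formula for the Euler field\<close>

lemma partial_int_mult:
  assumes "\<And>J. holo_on UNIV (\<omega> J)"
  shows "partial i (int_mult j \<omega> J) u = int_mult j (\<lambda>J. partial i (\<omega> J)) J u"
  using partial_cmult[OF assms] by (auto simp: int_mult_def partial_const)

lemma holo_on_int_mult:
  assumes "\<And>J. holo_on UNIV (\<omega> J)"
  shows "holo_on UNIV (int_mult j \<omega> J)"
  unfolding int_mult_def by (cases "j \<in> J") (simp_all add: holo_on_const holo_on_mult assms)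

text \<open>The right side is the Lie derivative along the Euler field: the coefficient is
  differentiated and each \<open>du_i\<close> contributes \<open>v i\<close>. Mixed terms cancel
  since \<open>int_mult j\<close> and \<open>ext_mult i\<close> anticommute for
  \<open>i \<noteq> j\<close>.\<close>

lemma cartan_euler:
  assumes "\<And>J. holo_on UNIV (\<omega> J)"
  shows "ext_d (contract_euler v \<omega>) I u + contract_euler v (ext_d \<omega>) I u
    = euler v (\<omega> I) u + of_int (wt I) * \<omega> I u"
proof -
  let ?D = "\<lambda>i J. partial i (\<omega> J)"
  have *: "partial i (contract_euler v \<omega> J) u
      = (\<Sum>j\<in>UNIV. of_nat (v j) * (u $ j * int_mult j (?D i) J u + (if i = j then int_mult i \<omega> J u else 0)))" for i J
  proof -
    have h: "holo_on UNIV (\<lambda>u. of_nat (v j) * (u $ j * int_mult j \<omega> J u))" for j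
      by (intro holo_on_mult holo_on_const holo_on_coord holo_on_int_mult assms)
    have "partial i (\<lambda>u. of_nat (v j) * (u $ j * int_mult j \<omega> J u)) u
       = of_nat (v j) * (u $ j * int_mult j (?D i) J u + (if i = j then int_mult i \<omega> J u else 0))" for j
      using partial_cmult[OF holo_on_mult[OF holo_on_coord holo_on_int_mult[OF assms]], of u i "of_nat (v j)" j j "\<lambda>J. J"]
        partial_mult[OF holo_on_coord holo_on_int_mult[OF assms], of u i j j "\<lambda>J. J"]
      by (simp add: partial_int_mult[OF assms] partial_coord)
    then show ?thesis
      unfolding contract_euler_eq mult.assoc
      by (subst partial_sum[where S = UNIV and g = "\<lambda>j u. of_nat (v j) * (u $ j * int_mult j \<omega> J u)"])
        (simp_all add: h)
  qed
  have "ext_d (contract_euler v \<omega>) I u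
      = (\<Sum>i\<in>UNIV. ext_mult i (\<lambda>J u. \<Sum>j\<in>UNIV. of_nat (v j) * (u $ j * int_mult j (?D i) J u + (if i = j then int_mult i \<omega> J u else 0))) I u)"
    unfolding ext_d_eq ext_mult_def * ..
  also have "\<dots> = (\<Sum>i\<in>UNIV. \<Sum>j\<in>UNIV. of_nat (v j) * u $ j * ext_mult i (int_mult j (?D i)) I u
      + (if i = j then of_nat (v i) * ext_mult i (int_mult i \<omega>) I u else 0))"
    by (intro sum.cong refl) (auto simp: ext_mult_def sum_distrib_left distrib_left mult_ac intro!: sum.cong)
  also have "\<dots> = (\<Sum>i\<in>UNIV. \<Sum>j\<in>UNIV. of_nat (v j) * u $ j * ext_mult i (int_mult j (?D i)) I u)
      + (\<Sum>i\<in>UNIV. of_nat (v i) * ext_mult i (int_mult i \<omega>) I u)"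
    by (simp add: sum.distrib)
  \<comment> \<open>These terms come from differentiating the coefficients
    \<open>v j * u $ j\<close> of the Euler field.\<close>
  also have "(\<Sum>i\<in>UNIV. of_nat (v i) * ext_mult i (int_mult i \<omega>) I u) = of_int (wt I) * \<omega> I u"
  proof -
    have "(\<Sum>i\<in>UNIV. of_nat (v i) * ext_mult i (int_mult i \<omega>) I u) = (\<Sum>i\<in>I. of_nat (v i) * \<omega> I u)"
      by (rule sum.mono_neutral_cong_right) (auto simp: ext_int_mult_self)
    then show ?thesis by (simp add: wt_def sum_distrib_right)
  qed
  finally have 1: "ext_d (contract_euler v \<omega>) I u =
     (\<Sum>i\<in>UNIV. \<Sum>j\<in>UNIV. of_nat (v j) * u $ j * ext_mult i (int_mult j (?D i)) I u) + of_int (wt I) * \<omega> I u" .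
  have "contract_euler v (ext_d \<omega>) I u
      = (\<Sum>j\<in>UNIV. of_nat (v j) * u $ j * int_mult j (\<lambda>I u. \<Sum>i\<in>UNIV. 1 * ext_mult i (?D i) I u) I u)"
    by (simp add: contract_euler_eq ext_d_eq)
  also have "\<dots> = (\<Sum>j\<in>UNIV. \<Sum>i\<in>UNIV. of_nat (v j) * u $ j * int_mult j (ext_mult i (?D i)) I u)"
    unfolding int_mult_sum by (simp add: sum_distrib_left)
  also have "\<dots> = (\<Sum>i\<in>UNIV. \<Sum>j\<in>UNIV. of_nat (v j) * u $ j * int_mult j (ext_mult i (?D i)) I u)"
    by (rule sum.swap)
  finally have 2: "contract_euler v (ext_d \<omega>) I u
    = (\<Sum>i\<in>UNIV. \<Sum>j\<in>UNIV. of_nat (v j) * u $ j * int_mult j (ext_mult i (?D i)) I u)" .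
  have 3: "int_mult j (ext_mult i (?D i)) I u + ext_mult i (int_mult j (?D i)) I u
      = (if i = j then ?D i I u else 0)" for i j
    using int_ext_mult_self[of i "?D i" I u] int_ext_mult[of j i "?D i" I u] by auto
  have "(\<Sum>i\<in>UNIV. \<Sum>j\<in>UNIV. of_nat (v j) * u $ j * ext_mult i (int_mult j (?D i)) I u)
      + (\<Sum>i\<in>UNIV. \<Sum>j\<in>UNIV. of_nat (v j) * u $ j * int_mult j (ext_mult i (?D i)) I u)
    = (\<Sum>i\<in>UNIV. \<Sum>j\<in>UNIV. of_nat (v j) * u $ j *
        (int_mult j (ext_mult i (?D i)) I u + ext_mult i (int_mult j (?D i)) I u))"
    by (simp add: sum.distrib distrib_left add.commute)
  also have "\<dots> = (\<Sum>i\<in>UNIV. \<Sum>j\<in>UNIV. if i = j then of_nat (v j) * u $ j * ?D i I u else 0)"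
    unfolding 3 by (intro sum.cong refl) auto
  also have "\<dots> = euler v (\<omega> I) u" by (simp add: euler_def)
  finally show ?thesis unfolding 1 2 by simp
qed

lemma hform_cartan:
  assumes "hform q w \<omega>"
  shows "ext_d (contract_euler v \<omega>) I u + contract_euler v (ext_d \<omega>) I u = of_int w * \<omega> I u"
  using cartan_euler[OF hform_holo_on[OF assms]] wpoly_euler[OF hform_wpoly[OF assms], of I u]
  by (simp add: algebra_simps)

section \<open>Contraction of products of differentials\<close>

lemma hform_d_comp: "wpoly w (f k) \<Longrightarrow> hform 1 w (d_comp f k)"
  using hform_ext_d[OF hform_fun_form] by simp

lemma hform_big_wedge:
  assumes "\<And>k. k \<in> set ks \<Longrightarrow> wpoly (p k) (f k)"
  shows "hform (length ks) (\<Sum>k\<leftarrow>ks. p k) (big_wedge (map (d_comp f) ks))"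
  using assms
proof (induction ks)
  case Nil
  have "hform 0 0 (fun_form (\<lambda>_. 1))" by (rule hform_fun_form[OF wpoly.const])
  then show ?case by (simp add: big_wedge_def one_fun_def)
next
  case (Cons k ks)
  then have "hform (1 + length ks) (p k + (\<Sum>k\<leftarrow>ks. p k)) (d_comp f k \<and>\<^sub>\<Omega> big_wedge (map (d_comp f) ks))"
    by (intro hform_wedge hform_d_comp Cons.IH) auto
  then show ?case by (simp add: big_wedge_def)
qed

text \<open>By Euler's relation, \<open>df_k\<close> pairs with the Euler field to \<open>w\<close>
  times \<open>f k\<close>.\<close>

lemma contract_euler_d_comp_wedge:
  assumes "wpoly w (f k)"
  shows "contract_euler v (d_comp f k \<and>\<^sub>\<Omega> \<beta>) I u
    = f k u * (of_int w * \<beta> I u) - (d_comp f k \<and>\<^sub>\<Omega> contract_euler v \<beta>) I u"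
  using contract_euler_wedge_one_form[OF one_form_d_comp, of v f k \<beta> I u] wpoly_euler[OF assms, of u]
  by (simp add: d_comp_singleton euler_def mult_ac)

text \<open>Moving the contraction past \<open>df_k\<close> costs a sign and a term divisible by
  \<open>f k\<close>, so modulo the \<open>f k\<close> it reaches \<open>\<beta>\<close>. The
  weights of the error terms are recorded because the later descent on weights depends on
  them.\<close>

lemma contract_big_wedge:
  assumes "\<And>k. k \<in> set ks \<Longrightarrow> wpoly (p k) (f k)" "distinct ks" "hform (Suc q) b \<beta>"
  shows "\<exists>\<gamma>. (\<forall>k\<in>set ks. hform (length ks + q) (b + (\<Sum>k\<leftarrow>ks. p k) - p k) (\<gamma> k)) \<and>
    (\<forall>I u. contract_euler v (big_wedge (map (d_comp f) ks) \<and>\<^sub>\<Omega> \<beta>) I u =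
       (-1) ^ length ks * (big_wedge (map (d_comp f) ks) \<and>\<^sub>\<Omega> contract_euler v \<beta>) I u
       + (\<Sum>k\<in>set ks. f k u * \<gamma> k I u))"
  using assms(1,2)
proof (induction ks)
  case Nil
  then show ?case by (simp add: big_wedge_Nil_wedge)
next
  case (Cons a ks)
  let ?W = "big_wedge (map (d_comp f) ks)"
  have a: "wpoly (p a) (f a)" using Cons.prems by simp
  obtain \<gamma> where \<gamma>: "\<And>k. k \<in> set ks \<Longrightarrow> hform (length ks + q) (b + (\<Sum>k\<leftarrow>ks. p k) - p k) (\<gamma> k)"
    and eq: "\<And>I u. contract_euler v (?W \<and>\<^sub>\<Omega> \<beta>) I u =
       (-1) ^ length ks * (?W \<and>\<^sub>\<Omega> contract_euler v \<beta>) I u + (\<Sum>k\<in>set ks. f k u * \<gamma> k I u)"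
    using Cons by auto
  \<comment> \<open>The new factor \<open>df_a\<close> contributes its own term
    \<open>p a * f a\<close> times the remaining product; the earlier error terms are multiplied by
    \<open>- df_a\<close>. Since \<open>a\<close> is not in \<open>ks\<close>, the two cases do not
    collide.\<close>
  define \<gamma>' where "\<gamma>' k = (if k = a then (\<lambda>_. of_int (p a)) *\<^sub>\<Omega> (?W \<and>\<^sub>\<Omega> \<beta>)
      else (\<lambda>_. - 1) *\<^sub>\<Omega> (d_comp f a \<and>\<^sub>\<Omega> \<gamma> k))" for k
  have "hform (length (a # ks) + q) (b + (\<Sum>k\<leftarrow>a # ks. p k) - p k) (\<gamma>' k)" if "k \<in> set (a # ks)" for k
  proof (cases "k = a")
    case True
    have "hform (length ks + Suc q) ((\<Sum>k\<leftarrow>ks. p k) + b) (?W \<and>\<^sub>\<Omega> \<beta>)"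
      using Cons.prems by (intro hform_wedge hform_big_wedge assms(3)) auto
    then show ?thesis using hform_cmult[of _ _ "?W \<and>\<^sub>\<Omega> \<beta>"] by (simp add: True \<gamma>'_def algebra_simps)
  next
    case False
    then have "hform (1 + (length ks + q)) (p a + (b + (\<Sum>k\<leftarrow>ks. p k) - p k)) (d_comp f a \<and>\<^sub>\<Omega> \<gamma> k)"
      using that by (intro hform_wedge hform_d_comp a \<gamma>) auto
    then show ?thesis using hform_cmult[of _ _ "d_comp f a \<and>\<^sub>\<Omega> \<gamma> k"] False by (simp add: \<gamma>'_def algebra_simps)
  qed
  moreover have "contract_euler v (big_wedge (map (d_comp f) (a # ks)) \<and>\<^sub>\<Omega> \<beta>) I u =
       (-1) ^ length (a # ks) * (big_wedge (map (d_comp f) (a # ks)) \<and>\<^sub>\<Omega> contract_euler v \<beta>) I u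
       + (\<Sum>k\<in>set (a # ks). f k u * \<gamma>' k I u)" for I u
  proof -
    have "contract_euler v (?W \<and>\<^sub>\<Omega> \<beta>) = (\<lambda>_. (-1) ^ length ks) *\<^sub>\<Omega> (?W \<and>\<^sub>\<Omega> contract_euler v \<beta>)
        + (\<Sum>k\<in>set ks. f k *\<^sub>\<Omega> \<gamma> k)"
      by (intro ext) (simp add: eq smult_form_def sum_form_apply)
    then have "d_comp f a \<and>\<^sub>\<Omega> contract_euler v (?W \<and>\<^sub>\<Omega> \<beta>)
       = (\<lambda>_. (-1) ^ length ks) *\<^sub>\<Omega> (d_comp f a \<and>\<^sub>\<Omega> ?W \<and>\<^sub>\<Omega> contract_euler v \<beta>)
        + (\<Sum>k\<in>set ks. f k *\<^sub>\<Omega> (d_comp f a \<and>\<^sub>\<Omega> \<gamma> k))"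
      by (simp only: wedge_add_right wedge_smult_right wedge_sum_right)
    then have 1: "(d_comp f a \<and>\<^sub>\<Omega> contract_euler v (?W \<and>\<^sub>\<Omega> \<beta>)) I u
       = (-1) ^ length ks * (d_comp f a \<and>\<^sub>\<Omega> ?W \<and>\<^sub>\<Omega> contract_euler v \<beta>) I u
        + (\<Sum>k\<in>set ks. f k u * (d_comp f a \<and>\<^sub>\<Omega> \<gamma> k) I u)"
      by (simp only: plus_fun_apply smult_form_def sum_form_apply)
    have 2: "(\<Sum>k\<in>set ks. f k u * \<gamma>' k I u) = - (\<Sum>k\<in>set ks. f k u * (d_comp f a \<and>\<^sub>\<Omega> \<gamma> k) I u)"
      using Cons.prems(2) by (auto simp: \<gamma>'_def smult_form_def sum_negf[symmetric] intro!: sum.cong)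
    have 3: "\<gamma>' a I u = of_int (p a) * (?W \<and>\<^sub>\<Omega> \<beta>) I u" by (simp add: \<gamma>'_def smult_form_def)
    have 4: "(\<Sum>k\<in>set (a # ks). f k u * \<gamma>' k I u) = f a u * \<gamma>' a I u + (\<Sum>k\<in>set ks. f k u * \<gamma>' k I u)"
      using Cons.prems(2) by simp
    have 5: "contract_euler v (d_comp f a \<and>\<^sub>\<Omega> ?W \<and>\<^sub>\<Omega> \<beta>) I u
       = f a u * (of_int (p a) * (?W \<and>\<^sub>\<Omega> \<beta>) I u) - (d_comp f a \<and>\<^sub>\<Omega> contract_euler v (?W \<and>\<^sub>\<Omega> \<beta>)) I u"
      by (rule contract_euler_d_comp_wedge[where f = f and k = a and w = "p a", OF a])
    show ?thesis
      unfolding list.map big_wedge_Cons_wedge[OF one_form_d_comp] 4 5 1 2 3 by simp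
  qed
  ultimately show ?case by (intro exI[of _ \<gamma>'] conjI ballI allI)
qed

end

section \<open>Polynomial algebras and germs of forms\<close>

lemma poly_algebra_add:
  assumes "g \<in> poly_algebra V f" "h \<in> poly_algebra V f"
  shows "(\<lambda>u. g u + h u) \<in> poly_algebra V f"
proof -
  obtain S c T d where S: "finite S" "g = (\<lambda>u. \<Sum>m\<in>S. c m * (\<Prod>i\<in>V. f i u ^ m i))"
    and T: "finite T" "h = (\<lambda>u. \<Sum>m\<in>T. d m * (\<Prod>i\<in>V. f i u ^ m i))"
    using assms unfolding poly_algebra_def by blast
  define e where "e m = (if m \<in> S then c m else 0) + (if m \<in> T then d m else 0)" for m
  have "g u + h u = (\<Sum>m\<in>S \<union> T. e m * (\<Prod>i\<in>V. f i u ^ m i))" for u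
  proof -
    have "g u = (\<Sum>m\<in>S \<union> T. (if m \<in> S then c m else 0) * (\<Prod>i\<in>V. f i u ^ m i))"
      unfolding S(2) using S(1) T(1) by (intro sum.mono_neutral_cong_left) auto
    moreover have "h u = (\<Sum>m\<in>S \<union> T. (if m \<in> T then d m else 0) * (\<Prod>i\<in>V. f i u ^ m i))"
      unfolding T(2) using S(1) T(1) by (intro sum.mono_neutral_cong_left) auto
    ultimately show ?thesis by (simp add: e_def distrib_right sum.distrib)
  qed
  then show ?thesis using S(1) T(1) unfolding poly_algebra_def by blast
qed

lemma poly_algebra_const: "(\<lambda>_. c) \<in> poly_algebra V f"
  unfolding poly_algebra_def
  by (intro CollectI exI[of _ "{\<lambda>_. 0}"] exI[of _ "\<lambda>_. c"]) simp

text \<open>Raising the exponent of \<open>k\<close> by one is injective on multi-indices, so the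
  coefficients are carried along by its inverse.\<close>

lemma poly_algebra_generator_mult:
  assumes "finite V" "k \<in> V" "g \<in> poly_algebra V f"
  shows "(\<lambda>u. f k u * g u) \<in> poly_algebra V f"
proof -
  obtain S c where S: "finite S" "g = (\<lambda>u. \<Sum>m\<in>S. c m * (\<Prod>i\<in>V. f i u ^ m i))"
    using assms(3) unfolding poly_algebra_def by blast
  let ?s = "\<lambda>m. m(k := Suc (m k))"
  have inj: "inj_on ?s S"
  proof (rule inj_onI)
    fix m m' assume eq: "?s m = ?s m'"
    show "m = m'"
    proof
      fix i show "m i = m' i" using fun_cong[OF eq, of i] by (cases "i = k") auto
    qed
  qed
  have prod: "(\<Prod>i\<in>V. f i u ^ ?s m i) = f k u * (\<Prod>i\<in>V. f i u ^ m i)" for u m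
    using assms(1,2) by (simp add: prod.remove[of V k])
  have "(\<lambda>u. f k u * g u) = (\<lambda>u. \<Sum>m\<in>?s ` S. c (the_inv_into S ?s m) * (\<Prod>i\<in>V. f i u ^ m i))"
  proof
    fix u
    have "(\<Sum>m\<in>?s ` S. c (the_inv_into S ?s m) * (\<Prod>i\<in>V. f i u ^ m i))
        = (\<Sum>m\<in>S. c (the_inv_into S ?s (?s m)) * (\<Prod>i\<in>V. f i u ^ ?s m i))"
      using inj by (rule sum.reindex_cong) auto
    also have "\<dots> = (\<Sum>m\<in>S. f k u * (c m * (\<Prod>i\<in>V. f i u ^ m i)))"
      by (intro sum.cong refl) (simp only: the_inv_into_f_f[OF inj] prod mult.left_commute)
    finally show "f k u * g u = (\<Sum>m\<in>?s ` S. c (the_inv_into S ?s m) * (\<Prod>i\<in>V. f i u ^ m i))"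
      by (simp add: S(2) sum_distrib_left)
  qed
  moreover have "finite (?s ` S)" using S(1) by simp
  ultimately show ?thesis
    unfolding poly_algebra_def
    by (intro CollectI exI[of _ "?s ` S"] exI[of _ "\<lambda>m. c (the_inv_into S ?s m)"] conjI)
qed

lemma poly_algebra_sum:
  "(\<And>j. j \<in> A \<Longrightarrow> g j \<in> poly_algebra V f) \<Longrightarrow> (\<lambda>u. \<Sum>j\<in>A. g j u) \<in> poly_algebra V f"
  by (induction A rule: infinite_finite_induct) (auto intro: poly_algebra_const poly_algebra_add)

lemma holo_on_power: "holo_on S g \<Longrightarrow> holo_on S (\<lambda>u. g u ^ m)"
  by (induction m) (auto intro: holo_on_const holo_on_mult)

lemma holo_on_prod: "(\<And>j. j \<in> A \<Longrightarrow> holo_on S (g j)) \<Longrightarrow> holo_on S (\<lambda>x. \<Prod>j\<in>A. g j x)"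
  by (induction A rule: infinite_finite_induct) (auto intro: holo_on_const holo_on_mult)

lemma holo_on_poly_algebra: "g \<in> poly_algebra V (\<lambda>i u. u $ i) \<Longrightarrow> holo_on S g"
  unfolding poly_algebra_def
  by (auto intro!: holo_on_sum holo_on_mult holo_on_const holo_on_prod holo_on_power holo_on_coord)

section \<open>Germs of forms and their weight parts\<close>

lemma germ_eq_sum: "(\<And>j. j \<in> A \<Longrightarrow> \<alpha> j =\<^sub>0 \<beta> j) \<Longrightarrow> (\<Sum>j\<in>A. \<alpha> j) =\<^sub>0 (\<Sum>j\<in>A. \<beta> j)"
proof (induction A rule: infinite_finite_induct)
  case (insert a A)
  then have "\<alpha> a =\<^sub>0 \<beta> a" "sum \<alpha> A =\<^sub>0 sum \<beta> A" by auto
  then have "(\<alpha> a + sum \<alpha> A) =\<^sub>0 (\<beta> a + sum \<beta> A)"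
    unfolding germ_eq_def plus_fun_apply
  proof (intro allI)
    fix I assume *: "\<forall>I. \<forall>\<^sub>F u in nhds 0. \<alpha> a I u = \<beta> a I u" "\<forall>I. \<forall>\<^sub>F u in nhds 0. sum \<alpha> A I u = sum \<beta> A I u"
    show "\<forall>\<^sub>F u in nhds 0. \<alpha> a I u + sum \<alpha> A I u = \<beta> a I u + sum \<beta> A I u"
      using *(1)[rule_format, of I] *(2)[rule_format, of I] by eventually_elim simp
  qed
  then show ?case by (simp only: sum.insert[OF insert.hyps])
qed (auto simp: germ_eq_def)

lemma germ_eq_smult: "\<alpha> =\<^sub>0 \<beta> \<Longrightarrow> (g *\<^sub>\<Omega> \<alpha>) =\<^sub>0 (g *\<^sub>\<Omega> \<beta>)"
  unfolding germ_eq_def smult_form_def by (auto elim!: eventually_mono)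

lemma germ_eq_wedge_left:
  assumes "\<alpha> =\<^sub>0 \<beta>"
  shows "(\<alpha> \<and>\<^sub>\<Omega> \<gamma>) =\<^sub>0 (\<beta> \<and>\<^sub>\<Omega> \<gamma>)"
  unfolding germ_eq_def
proof
  fix I
  have "\<forall>\<^sub>F u in nhds 0. \<forall>J\<in>UNIV. \<alpha> J u = \<beta> J u"
    using assms by (intro eventually_ball_finite) (auto simp: germ_eq_def)
  then show "\<forall>\<^sub>F u in nhds 0. (\<alpha> \<and>\<^sub>\<Omega> \<gamma>) I u = (\<beta> \<and>\<^sub>\<Omega> \<gamma>) I u"
    by eventually_elim (simp add: wedge_def)
qed

lemma OmegaD_holo: "\<omega> \<in> Omega q \<Longrightarrow> holo_near 0 (\<omega> I)"
  by (simp add: Omega_def)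

context form_weights
begin

text \<open>The passage from germs to functions: a weight part is built from iterated derivatives at
  the origin, so equal germs have literally equal parts.\<close>

lemma form_part_cong: "\<omega> =\<^sub>0 \<eta> \<Longrightarrow> form_part w \<omega> = form_part w \<eta>"
  unfolding germ_eq_def form_part_def by (intro ext wpart_cong) auto

lemma form_part_add:
  assumes "\<And>I. holo_near 0 (\<omega> I)" "\<And>I. holo_near 0 (\<eta> I)"
  shows "form_part w (\<omega> + \<eta>) = form_part w \<omega> + form_part w \<eta>"
  by (intro ext) (simp add: form_part_def plus_fun_def wpart_add[OF assms])

lemma holo_near_sum_form:
  fixes \<omega> :: "'j \<Rightarrow> 'n form"
  assumes "\<And>j. j \<in> A \<Longrightarrow> holo_near 0 (\<omega> j I)"
  shows "holo_near 0 ((\<Sum>j\<in>A. \<omega> j) I)"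
proof -
  have "(\<Sum>j\<in>A. \<omega> j) I = (\<lambda>u. \<Sum>j\<in>A. \<omega> j I u)" by (intro ext) (simp add: sum_form_apply)
  then show ?thesis using holo_near_sum[OF assms] by simp
qed

lemma form_part_sum:
  assumes "\<And>j I. j \<in> A \<Longrightarrow> holo_near 0 (\<omega> j I)"
  shows "form_part w (\<Sum>j\<in>A. \<omega> j) = (\<Sum>j\<in>A. form_part w (\<omega> j))"
proof (intro ext)
  fix I u
  have "(\<Sum>j\<in>A. \<omega> j) I = (\<lambda>u. \<Sum>j\<in>A. \<omega> j I u)" by (intro ext) (simp add: sum_form_apply)
  then have "form_part w (\<Sum>j\<in>A. \<omega> j) I u = wpart (w - wt I) (\<lambda>u. \<Sum>j\<in>A. \<omega> j I u) u"
    by (simp add: form_part_def)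
  also have "\<dots> = (\<Sum>j\<in>A. wpart (w - wt I) (\<omega> j I) u)"
    using assms by (rule wpart_sum)
  finally show "form_part w (\<Sum>j\<in>A. \<omega> j) I u = (\<Sum>j\<in>A. form_part w (\<omega> j)) I u"
    by (simp add: sum_form_apply form_part_def)
qed

lemma form_part_smult:
  assumes "wpoly a g" "\<And>I. holo_near 0 (\<omega> I)"
  shows "form_part w (g *\<^sub>\<Omega> \<omega>) = g *\<^sub>\<Omega> form_part (w - a) \<omega>"
proof (intro ext)
  fix I u
  have eq: "w - a - wt I = w - wt I - a" by simp
  show "form_part w (g *\<^sub>\<Omega> \<omega>) I u = (g *\<^sub>\<Omega> form_part (w - a) \<omega>) I u"
    unfolding form_part_def smult_form_def eq by (rule wpart_mult[OF assms])
qed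

lemma form_part_wedge:
  assumes "hform q a \<alpha>" "\<And>I. holo_near 0 (\<omega> I)"
  shows "form_part w (\<alpha> \<and>\<^sub>\<Omega> \<omega>) = \<alpha> \<and>\<^sub>\<Omega> form_part (w - a) \<omega>"
proof (intro ext)
  fix I u
  have t: "wpart (w - wt I) (\<lambda>u. shuffle_sign J (I - J) * \<alpha> J u * \<omega> (I - J) u) u
      = shuffle_sign J (I - J) * \<alpha> J u * wpart (w - a - wt (I - J)) (\<omega> (I - J)) u" if "J \<in> Pow I" for J
  proof -
    have p: "wpoly (a - wt J) (\<lambda>u. shuffle_sign J (I - J) * \<alpha> J u)"
      by (rule wpoly_cmult[OF hform_wpoly[OF assms(1)]])
    have eq: "w - a - wt (I - J) = w - wt I - (a - wt J)" using that by (simp add: wt_Diff)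
    show ?thesis unfolding eq by (rule wpart_mult[OF p assms(2)])
  qed
  have "form_part w (\<alpha> \<and>\<^sub>\<Omega> \<omega>) I u
      = (\<Sum>J\<in>Pow I. wpart (w - wt I) (\<lambda>u. shuffle_sign J (I - J) * \<alpha> J u * \<omega> (I - J) u) u)"
    unfolding form_part_def wedge_def
    by (intro wpart_sum holo_near_mult holo_near_const assms(2) wpoly_holo_near[OF hform_wpoly[OF assms(1)]])
  also have "\<dots> = (\<alpha> \<and>\<^sub>\<Omega> form_part (w - a) \<omega>) I u"
    unfolding wedge_def form_part_def by (intro sum.cong refl t)
  finally show "form_part w (\<alpha> \<and>\<^sub>\<Omega> \<omega>) I u = (\<alpha> \<and>\<^sub>\<Omega> form_part (w - a) \<omega>) I u" .
qed

lemma form_part_hform: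
  assumes "hform q a \<alpha>"
  shows "form_part w \<alpha> = (if w = a then \<alpha> else 0)"
  by (intro ext) (auto simp: form_part_def wpart_wpoly[OF hform_wpoly[OF assms]])

text \<open>Subtracting \<open>wt I\<close> from the weight of the form turns the condition into the
  Euler equation for the coefficient at \<open>I\<close>, whose solutions are polynomials.\<close>

lemma quasihomogeneous_imp_hform:
  assumes "\<omega> \<in> Omega q" "quasihomogeneous_form v \<omega>"
  shows "\<exists>w \<alpha>. hform q w \<alpha> \<and> \<omega> =\<^sub>0 \<alpha>"
proof -
  obtain w :: int where w: "\<And>I. \<forall>\<^sub>F u in nhds 0. euler v (\<omega> I) u + of_nat (\<Sum>i\<in>I. v i) * \<omega> I u = of_int w * \<omega> I u"
    using assms(2) unfolding quasihomogeneous_form_def germ_eq_def by blast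
  have "\<exists>g. wpoly (w - wt I) g \<and> (\<forall>\<^sub>F u in nhds 0. \<omega> I u = g u)" for I
  proof (rule euler_germ_imp_wpoly[OF OmegaD_holo[OF assms(1)]])
    show "\<forall>\<^sub>F u in nhds 0. euler v (\<omega> I) u = of_int (w - wt I) * \<omega> I u"
      using w[of I] by eventually_elim (simp add: wt_def algebra_simps del: of_nat_sum)
  qed
  then obtain g where g: "\<And>I. wpoly (w - wt I) (g I)" "\<And>I. \<forall>\<^sub>F u in nhds 0. \<omega> I u = g I u" by metis
  \<comment> \<open>Coefficients of the wrong degree are set to zero outright, because
    \<open>hform\<close> demands equality of functions there.\<close>
  define \<alpha> where "\<alpha> I = (if card I = q then g I else 0)" for I
  have "hform q w \<alpha>" using g(1) wpoly.zero by (auto simp: hform_def \<alpha>_def zero_fun_def)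
  moreover have "\<omega> =\<^sub>0 \<alpha>"
    unfolding germ_eq_def
  proof
    fix I show "\<forall>\<^sub>F u in nhds 0. \<omega> I u = \<alpha> I u"
      using g(2)[of I] assms(1) by (cases "card I = q") (auto simp: \<alpha>_def Omega_def)
  qed
  ultimately show ?thesis by blast
qed

end

section \<open>Graded maps and the product of all differentials\<close>

locale graded_map = form_weights v for v :: "'n::{finite,linorder} \<Rightarrow> nat" +
  fixes N K :: nat and p :: "nat \<Rightarrow> int" and f :: "nat \<Rightarrow> 'n scalar_fn"
  assumes dim: "CARD('n) = N + K"
    and f_wpoly: "k < K \<Longrightarrow> wpoly (p k) (f k)"
    and f_0: "k < K \<Longrightarrow> f k 0 = 0"
begin

definition total_weight :: int where
  "total_weight = (\<Sum>k<K. p k)"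

lemma sum_list_upt: "(\<Sum>k\<leftarrow>[0..<K]. p k) = total_weight"
  by (simp add: total_weight_def interv_sum_list_conv_sum_set_nat atLeast0LessThan)

lemma hform_df_all: "hform K total_weight (df_all K f)"
  using hform_big_wedge[of "[0..<K]" p f] f_wpoly unfolding df_all_def sum_list_upt by simp

text \<open>Positivity of \<open>p k\<close> is derived: a nonpositive weight leaves only constants,
  and \<open>f_0\<close> excludes the nonzero ones. A component that vanishes identically is the
  alternative.\<close>

lemma f_zero_or_pos:
  assumes "k < K"
  shows "f k = 0 \<or> p k > 0"
proof (cases "p k" "0 :: int" rule: linorder_cases)
  case less
  then show ?thesis using wpoly_neg[OF f_wpoly[OF assms]] by auto
next
  case equal
  then show ?thesis using wpoly_0[OF f_wpoly[OF assms]] f_0[OF assms] by auto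
qed simp

text \<open>The form \<open>df\<^sub>0 \<and> \<dots> \<and> df\<^bsub>K-1\<^esub> \<and> d\<omega>\<close> vanishes for reasons of degree; contracting it with
  the Euler field gives the claim.\<close>

lemma df_all_contract_ext_d:
  assumes "hform N w \<omega>"
  shows "\<exists>\<gamma>. (\<forall>k<K. hform (N + K) (w + total_weight - p k) (\<gamma> k)) \<and>
    df_all K f \<and>\<^sub>\<Omega> contract_euler v (ext_d \<omega>) = (\<Sum>k<K. f k *\<^sub>\<Omega> \<gamma> k)"
proof -
  have "\<exists>\<gamma>. (\<forall>k\<in>set [0..<K]. hform (length [0..<K] + N) (w + (\<Sum>k\<leftarrow>[0..<K]. p k) - p k) (\<gamma> k)) \<and>
    (\<forall>I u. contract_euler v (df_all K f \<and>\<^sub>\<Omega> ext_d \<omega>) I u =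
       (-1) ^ length [0..<K] * (df_all K f \<and>\<^sub>\<Omega> contract_euler v (ext_d \<omega>)) I u
       + (\<Sum>k\<in>set [0..<K]. f k u * \<gamma> k I u))"
    unfolding df_all_def using f_wpoly by (intro contract_big_wedge hform_ext_d assms) auto
  then obtain \<gamma> where \<gamma>: "\<And>k. k < K \<Longrightarrow> hform (N + K) (w + total_weight - p k) (\<gamma> k)"
    and eq: "\<And>I u. contract_euler v (df_all K f \<and>\<^sub>\<Omega> ext_d \<omega>) I u =
       (-1) ^ K * (df_all K f \<and>\<^sub>\<Omega> contract_euler v (ext_d \<omega>)) I u + (\<Sum>k<K. f k u * \<gamma> k I u)"
    unfolding sum_list_upt by (auto simp: add.commute atLeast0LessThan)
  have "df_all K f \<and>\<^sub>\<Omega> ext_d \<omega> = 0"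
    by (rule hform_large_degree[OF hform_wedge[OF hform_df_all hform_ext_d[OF assms]]]) (simp add: dim)
  then have "contract_euler v (df_all K f \<and>\<^sub>\<Omega> ext_d \<omega>) I u = 0" for I u
    by (simp add: contract_euler_def)
  then have "(-1) ^ K * (df_all K f \<and>\<^sub>\<Omega> contract_euler v (ext_d \<omega>)) I u = - (\<Sum>k<K. f k u * \<gamma> k I u)" for I u
    using eq[of I u] by (simp add: eq_neg_iff_add_eq_0)
  then have "(-1) ^ K * ((-1) ^ K * (df_all K f \<and>\<^sub>\<Omega> contract_euler v (ext_d \<omega>)) I u)
     = (-1) ^ K * - (\<Sum>k<K. f k u * \<gamma> k I u)" for I u by simp
  then have "(df_all K f \<and>\<^sub>\<Omega> contract_euler v (ext_d \<omega>)) I u = (-1) ^ K * - (\<Sum>k<K. f k u * \<gamma> k I u)" for I u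
    by (simp flip: mult.assoc power_mult_distrib)
  then have "df_all K f \<and>\<^sub>\<Omega> contract_euler v (ext_d \<omega>) = (\<Sum>k<K. f k *\<^sub>\<Omega> ((\<lambda>_. - ((-1) ^ K)) *\<^sub>\<Omega> \<gamma> k))"
    by (intro ext) (simp add: sum_form_apply smult_form_def sum_distrib_left sum_negf mult_ac)
  moreover have "hform (N + K) (w + total_weight - p k) ((\<lambda>_. - ((-1) ^ K)) *\<^sub>\<Omega> \<gamma> k)" if "k < K" for k
    by (rule hform_cmult[OF \<gamma>[OF that]])
  ultimately show ?thesis by (intro exI[of _ "\<lambda>k. (\<lambda>_. - ((-1) ^ K)) *\<^sub>\<Omega> \<gamma> k"]) simp
qed

lemma df_all_reduce:
  assumes "hform N w \<omega>" "w \<noteq> 0"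
  shows "\<exists>\<gamma>. (\<forall>k<K. hform (N + K) (w + total_weight - p k) (\<gamma> k)) \<and>
    df_all K f \<and>\<^sub>\<Omega> \<omega> = df_all K f \<and>\<^sub>\<Omega> ((\<lambda>_. 1 / of_int w) *\<^sub>\<Omega> ext_d (contract_euler v \<omega>))
      + (\<Sum>k<K. f k *\<^sub>\<Omega> \<gamma> k)"
proof -
  let ?c = "1 / of_int w :: complex"
  obtain \<gamma> where \<gamma>: "\<And>k. k < K \<Longrightarrow> hform (N + K) (w + total_weight - p k) (\<gamma> k)"
    and eq: "df_all K f \<and>\<^sub>\<Omega> contract_euler v (ext_d \<omega>) = (\<Sum>k<K. f k *\<^sub>\<Omega> \<gamma> k)"
    using df_all_contract_ext_d[OF assms(1)] by blast
  have "\<omega> = (\<lambda>_. ?c) *\<^sub>\<Omega> ext_d (contract_euler v \<omega>) + (\<lambda>_. ?c) *\<^sub>\<Omega> contract_euler v (ext_d \<omega>)"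
  proof (intro ext)
    fix I u
    have "\<omega> I u = ?c * (of_int w * \<omega> I u)" using assms(2) by simp
    also have "\<dots> = ?c * (ext_d (contract_euler v \<omega>) I u + contract_euler v (ext_d \<omega>) I u)"
      by (simp only: hform_cartan[OF assms(1)])
    finally show "\<omega> I u = ((\<lambda>_. ?c) *\<^sub>\<Omega> ext_d (contract_euler v \<omega>) + (\<lambda>_. ?c) *\<^sub>\<Omega> contract_euler v (ext_d \<omega>)) I u"
      by (simp add: smult_form_def distrib_left add_divide_distrib)
  qed
  then have "df_all K f \<and>\<^sub>\<Omega> \<omega> = df_all K f \<and>\<^sub>\<Omega> ((\<lambda>_. ?c) *\<^sub>\<Omega> ext_d (contract_euler v \<omega>))
      + (\<lambda>_. ?c) *\<^sub>\<Omega> (df_all K f \<and>\<^sub>\<Omega> contract_euler v (ext_d \<omega>))"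
    by (metis wedge_add_right wedge_smult_right)
  also have "(\<lambda>_. ?c) *\<^sub>\<Omega> (df_all K f \<and>\<^sub>\<Omega> contract_euler v (ext_d \<omega>)) = (\<Sum>k<K. f k *\<^sub>\<Omega> ((\<lambda>_. ?c) *\<^sub>\<Omega> \<gamma> k))"
    unfolding eq by (intro ext) (simp add: sum_form_apply smult_form_def sum_divide_distrib)
  finally show ?thesis
    by (intro exI[of _ "\<lambda>k. (\<lambda>_. ?c) *\<^sub>\<Omega> \<gamma> k"] conjI allI impI hform_cmult \<gamma>)
qed

end

section \<open>The decomposition\<close>

context graded_map
begin

definition entire_form :: "nat \<Rightarrow> 'n form \<Rightarrow> bool" where
  "entire_form q \<omega> \<longleftrightarrow> (\<forall>I. holo_on UNIV (\<omega> I)) \<and> (\<forall>I. card I \<noteq> q \<longrightarrow> \<omega> I = 0)"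

text \<open>Away from the origin the exterior derivative of a representative of a germ is not additive,
  so primitives are taken among entire forms.\<close>

definition primitives :: "'n form set" where
  "primitives = (if N \<ge> 1 then ext_d ` {\<eta>. entire_form (N - 1) \<eta>} else fun_form ` poly_algebra {..<K} f)"

lemma hform_entire: "hform q w \<omega> \<Longrightarrow> entire_form q \<omega>"
  using hform_holo_on unfolding entire_form_def hform_def by blast

lemma entire_form_Omega: "entire_form q \<omega> \<Longrightarrow> \<omega> \<in> Omega q"
  unfolding entire_form_def Omega_def using holo_on_UNIV_near by blast

text \<open>For \<open>N = 0\<close> and \<open>K \<le> 1\<close> the modulus is \<open>{0}\<close>,
  whereas \<open>primitives\<close> still contains the constants; hence the hypothesis.\<close>

lemma primitives_exact: "N \<ge> 1 \<or> K \<ge> 2 \<Longrightarrow> primitives \<subseteq> exact_forms N K f"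
  using entire_form_Omega by (auto simp: primitives_def exact_forms_def)

lemma ext_d_add:
  assumes "\<And>I. holo_on UNIV (\<alpha> I)" "\<And>I. holo_on UNIV (\<beta> I)"
  shows "ext_d (\<alpha> + \<beta>) = ext_d \<alpha> + ext_d \<beta>"
proof (intro ext)
  fix I u
  have "partial i ((\<alpha> + \<beta>) J) u = partial i (\<alpha> J) u + partial i (\<beta> J) u" for i J
    using partial_add[OF assms, of u] by (simp add: plus_fun_def)
  then show "ext_d (\<alpha> + \<beta>) I u = (ext_d \<alpha> + ext_d \<beta>) I u"
    by (simp add: ext_d_def distrib_left sum.distrib)
qed

lemma ext_d_smult:
  assumes "holo_on UNIV g" "\<And>I. holo_on UNIV (\<alpha> I)"
  shows "ext_d (g *\<^sub>\<Omega> \<alpha>) = ext_d (fun_form g) \<and>\<^sub>\<Omega> \<alpha> + g *\<^sub>\<Omega> ext_d \<alpha>"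
proof (intro ext)
  fix I u
  have 1: "partial i ((g *\<^sub>\<Omega> \<alpha>) J) u = g u * partial i (\<alpha> J) u + partial i g u * \<alpha> J u" for i J
    unfolding smult_form_def by (rule partial_mult[OF assms]) simp
  have "(\<Sum>i\<in>UNIV. ext_mult i (\<lambda>J. partial i ((g *\<^sub>\<Omega> \<alpha>) J)) I u)
     = (\<Sum>i\<in>UNIV. partial i g u * ext_mult i \<alpha> I u + g u * ext_mult i (\<lambda>J. partial i (\<alpha> J)) I u)"
    by (intro sum.cong refl) (simp add: ext_mult_def 1 algebra_simps)
  moreover have "(ext_d (fun_form g) \<and>\<^sub>\<Omega> \<alpha>) I u = (\<Sum>i\<in>UNIV. partial i g u * ext_mult i \<alpha> I u)"
    using one_form_d_comp[of "\<lambda>_. g" 0] d_comp_singleton[of "\<lambda>_. g" 0] by (simp add: wedge_one_form)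
  ultimately show "ext_d (g *\<^sub>\<Omega> \<alpha>) I u = (ext_d (fun_form g) \<and>\<^sub>\<Omega> \<alpha> + g *\<^sub>\<Omega> ext_d \<alpha>) I u"
    unfolding ext_d_eq[of "g *\<^sub>\<Omega> \<alpha>"] ext_d_eq[of \<alpha>]
    by (simp only: plus_fun_apply sum.distrib sum_distrib_left smult_form_def)
qed

lemma fun_form_add: "fun_form (\<lambda>u. g u + h u) = fun_form g + fun_form h"
  by (intro ext) (simp add: fun_form_def)

lemma primitives_zero: "0 \<in> primitives"
proof (cases "N \<ge> 1")
  case True
  have "entire_form (N - 1) 0"
    using holo_on_const[of UNIV 0] by (simp add: entire_form_def zero_fun_def)
  moreover have "ext_d 0 = 0" by (intro ext) (simp add: ext_d_def zero_fun_def partial_const)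
  ultimately show ?thesis using True unfolding primitives_def by (auto intro!: image_eqI[of 0 ext_d 0])
next
  case False
  have "fun_form (\<lambda>_. 0) = (0 :: 'n form)" by (intro ext) (simp add: fun_form_def)
  then show ?thesis using False poly_algebra_const[of 0 "{..<K}" f] unfolding primitives_def by force
qed

lemma primitives_add:
  assumes "\<alpha> \<in> primitives" "\<beta> \<in> primitives"
  shows "\<alpha> + \<beta> \<in> primitives"
proof (cases "N \<ge> 1")
  case True
  then obtain a b where a: "entire_form (N - 1) a" "\<alpha> = ext_d a" and b: "entire_form (N - 1) b" "\<beta> = ext_d b"
    using assms by (auto simp: primitives_def)
  have "entire_form (N - 1) (a + b)"
    using a(1) b(1) by (auto simp: entire_form_def plus_fun_def intro!: holo_on_add)
  moreover have "\<alpha> + \<beta> = ext_d (a + b)"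
    using ext_d_add[of a b] a b by (simp add: entire_form_def)
  ultimately show ?thesis using True by (auto simp: primitives_def)
next
  case False
  then obtain g h where "g \<in> poly_algebra {..<K} f" "\<alpha> = fun_form g" "h \<in> poly_algebra {..<K} f" "\<beta> = fun_form h"
    using assms by (auto simp: primitives_def)
  then show ?thesis
    using False poly_algebra_add[of g "{..<K}" f h] by (auto simp: primitives_def fun_form_add[symmetric])
qed

lemma primitives_sum: "(\<And>j. j \<in> A \<Longrightarrow> \<beta> j \<in> primitives) \<Longrightarrow> (\<Sum>j\<in>A. \<beta> j) \<in> primitives"
proof (induction A rule: infinite_finite_induct)
  case (insert a A)
  then have "\<beta> a + sum \<beta> A \<in> primitives" by (intro primitives_add) auto
  then show ?case by (simp only: sum.insert[OF insert.hyps])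
qed (simp_all only: sum.infinite sum.empty primitives_zero not_False_eq_True)

lemma df_all_wedge_d_comp:
  assumes "k < K"
  shows "df_all K f \<and>\<^sub>\<Omega> d_comp f k \<and>\<^sub>\<Omega> \<beta> = 0"
  unfolding df_all_def using assms one_form_d_comp by (intro big_wedge_wedge_mem) auto

text \<open>Makes the modulus stable under multiplication by \<open>f k\<close>: \<open>f k\<close>
  times \<open>d\<eta>\<close> differs from \<open>d(f k \<eta>)\<close> by
  \<open>df_k \<and> \<eta>\<close>, up to sign, and \<open>df_all\<close> annihilates this. For
  \<open>N = 0\<close> stability is that of the algebra.\<close>

lemma primitives_generator_mult:
  assumes "k < K" "\<beta> \<in> primitives"
  shows "\<exists>\<gamma>\<in>primitives. f k *\<^sub>\<Omega> (df_all K f \<and>\<^sub>\<Omega> \<beta>) = df_all K f \<and>\<^sub>\<Omega> \<gamma>"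
proof (cases "N \<ge> 1")
  case True
  then obtain a where a: "entire_form (N - 1) a" "\<beta> = ext_d a" using assms(2) by (auto simp: primitives_def)
  have h: "holo_on UNIV (f k)" by (rule wpoly_holo_on[OF f_wpoly[OF assms(1)]])
  have "entire_form (N - 1) (f k *\<^sub>\<Omega> a)"
    using a(1) h holo_on_mult by (auto simp: entire_form_def smult_form_def zero_fun_def)
  then have "ext_d (f k *\<^sub>\<Omega> a) \<in> primitives" using True by (auto simp: primitives_def)
  moreover have "ext_d (f k *\<^sub>\<Omega> a) = d_comp f k \<and>\<^sub>\<Omega> a + f k *\<^sub>\<Omega> ext_d a"
    by (rule ext_d_smult[OF h]) (use a(1) in \<open>simp add: entire_form_def\<close>)
  then have "df_all K f \<and>\<^sub>\<Omega> ext_d (f k *\<^sub>\<Omega> a) = 0 + f k *\<^sub>\<Omega> (df_all K f \<and>\<^sub>\<Omega> \<beta>)"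
    by (simp only: wedge_add_right wedge_smult_right df_all_wedge_d_comp[OF assms(1)] a(2))
  ultimately show ?thesis by (metis add_0)
next
  case False
  then obtain g where g: "g \<in> poly_algebra {..<K} f" "\<beta> = fun_form g" using assms(2) by (auto simp: primitives_def)
  have "(\<lambda>u. f k u * g u) \<in> poly_algebra {..<K} f"
    using assms(1) g(1) by (intro poly_algebra_generator_mult) auto
  then have "fun_form (\<lambda>u. f k u * g u) \<in> primitives" using False by (auto simp: primitives_def)
  moreover have "f k *\<^sub>\<Omega> (df_all K f \<and>\<^sub>\<Omega> \<beta>) = df_all K f \<and>\<^sub>\<Omega> fun_form (\<lambda>u. f k u * g u)"
    by (intro ext) (simp add: g(2) wedge_fun_form smult_form_def)
  ultimately show ?thesis by blast
qed

text \<open>The case split isolates weight zero, where Cartan's formula cannot be divided by the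
  weight.\<close>

lemma primitives_reduce:
  assumes "hform N w \<omega>"
  shows "\<exists>\<beta>\<in>primitives. \<exists>\<gamma>. (\<forall>k<K. hform (N + K) (w + total_weight - p k) (\<gamma> k)) \<and>
    df_all K f \<and>\<^sub>\<Omega> \<omega> = df_all K f \<and>\<^sub>\<Omega> \<beta> + (\<Sum>k<K. f k *\<^sub>\<Omega> \<gamma> k)"
proof -
  have zero: "(\<Sum>k<K. f k *\<^sub>\<Omega> (0 :: 'n form)) = 0"
    by (simp only: smult_form_zero sum.neutral_const)
  consider "w \<le> 0" "N > 0 \<or> w < 0" | "w = 0" "N = 0" | "w > 0" "N = 0" | "w > 0" "N > 0" by linarith
  then show ?thesis
  proof cases
    case 1
    have "\<omega> = 0" by (rule hform_nonpos[OF assms 1])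
    then show ?thesis
      by (intro bexI[of _ 0] exI[of _ "\<lambda>_. 0"] conjI allI impI hform_zero primitives_zero) (simp only: zero add_0_right)
  next
    \<comment> \<open>Here \<open>\<omega>\<close> is constant, and constants belong to the algebra,
      so it is itself a primitive.\<close>
    case 2
    then have "\<omega> = fun_form (\<lambda>_. \<omega> {} 0)" using assms hform_0_0 by simp
    moreover have "fun_form (\<lambda>_. \<omega> {} 0) \<in> primitives"
      unfolding primitives_def using 2(2) by (simp add: poly_algebra_const)
    ultimately have "\<omega> \<in> primitives" by metis
    then show ?thesis
      by (intro bexI[of _ \<omega>] exI[of _ "\<lambda>_. 0"] conjI allI impI hform_zero) (simp only: zero add_0_right)
  next
    \<comment> \<open>A function contracts to zero, so only the combination of the
      \<open>f k\<close> remains.\<close>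
    case 3
    have "ext_d (contract_euler v \<omega>) = 0"
      using 3 assms hform_0_contract by (intro ext) (simp add: ext_d_def zero_fun_def partial_const)
    moreover obtain \<gamma> where "\<forall>k<K. hform (N + K) (w + total_weight - p k) (\<gamma> k)"
      "df_all K f \<and>\<^sub>\<Omega> \<omega> = df_all K f \<and>\<^sub>\<Omega> ((\<lambda>_. 1 / of_int w) *\<^sub>\<Omega> ext_d (contract_euler v \<omega>)) + (\<Sum>k<K. f k *\<^sub>\<Omega> \<gamma> k)"
      using df_all_reduce[OF assms] 3 by auto
    ultimately show ?thesis
      by (intro bexI[of _ 0] exI[of _ \<gamma>] conjI primitives_zero) (simp_all only: smult_form_zero)
  next
    case 4
    let ?c = "1 / of_int w :: complex"
    obtain m where m: "N = Suc m" using 4 by (cases N) auto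
    have h: "hform (N - 1) w (contract_euler v \<omega>)" using hform_contract[of m w \<omega>] assms m by simp
    have "ext_d ((\<lambda>_. ?c) *\<^sub>\<Omega> contract_euler v \<omega>) = (\<lambda>_. ?c) *\<^sub>\<Omega> ext_d (contract_euler v \<omega>)"
    proof (intro ext)
      fix I u
      have "partial i (((\<lambda>_. ?c) *\<^sub>\<Omega> contract_euler v \<omega>) J) u = ?c * partial i (contract_euler v \<omega> J) u" for i J
        unfolding smult_form_def by (rule partial_cmult[where S = UNIV, OF hform_holo_on[OF h] UNIV_I])
      then show "ext_d ((\<lambda>_. ?c) *\<^sub>\<Omega> contract_euler v \<omega>) I u = ((\<lambda>_. ?c) *\<^sub>\<Omega> ext_d (contract_euler v \<omega>)) I u"
        by (simp add: ext_d_def smult_form_def sum_divide_distrib)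
    qed
    moreover have "ext_d ((\<lambda>_. ?c) *\<^sub>\<Omega> contract_euler v \<omega>) \<in> primitives"
      using hform_entire[OF hform_cmult[OF h]] 4 by (auto simp: primitives_def)
    ultimately have "(\<lambda>_. ?c) *\<^sub>\<Omega> ext_d (contract_euler v \<omega>) \<in> primitives" by simp
    then show ?thesis using df_all_reduce[OF assms] 4 by (intro bexI) auto
  qed
qed

end

text \<open>\<open>b\<close> is the given basis and \<open>a\<close> consists of polynomial
  representatives of the same germs. Identities are proved for \<open>a\<close> as equalities of
  functions and carried back to \<open>b\<close> as equalities of germs.\<close>

locale graded_basis = graded_map v N K p f
  for v :: "'n::{finite,linorder} \<Rightarrow> nat" and N K p f +
  fixes \<mu> :: nat and b a :: "nat \<Rightarrow> 'n form" and d :: "nat \<Rightarrow> int"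
  assumes a_hform: "j \<in> {1..\<mu>} \<Longrightarrow> hform (N + K) (d j) (a j)"
    and b_germ: "j \<in> {1..\<mu>} \<Longrightarrow> b j =\<^sub>0 a j"
    and spanning: "\<And>\<omega>. \<omega> \<in> Omega (N + K) \<Longrightarrow>
      \<exists>c. \<omega> - (\<Sum>j=1..\<mu>. (\<lambda>_. c j) *\<^sub>\<Omega> b j) \<in> Phi_relations N K f"
begin

lemma homogeneous_step:
  assumes "hform (N + K) w \<alpha>"
  shows "\<exists>c \<omega> \<beta>. hform N (w - total_weight) \<omega> \<and> (\<forall>k<K. hform (N + K) (w - p k) (\<beta> k)) \<and>
    \<alpha> = (\<Sum>j=1..\<mu>. (\<lambda>_. c j) *\<^sub>\<Omega> a j) + (df_all K f \<and>\<^sub>\<Omega> \<omega> + (\<Sum>k<K. f k *\<^sub>\<Omega> \<beta> k))"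
proof -
  obtain c where "\<alpha> - (\<Sum>j=1..\<mu>. (\<lambda>_. c j) *\<^sub>\<Omega> b j) \<in> Phi_relations N K f"
    using spanning[OF hform_Omega[OF assms]] by blast
  then obtain \<omega> \<beta> where \<omega>: "\<omega> \<in> Omega N" and \<beta>: "\<And>k. k < K \<Longrightarrow> \<beta> k \<in> Omega (N + K)"
    and germ: "(\<alpha> - (\<Sum>j=1..\<mu>. (\<lambda>_. c j) *\<^sub>\<Omega> b j)) =\<^sub>0 (df_all K f \<and>\<^sub>\<Omega> \<omega> + (\<Sum>k<K. f k *\<^sub>\<Omega> \<beta> k))"
    unfolding Phi_relations_def by auto
  let ?S = "\<Sum>j=1..\<mu>. (\<lambda>_. c j) *\<^sub>\<Omega> a j"
  have S: "(\<Sum>j=1..\<mu>. (\<lambda>_. c j) *\<^sub>\<Omega> b j) =\<^sub>0 ?S"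
    using b_germ by (intro germ_eq_sum germ_eq_smult) auto
  have "\<alpha> =\<^sub>0 (?S + (df_all K f \<and>\<^sub>\<Omega> \<omega> + (\<Sum>k<K. f k *\<^sub>\<Omega> \<beta> k)))"
    unfolding germ_eq_def
  proof
    fix I
    show "\<forall>\<^sub>F u in nhds 0. \<alpha> I u = (?S + (df_all K f \<and>\<^sub>\<Omega> \<omega> + (\<Sum>k<K. f k *\<^sub>\<Omega> \<beta> k))) I u"
      using S[unfolded germ_eq_def, rule_format, of I] germ[unfolded germ_eq_def, rule_format, of I]
      by eventually_elim (simp add: diff_eq_eq add.commute)
  qed
  then have eq: "form_part w \<alpha> = form_part w (?S + (df_all K f \<and>\<^sub>\<Omega> \<omega> + (\<Sum>k<K. f k *\<^sub>\<Omega> \<beta> k)))"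
    by (rule form_part_cong)
  have h1: "holo_near 0 (((\<lambda>_. c j) *\<^sub>\<Omega> a j) I)" if "j \<in> {1..\<mu>}" for j I
    by (rule wpoly_holo_near[OF hform_wpoly[OF hform_cmult[OF a_hform[OF that]]]])
  have h2: "holo_near 0 ((f k *\<^sub>\<Omega> \<beta> k) I)" if "k \<in> {..<K}" for k I
    using that unfolding smult_form_def
    by (intro holo_near_mult wpoly_holo_near[OF f_wpoly] OmegaD_holo[OF \<beta>]) auto
  have h3: "holo_near 0 ((df_all K f \<and>\<^sub>\<Omega> \<omega>) I)" for I
    unfolding wedge_def
    by (intro holo_near_sum holo_near_mult holo_near_const wpoly_holo_near[OF hform_wpoly[OF hform_df_all]] OmegaD_holo[OF \<omega>])
  have h4: "holo_near 0 ((df_all K f \<and>\<^sub>\<Omega> \<omega> + (\<Sum>k<K. f k *\<^sub>\<Omega> \<beta> k)) I)" for I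
    unfolding plus_fun_apply plus_fun_def by (intro holo_near_add h3 holo_near_sum_form h2)
  \<comment> \<open>A multiple of \<open>a j\<close> has the single weight \<open>d j\<close>, so
    only basis forms of weight \<open>w\<close> keep their coefficient.\<close>
  have p1: "form_part w ((\<lambda>_. c j) *\<^sub>\<Omega> a j) = (\<lambda>_. if d j = w then c j else 0) *\<^sub>\<Omega> a j" if "j \<in> {1..\<mu>}" for j
    using form_part_hform[OF hform_cmult[OF a_hform[OF that]], of w "c j"]
    by (intro ext) (auto simp: smult_form_def)
  have p2: "form_part w (f k *\<^sub>\<Omega> \<beta> k) = f k *\<^sub>\<Omega> form_part (w - p k) (\<beta> k)" if "k \<in> {..<K}" for k
    using that by (intro form_part_smult f_wpoly OmegaD_holo[OF \<beta>]) auto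
  have p3: "form_part w (df_all K f \<and>\<^sub>\<Omega> \<omega>) = df_all K f \<and>\<^sub>\<Omega> form_part (w - total_weight) \<omega>"
    by (intro form_part_wedge[OF hform_df_all] OmegaD_holo[OF \<omega>])
  have p4: "form_part w ?S = (\<Sum>j=1..\<mu>. (\<lambda>_. if d j = w then c j else 0) *\<^sub>\<Omega> a j)"
    by (subst form_part_sum[OF h1], assumption) (intro sum.cong refl p1)
  have p5: "form_part w (\<Sum>k<K. f k *\<^sub>\<Omega> \<beta> k) = (\<Sum>k<K. f k *\<^sub>\<Omega> form_part (w - p k) (\<beta> k))"
    by (subst form_part_sum[OF h2], assumption) (intro sum.cong refl p2)
  have "\<alpha> = (\<Sum>j=1..\<mu>. (\<lambda>_. if d j = w then c j else 0) *\<^sub>\<Omega> a j)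
      + (df_all K f \<and>\<^sub>\<Omega> form_part (w - total_weight) \<omega> + (\<Sum>k<K. f k *\<^sub>\<Omega> form_part (w - p k) (\<beta> k)))"
  proof -
    have "\<alpha> = form_part w \<alpha>" using form_part_hform[OF assms, of w] by simp
    also have "\<dots> = form_part w ?S + form_part w (df_all K f \<and>\<^sub>\<Omega> \<omega> + (\<Sum>k<K. f k *\<^sub>\<Omega> \<beta> k))"
      unfolding eq by (intro form_part_add holo_near_sum_form h1 h4)
    also have "form_part w (df_all K f \<and>\<^sub>\<Omega> \<omega> + (\<Sum>k<K. f k *\<^sub>\<Omega> \<beta> k))
        = form_part w (df_all K f \<and>\<^sub>\<Omega> \<omega>) + form_part w (\<Sum>k<K. f k *\<^sub>\<Omega> \<beta> k)"
      by (intro form_part_add holo_near_sum_form h3 h2)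
    finally show ?thesis unfolding p3 p4 p5 .
  qed
  moreover have "hform N (w - total_weight) (form_part (w - total_weight) \<omega>)" by (rule hform_form_part[OF \<omega>])
  moreover have "\<forall>k<K. hform (N + K) (w - p k) (form_part (w - p k) (\<beta> k))" using hform_form_part[OF \<beta>] by blast
  ultimately show ?thesis
    by (intro exI[of _ "\<lambda>j. if d j = w then c j else 0"] exI[of _ "form_part (w - total_weight) \<omega>"]
        exI[of _ "\<lambda>k. form_part (w - p k) (\<beta> k)"] conjI)
qed

lemma homogeneous_decomposition:
  assumes "hform (N + K) w \<alpha>"
  shows "\<exists>P. (\<forall>j. P j \<in> poly_algebra {..<K} f) \<and> (\<exists>\<beta>\<in>primitives.
    \<alpha> = (\<Sum>j=1..\<mu>. P j *\<^sub>\<Omega> a j) + df_all K f \<and>\<^sub>\<Omega> \<beta>)"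
  using assms
\<comment> \<open>The shift by one makes the measure drop even from weight zero to a negative
  weight.\<close>
proof (induction "nat (w + 1)" arbitrary: w \<alpha> rule: less_induct)
  case less
  have null: "\<exists>P. (\<forall>j. P j \<in> poly_algebra {..<K} f) \<and> (\<exists>\<beta>\<in>primitives.
    0 = (\<Sum>j=1..\<mu>. P j *\<^sub>\<Omega> a j) + df_all K f \<and>\<^sub>\<Omega> \<beta>)"
  proof (intro exI[of _ "\<lambda>_ _. 0"] conjI allI poly_algebra_const bexI[of _ 0] primitives_zero)
    have "(\<lambda>_. 0) *\<^sub>\<Omega> a j = 0" for j by (intro ext) (simp add: smult_form_def)
    then show "0 = (\<Sum>j=1..\<mu>. (\<lambda>_. 0) *\<^sub>\<Omega> a j) + df_all K f \<and>\<^sub>\<Omega> 0"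
      by (simp only: sum.neutral_const wedge_zero_right add_0_right)
  qed
  show ?case
  proof (cases "w < 0")
    case True
    then have "\<alpha> = 0" using hform_nonpos[OF less.prems] by simp
    then show ?thesis using null by (simp only:)
  next
    case False
    obtain c \<omega> \<beta> where \<omega>: "hform N (w - total_weight) \<omega>" and \<beta>: "\<And>k. k < K \<Longrightarrow> hform (N + K) (w - p k) (\<beta> k)"
      and \<alpha>: "\<alpha> = (\<Sum>j=1..\<mu>. (\<lambda>_. c j) *\<^sub>\<Omega> a j) + (df_all K f \<and>\<^sub>\<Omega> \<omega> + (\<Sum>k<K. f k *\<^sub>\<Omega> \<beta> k))"
      using homogeneous_step[OF less.prems] by blast
    obtain \<eta> \<gamma> where \<eta>: "\<eta> \<in> primitives" and \<gamma>: "\<And>k. k < K \<Longrightarrow> hform (N + K) (w - p k) (\<gamma> k)"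
      and red: "df_all K f \<and>\<^sub>\<Omega> \<omega> = df_all K f \<and>\<^sub>\<Omega> \<eta> + (\<Sum>k<K. f k *\<^sub>\<Omega> \<gamma> k)"
      using primitives_reduce[OF \<omega>] by auto
    have ex: "\<exists>Q. (\<forall>j. Q j \<in> poly_algebra {..<K} f) \<and> (\<exists>\<xi>\<in>primitives.
        f k *\<^sub>\<Omega> (\<beta> k + \<gamma> k) = (\<Sum>j=1..\<mu>. Q j *\<^sub>\<Omega> a j) + df_all K f \<and>\<^sub>\<Omega> \<xi>)" if k: "k < K" for k
    \<comment> \<open>Descent requires \<open>p k > 0\<close>, which is known unless
      \<open>f k\<close> vanishes identically; in that case the product is zero.\<close>
    proof (cases "f k = 0")
      case True
      then have "f k *\<^sub>\<Omega> (\<beta> k + \<gamma> k) = 0" by (intro ext) (simp add: smult_form_def)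
      then show ?thesis using null by (simp only:)
    next
      case False
      then have "nat (w - p k + 1) < nat (w + 1)" using f_zero_or_pos[OF k] \<open>\<not> w < 0\<close> by auto
      from less.hyps[OF this hform_add[OF \<beta>[OF k] \<gamma>[OF k]]]
      obtain Q \<xi> where Q: "\<And>j. Q j \<in> poly_algebra {..<K} f" and \<xi>: "\<xi> \<in> primitives"
        and eq: "\<beta> k + \<gamma> k = (\<Sum>j=1..\<mu>. Q j *\<^sub>\<Omega> a j) + df_all K f \<and>\<^sub>\<Omega> \<xi>" by blast
      obtain \<zeta> where \<zeta>: "\<zeta> \<in> primitives" "f k *\<^sub>\<Omega> (df_all K f \<and>\<^sub>\<Omega> \<xi>) = df_all K f \<and>\<^sub>\<Omega> \<zeta>"
        using primitives_generator_mult[OF k \<xi>] by blast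
      have "f k *\<^sub>\<Omega> (\<beta> k + \<gamma> k) = (\<Sum>j=1..\<mu>. (\<lambda>u. f k u * Q j u) *\<^sub>\<Omega> a j) + f k *\<^sub>\<Omega> (df_all K f \<and>\<^sub>\<Omega> \<xi>)"
        unfolding eq by (intro ext) (simp add: smult_form_def sum_form_apply distrib_left sum_distrib_left mult.assoc)
      moreover have "(\<lambda>u. f k u * Q j u) \<in> poly_algebra {..<K} f" for j
        using k by (intro poly_algebra_generator_mult Q) auto
      ultimately show ?thesis using \<zeta> by (intro exI[of _ "\<lambda>j u. f k u * Q j u"] conjI allI bexI[of _ \<zeta>]) simp_all
    qed
    have "\<forall>k\<in>{..<K}. \<exists>Q. (\<forall>j. Q j \<in> poly_algebra {..<K} f) \<and> (\<exists>\<xi>\<in>primitives.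
        f k *\<^sub>\<Omega> (\<beta> k + \<gamma> k) = (\<Sum>j=1..\<mu>. Q j *\<^sub>\<Omega> a j) + df_all K f \<and>\<^sub>\<Omega> \<xi>)"
      using ex by simp
    from bchoice[OF this] obtain Q where Q': "\<forall>k\<in>{..<K}. (\<forall>j. Q k j \<in> poly_algebra {..<K} f) \<and>
        (\<exists>\<xi>\<in>primitives. f k *\<^sub>\<Omega> (\<beta> k + \<gamma> k) = (\<Sum>j=1..\<mu>. Q k j *\<^sub>\<Omega> a j) + df_all K f \<and>\<^sub>\<Omega> \<xi>)" ..
    then have "\<forall>k\<in>{..<K}. \<exists>\<xi>. \<xi> \<in> primitives \<and>
        f k *\<^sub>\<Omega> (\<beta> k + \<gamma> k) = (\<Sum>j=1..\<mu>. Q k j *\<^sub>\<Omega> a j) + df_all K f \<and>\<^sub>\<Omega> \<xi>" by blast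
    from bchoice[OF this] obtain \<xi> where \<xi>': "\<forall>k\<in>{..<K}. \<xi> k \<in> primitives \<and>
        f k *\<^sub>\<Omega> (\<beta> k + \<gamma> k) = (\<Sum>j=1..\<mu>. Q k j *\<^sub>\<Omega> a j) + df_all K f \<and>\<^sub>\<Omega> \<xi> k" ..
    have Q: "Q k j \<in> poly_algebra {..<K} f" if "k < K" for k j using Q' that by simp
    have \<xi>: "\<xi> k \<in> primitives" if "k < K" for k using \<xi>' that by simp
    have eq: "f k *\<^sub>\<Omega> (\<beta> k + \<gamma> k) = (\<Sum>j=1..\<mu>. Q k j *\<^sub>\<Omega> a j) + df_all K f \<and>\<^sub>\<Omega> \<xi> k" if "k < K" for k
      using \<xi>' that by (simp only: lessThan_iff ball_simps)
    define P where "P j = (\<lambda>u. c j + (\<Sum>k<K. Q k j u))" for j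
    define \<zeta> where "\<zeta> = \<eta> + (\<Sum>k<K. \<xi> k)"
    have "P j \<in> poly_algebra {..<K} f" for j
      unfolding P_def by (intro poly_algebra_add poly_algebra_const poly_algebra_sum Q) auto
    moreover have "\<zeta> \<in> primitives"
      unfolding \<zeta>_def by (intro primitives_add \<eta> primitives_sum \<xi>) auto
    moreover have "\<alpha> = (\<Sum>j=1..\<mu>. P j *\<^sub>\<Omega> a j) + df_all K f \<and>\<^sub>\<Omega> \<zeta>"
    proof (intro ext)
      fix I u
      have eq': "f k u * \<beta> k I u + f k u * \<gamma> k I u = (\<Sum>j=1..\<mu>. Q k j u * a j I u) + (df_all K f \<and>\<^sub>\<Omega> \<xi> k) I u"
        if "k < K" for k
        using fun_cong[OF fun_cong[OF eq[OF that], of I], of u]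
        by (simp add: smult_form_def sum_form_apply distrib_left)
      have "\<alpha> I u = (\<Sum>j=1..\<mu>. c j * a j I u) + (df_all K f \<and>\<^sub>\<Omega> \<eta>) I u
          + (\<Sum>k<K. f k u * \<beta> k I u + f k u * \<gamma> k I u)"
        unfolding \<alpha> red by (simp add: smult_form_def sum_form_apply sum.distrib)
      also have "(\<Sum>k<K. f k u * \<beta> k I u + f k u * \<gamma> k I u)
          = (\<Sum>j=1..\<mu>. (\<Sum>k<K. Q k j u) * a j I u) + (\<Sum>k<K. (df_all K f \<and>\<^sub>\<Omega> \<xi> k) I u)"
        unfolding sum_distrib_right by (subst sum.swap) (simp add: eq' sum.distrib)
      finally show "\<alpha> I u = ((\<Sum>j=1..\<mu>. P j *\<^sub>\<Omega> a j) + df_all K f \<and>\<^sub>\<Omega> \<zeta>) I u"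
        unfolding \<zeta>_def wedge_add_right wedge_sum_right
        by (simp add: smult_form_def sum_form_apply P_def distrib_right sum.distrib)
    qed
    ultimately show ?thesis by blast
  qed
qed

end

section \<open>The case of one variable\<close>

lemma (in weights) wpoly_one_variable:
  assumes "v i = 1" "UNIV = {i}" "wpoly w g"
  shows "\<exists>c. \<forall>u. g u = c * (u $ i) ^ nat w"
  using assms(3)
proof (induction rule: wpoly.induct)
  case (add w g h)
  then obtain c d where "\<forall>u. g u = c * (u $ i) ^ nat w" "\<forall>u. h u = d * (u $ i) ^ nat w" by blast
  then show ?case by (intro exI[of _ "c + d"]) (simp add: distrib_right)
next
  case (coord w g j)
  have j: "j = i" using assms(2) by blast
  obtain c where c: "\<forall>u. g u = c * (u $ i) ^ nat w" using coord.IH by blast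
  show ?case
  \<comment> \<open>For negative \<open>w\<close> the truncation by \<open>nat\<close> spoils the
    exponents, but then \<open>g\<close> is zero.\<close>
  proof (cases "w < 0")
    case True
    then show ?thesis using wpoly_neg[OF coord.hyps] by (intro exI[of _ 0]) simp
  next
    case False
    then have "nat (w + int (v j)) = Suc (nat w)" using assms(1) j by simp
    then show ?thesis using c j by (intro exI[of _ c]) simp
  qed
qed (auto intro: exI[of _ 0])

context graded_map
begin

lemma hform_df_omit:
  assumes "l < K"
  shows "\<exists>w. hform (K - 1) w (df_omit K f l)"
proof -
  let ?ks = "filter (\<lambda>k. k \<noteq> l) [0..<K]"
  have "length ?ks = card (set ?ks)" by (rule distinct_card[symmetric]) simp
  also have "set ?ks = {0..<K} - {l}" by auto
  also have "card \<dots> = K - 1" using assms by simp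
  finally show ?thesis
    using hform_big_wedge[of ?ks p f] f_wpoly unfolding df_omit_def by auto
qed

text \<open>The greatest common divisor makes the only coordinate weight one. So \<open>df_0\<close>
  is a multiple of \<open>u^(p 0 - 1) du\<close> and \<open>\<alpha>\<close> one of
  \<open>u^(w - 1) du\<close>; their quotient is a monomial once \<open>p 0 \<le> w\<close>.\<close>

lemma one_variable_multiple_of_df:
  assumes "N = 0" "K = 1" "Gcd (range v) = 1" "f 0 \<noteq> 0" "hform 1 w \<alpha>" "p 0 \<le> w"
  shows "\<exists>g. holo_on UNIV g \<and> \<alpha> = d_comp f 0 \<and>\<^sub>\<Omega> fun_form g"
proof -
  obtain i :: 'n where i: "UNIV = {i}" using dim assms(1,2) card_1_singletonE[of "UNIV :: 'n set"] by auto
  have "range v = {v i}" unfolding i by simp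
  then have v1: "v i = 1" using assms(3) by simp
  have p0: "p 0 > 0" using f_zero_or_pos[of 0] assms(2,4) by auto
  have f0: "wpoly (p 0) (f 0)" using f_wpoly assms(2) by simp
  obtain c where c: "\<And>u. partial i (f 0) u = c * (u $ i) ^ nat (p 0 - 1)"
    using wpoly_one_variable[OF v1 i wpoly_partial[OF f0, of i]] v1 by auto
  obtain b where b: "\<And>u. \<alpha> {i} u = b * (u $ i) ^ nat (w - 1)"
    using wpoly_one_variable[OF v1 i hform_wpoly[OF assms(5), of "{i}"]] v1 by (auto simp: wt_def)
  \<comment> \<open>Otherwise Euler's formula with \<open>p 0 > 0\<close> would give
    \<open>f 0 = 0\<close>.\<close>
  have "c \<noteq> 0"
  proof
    assume "c = 0"
    have "f 0 u = 0" for u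
      using wpoly_euler[OF f0, of u] c[of u] p0 \<open>c = 0\<close> by (simp add: euler_def i)
    then show False using assms(4) by auto
  qed
  define g where "g = (\<lambda>u. (b / c) * (u $ i) ^ nat (w - p 0))"
  \<comment> \<open>The bounds \<open>p 0 > 0\<close> and \<open>p 0 \<le> w\<close> keep
    \<open>nat\<close> from truncating.\<close>
  have "nat (w - 1) = nat (w - p 0) + nat (p 0 - 1)" using assms(6) p0 by simp
  then have gi: "\<alpha> {i} u = g u * partial i (f 0) u" for u
    using \<open>c \<noteq> 0\<close> by (simp add: b c g_def power_add)
  have "\<alpha> = d_comp f 0 \<and>\<^sub>\<Omega> fun_form g"
  proof (intro ext)
    fix I :: "'n set" and u
    have "I \<subseteq> {i}" unfolding i[symmetric] by (rule subset_UNIV)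
    then have "I = {} \<or> I = {i}" by (rule subset_singletonD)
    then show "\<alpha> I u = (d_comp f 0 \<and>\<^sub>\<Omega> fun_form g) I u"
    proof
      assume "I = {}"
      then show ?thesis
        using assms(5) one_form_d_comp[of f 0]
        by (simp add: wedge_fun_form smult_form_def hform_def one_form_def)
    qed (simp add: wedge_fun_form smult_form_def d_comp_singleton gi)
  qed
  moreover have "holo_on UNIV g"
    unfolding g_def by (intro holo_on_mult holo_on_const holo_on_power holo_on_coord)
  ultimately show ?thesis by blast
qed

end

text \<open>For the zero map every point lies in the zero fibre and is critical, so the isolatedness
  condition would fail at all points near the origin.\<close>

lemma quasihomogeneous_icis_f_nonzero:
  fixes f :: "nat \<Rightarrow> 'n::{finite,linorder} scalar_fn"
  assumes "quasihomogeneous_icis N 1 v p f"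
  shows "f 0 \<noteq> 0"
proof
  assume f: "f 0 = 0"
  have "df_all 1 f I u = 0" for I u
  proof -
    have "d_comp f 0 = 0"
      by (intro ext) (auto simp: ext_d_def fun_form_def f zero_fun_def partial_const intro!: sum.neutral)
    then show ?thesis by (simp add: df_all_def big_wedge_def wedge_def)
  qed
  then have "eventually (\<lambda>_. False) (at (0 :: (complex, 'n) vec))"
    using assms by (simp add: quasihomogeneous_icis_def fibre_def critical_set_def f)
  then show False by simp
qed

theorem proposition5:
  fixes N K \<mu> :: nat
    and v :: "'n::{finite,linorder} \<Rightarrow> nat"
    and p :: "nat \<Rightarrow> int"
    and f :: "nat \<Rightarrow> 'n scalar_fn"
    and \<omega> :: "nat \<Rightarrow> 'n form"
    and \<phi> :: "nat \<Rightarrow> 'n scalar_fn"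
  assumes "quasihomogeneous_icis N K v p f"
    and "\<mu> = milnor_number N K f"
    and "\<And>i. i \<in> {1..\<mu>} \<Longrightarrow> quasihomogeneous_form v (\<omega> i)"
    and "basis_mod (Omega (N + 1)) (F_relations N K v f) \<mu> \<omega>"
    and "\<And>j. j \<in> {1..\<mu>} \<Longrightarrow> quasihomogeneous_form v (top_form (\<phi> j))"
    and "basis_mod (Omega (N + K)) (Phi_relations N K f) \<mu> (\<lambda>j. top_form (\<phi> j))"
  shows "\<forall>i\<in>{1..\<mu>}. \<forall>l<K. \<exists>P. (\<forall>j\<in>{1..\<mu>}. P j \<in> poly_algebra {..<K} f) \<and>
           (\<exists>\<eta>\<in>exact_forms N K f.
              \<omega> i \<and>\<^sub>\<Omega> df_omit K f l =\<^sub>0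
                (\<Sum>j=1..\<mu>. P j *\<^sub>\<Omega> top_form (\<phi> j)) + df_all K f \<and>\<^sub>\<Omega> \<eta>)"
proof (intro ballI allI impI)
  fix i l assume i: "i \<in> {1..\<mu>}" and l: "l < K"
  have icis: "CARD('n) = N + K" "\<And>l. l < K \<Longrightarrow> f l \<in> poly_algebra UNIV (\<lambda>i u. u $ i)"
    "\<And>l. l < K \<Longrightarrow> f l 0 = 0" "\<And>i. v i > 0" "Gcd (range v) = 1"
    "\<And>l u. l < K \<Longrightarrow> euler v (f l) u = of_int (p l) * f l u"
    using assms(1) unfolding quasihomogeneous_icis_def by auto
  interpret form_weights v by unfold_locales (rule icis(4))
  interpret graded_map v N K p f
  proof
    show "wpoly (p k) (f k)" if "k < K" for k
      by (intro wpoly_of_euler_UNIV holo_on_poly_algebra[OF icis(2)] icis(6) that)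
  qed (rule icis | assumption)+
  \<comment> \<open>Weight and polynomial representative form one pair, so a single choice yields
    both.\<close>
  have "\<forall>j\<in>{1..\<mu>}. \<exists>wa. hform (N + K) (fst wa) (snd wa) \<and> top_form (\<phi> j) =\<^sub>0 snd wa"
  proof
    fix j assume j: "j \<in> {1..\<mu>}"
    then have "top_form (\<phi> j) \<in> Omega (N + K)" using assms(6) by (simp add: basis_mod_def)
    then show "\<exists>wa. hform (N + K) (fst wa) (snd wa) \<and> top_form (\<phi> j) =\<^sub>0 snd wa"
      using quasihomogeneous_imp_hform[OF _ assms(5)[OF j]] by simp
  qed
  from bchoice[OF this] obtain wa
    where wa: "\<forall>j\<in>{1..\<mu>}. hform (N + K) (fst (wa j)) (snd (wa j)) \<and> top_form (\<phi> j) =\<^sub>0 snd (wa j)" ..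
  define a where "a j = snd (wa j)" for j
  interpret graded_basis v N K p f \<mu> "\<lambda>j. top_form (\<phi> j)" a "\<lambda>j. fst (wa j)"
    using wa assms(6) by unfold_locales (auto simp: a_def basis_mod_def)
  have \<omega>_Omega: "\<omega> i \<in> Omega (N + 1)" using assms(4) i by (simp add: basis_mod_def)
  obtain w \<alpha> where \<alpha>: "hform (N + 1) w \<alpha>" and \<omega>\<alpha>: "\<omega> i =\<^sub>0 \<alpha>"
    using quasihomogeneous_imp_hform[OF \<omega>_Omega assms(3)[OF i]] by blast
  have basis_germ: "(\<Sum>j=1..\<mu>. P j *\<^sub>\<Omega> top_form (\<phi> j)) =\<^sub>0 (\<Sum>j=1..\<mu>. P j *\<^sub>\<Omega> a j)" for P
    using b_germ by (intro germ_eq_sum germ_eq_smult)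
  have conclude: "\<omega> i \<and>\<^sub>\<Omega> df_omit K f l =\<^sub>0 (\<Sum>j=1..\<mu>. P j *\<^sub>\<Omega> top_form (\<phi> j)) + df_all K f \<and>\<^sub>\<Omega> \<eta>"
    \<comment> \<open>It suffices to decompose polynomial representatives: replacing them by the
      given forms changes neither germ.\<close>
    if "\<alpha> \<and>\<^sub>\<Omega> df_omit K f l = (\<Sum>j=1..\<mu>. P j *\<^sub>\<Omega> a j) + df_all K f \<and>\<^sub>\<Omega> \<eta>" for P \<eta>
    unfolding germ_eq_def
  proof
    fix I
    show "\<forall>\<^sub>F u in nhds 0. (\<omega> i \<and>\<^sub>\<Omega> df_omit K f l) I u
        = ((\<Sum>j=1..\<mu>. P j *\<^sub>\<Omega> top_form (\<phi> j)) + df_all K f \<and>\<^sub>\<Omega> \<eta>) I u"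
      using germ_eq_wedge_left[OF \<omega>\<alpha>, of "df_omit K f l", unfolded germ_eq_def that, rule_format, of I]
        basis_germ[of P, unfolded germ_eq_def, rule_format, of I]
      by eventually_elim simp
  qed
  show "\<exists>P. (\<forall>j\<in>{1..\<mu>}. P j \<in> poly_algebra {..<K} f) \<and> (\<exists>\<eta>\<in>exact_forms N K f.
      \<omega> i \<and>\<^sub>\<Omega> df_omit K f l =\<^sub>0 (\<Sum>j=1..\<mu>. P j *\<^sub>\<Omega> top_form (\<phi> j)) + df_all K f \<and>\<^sub>\<Omega> \<eta>)"
  proof (cases "N \<ge> 1 \<or> K \<ge> 2")
    case True
    obtain w' where "hform (K - 1) w' (df_omit K f l)" using hform_df_omit[OF l] by blast
    \<comment> \<open>The degree \<open>(N + 1) + (K - 1)\<close> equals \<open>N + K\<close>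
      because \<open>l < K\<close> makes \<open>K\<close> positive.\<close>
    from hform_wedge[OF \<alpha> this] have "hform (N + K) (w + w') (\<alpha> \<and>\<^sub>\<Omega> df_omit K f l)" using l by simp
    from homogeneous_decomposition[OF this]
    obtain P \<beta> where P: "\<And>j. P j \<in> poly_algebra {..<K} f" and \<beta>: "\<beta> \<in> primitives"
      and eq: "\<alpha> \<and>\<^sub>\<Omega> df_omit K f l = (\<Sum>j=1..\<mu>. P j *\<^sub>\<Omega> a j) + df_all K f \<and>\<^sub>\<Omega> \<beta>" by blast
    show ?thesis
      by (intro exI[of _ P] conjI ballI P bexI[of _ \<beta>] conclude[OF eq] subsetD[OF primitives_exact[OF True] \<beta>])
  next
    case False
    then have N: "N = 0" and K: "K = 1" and l0: "l = 0" using l by auto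
    have f0: "f 0 \<noteq> 0" using quasihomogeneous_icis_f_nonzero assms(1) K by simp
    have "w < p 0"
    proof (rule ccontr)
      assume "\<not> w < p 0"
      moreover have "hform 1 w \<alpha>" using \<alpha> by (simp add: N)
      ultimately obtain g where g: "holo_on UNIV g" "\<alpha> = d_comp f 0 \<and>\<^sub>\<Omega> fun_form g"
        using one_variable_multiple_of_df[OF N K icis(5) f0, of w \<alpha>] by (auto simp: not_less)
      have "fun_form g \<in> Omega 0"
        using g(1) by (auto simp: Omega_def fun_form_def zero_fun_def intro: holo_on_UNIV_near holo_near_const)
      moreover have "(0 :: 'n form) \<in> Omega (N + 2)" by (rule hform_Omega[OF hform_zero])
      moreover have "contract_euler v (0 :: 'n form) = 0" by (intro ext) (simp add: contract_euler_def)
      ultimately have "\<omega> i \<in> F_relations N K v f"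
        unfolding F_relations_def using \<omega>_Omega \<omega>\<alpha> g(2)
        by (intro CollectI conjI exI[of _ "\<lambda>_. fun_form g"] exI[of _ 0]) (simp_all add: N K)
      \<comment> \<open>Indicator coefficients write \<open>\<omega> i\<close> as a combination of
        the basis; its class being zero, independence would force \<open>e i = 0\<close>.\<close>
      moreover define e :: "nat \<Rightarrow> complex" where "e j = (if j = i then 1 else 0)" for j
      have "(\<Sum>j=1..\<mu>. (\<lambda>_. e j) *\<^sub>\<Omega> \<omega> j) = \<omega> i"
      proof (intro ext)
        fix I u
        have "(\<Sum>j=1..\<mu>. (\<lambda>_. e j) *\<^sub>\<Omega> \<omega> j) I u = (\<Sum>j=1..\<mu>. if j = i then \<omega> j I u else 0)"
          unfolding sum_form_apply by (intro sum.cong refl) (simp add: smult_form_def e_def)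
        then show "(\<Sum>j=1..\<mu>. (\<lambda>_. e j) *\<^sub>\<Omega> \<omega> j) I u = \<omega> i I u"
          using i by simp
      qed
      ultimately have "(\<Sum>j=1..\<mu>. (\<lambda>_. e j) *\<^sub>\<Omega> \<omega> j) \<in> F_relations N K v f" by simp
      then have "\<forall>j\<in>{1..\<mu>}. e j = 0"
        using assms(4)[unfolded basis_mod_def, THEN conjunct2, THEN conjunct1, THEN spec] by (rule rev_mp)
      from bspec[OF this i] show False by (simp add: e_def)
    qed
    have "hform (N + K) w \<alpha>" using \<alpha> by (simp add: K)
    then obtain c \<xi> \<beta> where \<xi>: "hform N (w - total_weight) \<xi>" and \<beta>: "\<And>k. k < K \<Longrightarrow> hform (N + K) (w - p k) (\<beta> k)"
      and eq: "\<alpha> = (\<Sum>j=1..\<mu>. (\<lambda>_. c j) *\<^sub>\<Omega> a j) + (df_all K f \<and>\<^sub>\<Omega> \<xi> + (\<Sum>k<K. f k *\<^sub>\<Omega> \<beta> k))"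
      using homogeneous_step by blast
    \<comment> \<open>For \<open>K = 1\<close> both \<open>\<xi>\<close> and
      \<open>\<beta> 0\<close> have weight \<open>w - p 0\<close>, which is negative, so they
      vanish.\<close>
    have "total_weight = p 0" by (subst total_weight_def) (simp add: K)
    then have "\<xi> = 0" using \<open>w < p 0\<close> by (intro hform_nonpos[OF \<xi>]) auto
    moreover have "\<beta> 0 = 0" using hform_nonpos[OF \<beta>[of 0]] \<open>w < p 0\<close> K by simp
    then have "(\<Sum>k<K. f k *\<^sub>\<Omega> \<beta> k) = 0" by (simp add: K smult_form_zero)
    ultimately have \<alpha>_eq: "\<alpha> = (\<Sum>j=1..\<mu>. (\<lambda>_. c j) *\<^sub>\<Omega> a j) + df_all K f \<and>\<^sub>\<Omega> 0"
      using eq by (simp only: add_0_right)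
    \<comment> \<open>With \<open>K = 1\<close> no factor is left, and the empty product is the
      function 1.\<close>
    have "df_omit K f l = fun_form 1" by (simp add: df_omit_def big_wedge_def K l0)
    then have "\<alpha> \<and>\<^sub>\<Omega> df_omit K f l = \<alpha>" by (intro ext) (simp add: wedge_fun_form smult_form_def)
    then have eq': "\<alpha> \<and>\<^sub>\<Omega> df_omit K f l = (\<Sum>j=1..\<mu>. (\<lambda>_. c j) *\<^sub>\<Omega> a j) + df_all K f \<and>\<^sub>\<Omega> 0"
      using \<alpha>_eq by (simp only:)
    have "0 \<in> exact_forms N K f" by (simp add: exact_forms_def N K)
    then show ?thesis
      by (intro exI[of _ "\<lambda>j _. c j"] conjI ballI poly_algebra_const bexI[of _ 0] conclude[OF eq'])
  qed
qed

end
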